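(* Let $\mathcal{G}=(X,Y,A,B,\lambda)$ be an imitation game and let $p$ be a non-signalling correlation on $(X,Y,A,B)$. The following statements are equivalent: (a) $p\in\mathcal{C}_{\rm qc}(\mathcal{G})$; (b) the C*-algebra of the game $C^*(\mathcal{G})$ is nonzero, and there exists a tracial state $\tau$ on $C^*(\mathcal{G})$ such that $p(a,b|x,y)=\tau(p_{x,a}q_{y,b})$ for all $(x,y,a,b)\in X\times Y\times A\times B$.
   Context: $X,Y,A,B$ are finite non-empty sets. A non-signalling game is a tuple $\mathcal{G}=(X,Y,A,B,\lambda)$ with $\lambda:X\times Y\times A\times B\to\{0,1\}$. It is an imitation game if: (1) for every $x\in X$ and $a,a'\in A$ with $a\ne a'$ there is $y\in Y$ with $\sum_{b\in B}\lambda(x,y,a,b)\lambda(x,y,a',b)=0$; and (2) for every $y\in Y$ and $b,b'\in B$ with $b\neq b'$ there is $x\in X$ with $\sum_{a\in A}\lambda(x,y,a,b)\lambda(x,y,a,b')=0$. The game C*-algebra $C^*(\mathcal{G})$ is the universal unital C*-algebra generated by projections $(p_{x,a})_{x\in X,a\in A}$ and $(q_{y,b})_{y\in Y,b\in B}$ satisfying $\sum_{a}p_{x,a}=1$ for every $x$, $\sum_{b}q_{y,b}=1$ for every $y$, and $p_{x,a}q_{y,b}=0$ whenever $\lambda(x,y,a,b)=0$. The zero C*-algebra is regarded as a unital C*-algebra, so $C^*(\mathcal{G})=\{0\}$ is possible. A non-signalling correlation on $(X,Y,A,B)$ is a family $p=\{p(a,b|x,y)\}$ such that each $p(\cdot,\cdot|x,y)$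 is a probability distribution on $A\times B$, $\sum_{b}p(a,b|x,y)=\sum_b p(a,b|x,y')$ for all $x,y,y',a$, and $\sum_a p(a,b|x,y)=\sum_a p(a,b|x',y)$ for all $x,x',y,b$. A PVM is a finite tuple of projections on a Hilbert space summing to the identity. $\mathcal{C}_{\rm qc}$ is the set of correlations $p(a,b|x,y)=\langle\xi|P_{x,a}Q_{y,b}|\xi\rangle$ with $\xi$ a unit vector in a Hilbert space $\mathcal{H}$, $(P_{x,a})_{a\in A}$, $(Q_{y,b})_{b\in B}$ PVMs on $\mathcal{H}$ for all $x,y$, and $P_{x,a}Q_{y,b}=Q_{y,b}P_{x,a}$ for all $x,y,a,b$. $\mathcal{C}_{\rm qc}(\mathcal{G})=\{p\in\mathcal{C}_{\rm qc}:\lambda(x,y,a,b)=0\Rightarrow p(a,b|x,y)=0\}$. *)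

theory Defs
  imports
    "HOL-Analysis.Analysis"
    "HOL-Algebra.Module"
    "HOL-Library.Equipollence"
begin

section \<open>Games and correlations\<close>

text \<open>
  The finite non-empty sets \<open>X\<close>, \<open>Y\<close>, \<open>A\<close>, \<open>B\<close> are the types \<open>'x\<close>, \<open>'y\<close>, \<open>'a\<close>, \<open>'b\<close> of class
  \<open>finite\<close>. A correlation takes its arguments in the order of \<open>p(a,b|x,y)\<close>.
\<close>

type_synonym ('x, 'y, 'a, 'b) rule = "'x \<Rightarrow> 'y \<Rightarrow> 'a \<Rightarrow> 'b \<Rightarrow> nat"
type_synonym ('x, 'y, 'a, 'b) correlation = "'a \<Rightarrow> 'b \<Rightarrow> 'x \<Rightarrow> 'y \<Rightarrow> real"

definition nonsignalling_game ::
    "('x::finite, 'y::finite, 'a::finite, 'b::finite) rule \<Rightarrow> bool" where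
  "nonsignalling_game lam \<longleftrightarrow> (\<forall>x y a b. lam x y a b \<in> {0, 1})"

definition imitation_game ::
    "('x::finite, 'y::finite, 'a::finite, 'b::finite) rule \<Rightarrow> bool" where
  "imitation_game lam \<longleftrightarrow>
     nonsignalling_game lam \<and>
     (\<forall>x a a'. a \<noteq> a' \<longrightarrow> (\<exists>y. (\<Sum>b\<in>UNIV. lam x y a b * lam x y a' b) = 0)) \<and>
     (\<forall>y b b'. b \<noteq> b' \<longrightarrow> (\<exists>x. (\<Sum>a\<in>UNIV. lam x y a b * lam x y a b') = 0))"

definition nonsignalling_correlation ::
    "('x::finite, 'y::finite, 'a::finite, 'b::finite) correlation \<Rightarrow> bool" where
  "nonsignalling_correlation p \<longleftrightarrow>
     (\<forall>x y. (\<forall>a b. 0 \<le> p a b x y) \<and> (\<Sum>a\<in>UNIV. \<Sum>b\<in>UNIV. p a b x y) = 1) \<and>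
     (\<forall>x y y' a. (\<Sum>b\<in>UNIV. p a b x y) = (\<Sum>b\<in>UNIV. p a b x y')) \<and>
     (\<forall>x x' y b. (\<Sum>a\<in>UNIV. p a b x y) = (\<Sum>a\<in>UNIV. p a b x' y))"


section \<open>Complex Hilbert spaces\<close>

definition complex_ring :: "complex ring" where
  "complex_ring = \<lparr>carrier = UNIV, mult = (*), one = 1, zero = 0, add = (+)\<rparr>"

text \<open>
  As usual for \<open>module\<close>, the fields \<open>mult\<close> and \<open>one\<close> of a Hilbert space are unused. The inner
  product is conjugate-linear in its first argument.
\<close>

record 'h inner_product_space = "(complex, 'h) module" +
  inner_prod :: "'h \<Rightarrow> 'h \<Rightarrow> complex"

definition hnorm :: "('h, 'm) inner_product_space_scheme \<Rightarrow> 'h \<Rightarrow> real" where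
  "hnorm H u = sqrt (Re (inner_prod H u u))"

locale hilbert_space = module complex_ring H
  for H :: "('h, 'm) inner_product_space_scheme" (structure) +
  assumes inner_add_right:
      "\<lbrakk>u \<in> carrier H; v \<in> carrier H; w \<in> carrier H\<rbrakk> \<Longrightarrow>
        inner_prod H u (v \<oplus> w) = inner_prod H u v + inner_prod H u w"
    and inner_smult_right:
      "\<lbrakk>u \<in> carrier H; v \<in> carrier H\<rbrakk> \<Longrightarrow>
        inner_prod H u (c \<odot> v) = c * inner_prod H u v"
    and inner_commute:
      "\<lbrakk>u \<in> carrier H; v \<in> carrier H\<rbrakk> \<Longrightarrow> inner_prod H v u = cnj (inner_prod H u v)"
    and inner_nonneg: "u \<in> carrier H \<Longrightarrow> 0 \<le> Re (inner_prod H u u)"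
    and inner_definite: "\<lbrakk>u \<in> carrier H; inner_prod H u u = 0\<rbrakk> \<Longrightarrow> u = \<zero>"
    and complete: "Metric_space.mcomplete (carrier H) (\<lambda>u v. hnorm H (u \<ominus> v))"

definition bounded_operator :: "('h, 'm) inner_product_space_scheme \<Rightarrow> ('h \<Rightarrow> 'h) \<Rightarrow> bool" where
  "bounded_operator H T \<longleftrightarrow>
     T \<in> carrier H \<rightarrow> carrier H \<and>
     (\<forall>u\<in>carrier H. \<forall>v\<in>carrier H. T (u \<oplus>\<^bsub>H\<^esub> v) = T u \<oplus>\<^bsub>H\<^esub> T v) \<and>
     (\<forall>c. \<forall>u\<in>carrier H. T (c \<odot>\<^bsub>H\<^esub> u) = c \<odot>\<^bsub>H\<^esub> T u) \<and>
     (\<exists>K. \<forall>u\<in>carrier H. hnorm H (T u) \<le> K * hnorm H u)"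

definition projection_operator :: "('h, 'm) inner_product_space_scheme \<Rightarrow> ('h \<Rightarrow> 'h) \<Rightarrow> bool" where
  "projection_operator H T \<longleftrightarrow>
     bounded_operator H T \<and>
     (\<forall>u\<in>carrier H. T (T u) = T u) \<and>
     (\<forall>u\<in>carrier H. \<forall>v\<in>carrier H. inner_prod H (T u) v = inner_prod H u (T v))"

definition PVM :: "('h, 'm) inner_product_space_scheme \<Rightarrow> ('i::finite \<Rightarrow> 'h \<Rightarrow> 'h) \<Rightarrow> bool" where
  "PVM H P \<longleftrightarrow>
     (\<forall>i. projection_operator H (P i)) \<and>
     (\<forall>u\<in>carrier H. (\<Oplus>\<^bsub>H\<^esub>i\<in>UNIV. P i u) = u)"


section \<open>Quantum commuting correlations\<close>

text \<open>
  The Hilbert spaces range over all those whose carrier is a subset of the type \<open>'h\<close>. If \<open>'h\<close> has at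
  least the cardinality of the continuum, no correlation is lost: the closed subspace generated
  from \<open>\<xi>\<close> by the finitely many projections is separable and so has a copy on \<open>'h\<close>.
\<close>

definition qc_correlations ::
    "'h itself \<Rightarrow> ('x::finite, 'y::finite, 'a::finite, 'b::finite) correlation set" where
  "qc_correlations _ =
     {p. \<exists>(H :: 'h inner_product_space) \<xi> P Q.
           hilbert_space H \<and> \<xi> \<in> carrier H \<and> hnorm H \<xi> = 1 \<and>
           (\<forall>x. PVM H (P x)) \<and> (\<forall>y. PVM H (Q y)) \<and>
           (\<forall>x y a b. \<forall>u\<in>carrier H. P x a (Q y b u) = Q y b (P x a u)) \<and>
           (\<forall>x y a b. complex_of_real (p a b x y) = inner_prod H \<xi> (P x a (Q y b \<xi>)))}"

definition qc_game_correlations ::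
    "'h itself \<Rightarrow> ('x::finite, 'y::finite, 'a::finite, 'b::finite) rule \<Rightarrow>
     ('x, 'y, 'a, 'b) correlation set" where
  "qc_game_correlations T lam =
     {p \<in> qc_correlations T. \<forall>x y a b. lam x y a b = 0 \<longrightarrow> p a b x y = 0}"


section \<open>Unital C*-algebras\<close>

text \<open>
  There is no requirement \<open>\<one> \<noteq> \<zero>\<close>, so the zero algebra is included.
\<close>

record 'c cstar_structure = "(complex, 'c) module" +
  star :: "'c \<Rightarrow> 'c"
  cnorm :: "'c \<Rightarrow> real"

locale unital_cstar_algebra = ring \<AA> + module complex_ring \<AA>
  for \<AA> :: "('c, 'm) cstar_structure_scheme" (structure) +
  assumes smult_mult_left:
      "\<lbrakk>v \<in> carrier \<AA>; w \<in> carrier \<AA>\<rbrakk> \<Longrightarrow> (c \<odot> v) \<otimes> w = c \<odot> (v \<otimes> w)"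
    and smult_mult_right:
      "\<lbrakk>v \<in> carrier \<AA>; w \<in> carrier \<AA>\<rbrakk> \<Longrightarrow> v \<otimes> (c \<odot> w) = c \<odot> (v \<otimes> w)"
    and star_closed: "v \<in> carrier \<AA> \<Longrightarrow> star \<AA> v \<in> carrier \<AA>"
    and star_star: "v \<in> carrier \<AA> \<Longrightarrow> star \<AA> (star \<AA> v) = v"
    and star_add:
      "\<lbrakk>v \<in> carrier \<AA>; w \<in> carrier \<AA>\<rbrakk> \<Longrightarrow> star \<AA> (v \<oplus> w) = star \<AA> v \<oplus> star \<AA> w"
    and star_smult: "v \<in> carrier \<AA> \<Longrightarrow> star \<AA> (c \<odot> v) = cnj c \<odot> star \<AA> v"
    and star_mult:
      "\<lbrakk>v \<in> carrier \<AA>; w \<in> carrier \<AA>\<rbrakk> \<Longrightarrow> star \<AA> (v \<otimes> w) = star \<AA> w \<otimes> star \<AA> v"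
    and cnorm_nonneg: "v \<in> carrier \<AA> \<Longrightarrow> 0 \<le> cnorm \<AA> v"
    and cnorm_eq_0_iff: "v \<in> carrier \<AA> \<Longrightarrow> cnorm \<AA> v = 0 \<longleftrightarrow> v = \<zero>"
    and cnorm_triangle:
      "\<lbrakk>v \<in> carrier \<AA>; w \<in> carrier \<AA>\<rbrakk> \<Longrightarrow> cnorm \<AA> (v \<oplus> w) \<le> cnorm \<AA> v + cnorm \<AA> w"
    and cnorm_smult: "v \<in> carrier \<AA> \<Longrightarrow> cnorm \<AA> (c \<odot> v) = cmod c * cnorm \<AA> v"
    and cnorm_mult:
      "\<lbrakk>v \<in> carrier \<AA>; w \<in> carrier \<AA>\<rbrakk> \<Longrightarrow> cnorm \<AA> (v \<otimes> w) \<le> cnorm \<AA> v * cnorm \<AA> w"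
    and cstar_identity: "v \<in> carrier \<AA> \<Longrightarrow> cnorm \<AA> (star \<AA> v \<otimes> v) = (cnorm \<AA> v)\<^sup>2"
    and complete: "Metric_space.mcomplete (carrier \<AA>) (\<lambda>v w. cnorm \<AA> (v \<ominus> w))"

definition unital_star_hom ::
    "('c, 'm) cstar_structure_scheme \<Rightarrow> ('d, 'n) cstar_structure_scheme \<Rightarrow> ('c \<Rightarrow> 'd) set" where
  "unital_star_hom \<AA> \<BB> =
     {\<phi> \<in> ring_hom \<AA> \<BB>.
        (\<forall>c. \<forall>v\<in>carrier \<AA>. \<phi> (c \<odot>\<^bsub>\<AA>\<^esub> v) = c \<odot>\<^bsub>\<BB>\<^esub> \<phi> v) \<and>
        (\<forall>v\<in>carrier \<AA>. \<phi> (star \<AA> v) = star \<BB> (\<phi> v))}"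

definition unital_cstar_subalgebra :: "'c set \<Rightarrow> ('c, 'm) cstar_structure_scheme \<Rightarrow> bool" where
  "unital_cstar_subalgebra S \<AA> \<longleftrightarrow>
     S \<subseteq> carrier \<AA> \<and> \<one>\<^bsub>\<AA>\<^esub> \<in> S \<and>
     (\<forall>v\<in>S. \<forall>w\<in>S. v \<oplus>\<^bsub>\<AA>\<^esub> w \<in> S \<and> v \<otimes>\<^bsub>\<AA>\<^esub> w \<in> S) \<and>
     (\<forall>c. \<forall>v\<in>S. c \<odot>\<^bsub>\<AA>\<^esub> v \<in> S) \<and>
     (\<forall>v\<in>S. star \<AA> v \<in> S) \<and>
     closedin (Metric_space.mtopology (carrier \<AA>) (\<lambda>v w. cnorm \<AA> (v \<ominus>\<^bsub>\<AA>\<^esub> w))) S"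

definition generates_cstar :: "'c set \<Rightarrow> ('c, 'm) cstar_structure_scheme \<Rightarrow> bool" where
  "generates_cstar G \<AA> \<longleftrightarrow>
     G \<subseteq> carrier \<AA> \<and>
     (\<forall>S. unital_cstar_subalgebra S \<AA> \<and> G \<subseteq> S \<longrightarrow> S = carrier \<AA>)"

definition tracial_state :: "('c, 'm) cstar_structure_scheme \<Rightarrow> ('c \<Rightarrow> complex) \<Rightarrow> bool" where
  "tracial_state \<AA> \<tau> \<longleftrightarrow>
     (\<forall>v\<in>carrier \<AA>. \<forall>w\<in>carrier \<AA>. \<tau> (v \<oplus>\<^bsub>\<AA>\<^esub> w) = \<tau> v + \<tau> w) \<and>
     (\<forall>c. \<forall>v\<in>carrier \<AA>. \<tau> (c \<odot>\<^bsub>\<AA>\<^esub> v) = c * \<tau> v) \<and>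
     (\<forall>v\<in>carrier \<AA>. \<tau> (star \<AA> v \<otimes>\<^bsub>\<AA>\<^esub> v) \<in> \<real>\<^sub>\<ge>\<^sub>0) \<and>
     \<tau> \<one>\<^bsub>\<AA>\<^esub> = 1 \<and>
     (\<forall>v\<in>carrier \<AA>. \<forall>w\<in>carrier \<AA>. \<tau> (v \<otimes>\<^bsub>\<AA>\<^esub> w) = \<tau> (w \<otimes>\<^bsub>\<AA>\<^esub> v))"


section \<open>The C*-algebra of a game\<close>

definition cstar_projection :: "('c, 'm) cstar_structure_scheme \<Rightarrow> 'c \<Rightarrow> bool" where
  "cstar_projection \<AA> e \<longleftrightarrow> e \<in> carrier \<AA> \<and> e \<otimes>\<^bsub>\<AA>\<^esub> e = e \<and> star \<AA> e = e"

definition game_relations ::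
    "('x::finite, 'y::finite, 'a::finite, 'b::finite) rule \<Rightarrow> ('c, 'm) cstar_structure_scheme \<Rightarrow>
     ('x \<Rightarrow> 'a \<Rightarrow> 'c) \<Rightarrow> ('y \<Rightarrow> 'b \<Rightarrow> 'c) \<Rightarrow> bool" where
  "game_relations lam \<AA> e f \<longleftrightarrow>
     (\<forall>x a. cstar_projection \<AA> (e x a)) \<and>
     (\<forall>y b. cstar_projection \<AA> (f y b)) \<and>
     (\<forall>x. (\<Oplus>\<^bsub>\<AA>\<^esub>a\<in>UNIV. e x a) = \<one>\<^bsub>\<AA>\<^esub>) \<and>
     (\<forall>y. (\<Oplus>\<^bsub>\<AA>\<^esub>b\<in>UNIV. f y b) = \<one>\<^bsub>\<AA>\<^esub>) \<and>
     (\<forall>x y a b. lam x y a b = 0 \<longrightarrow> e x a \<otimes>\<^bsub>\<AA>\<^esub> f y b = \<zero>\<^bsub>\<AA>\<^esub>)"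

text \<open>
  \<open>is_game_cstar_algebra lam \<AA> e f\<close>: the algebra \<open>\<AA>\<close> with the generators \<open>e x a\<close> (for \<open>p\<^sub>x\<^sub>,\<^sub>a\<close>) and
  \<open>f y b\<close> (for \<open>q\<^sub>y\<^sub>,\<^sub>b\<close>) is the universal unital C*-algebra of the game, i.e. it is generated by
  projections satisfying the relations and maps onto any other such family. The homomorphism
  \<open>\<phi>\<close> is unique because the \<open>e x a\<close> and \<open>f y b\<close> generate. The test algebras \<open>\<BB>\<close> range over all unital
  C*-algebras whose carrier is a subset of the type \<open>'c\<close>. If \<open>'c\<close> has at least the cardinality of
  the continuum, this gives the universal property for all unital C*-algebras, since the
  C*-subalgebra generated by a finite set is separable and so has a copy on \<open>'c\<close>.
\<close>

definition is_game_cstar_algebra ::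
    "('x::finite, 'y::finite, 'a::finite, 'b::finite) rule \<Rightarrow> 'c cstar_structure \<Rightarrow>
     ('x \<Rightarrow> 'a \<Rightarrow> 'c) \<Rightarrow> ('y \<Rightarrow> 'b \<Rightarrow> 'c) \<Rightarrow> bool" where
  "is_game_cstar_algebra lam \<AA> e f \<longleftrightarrow>
     unital_cstar_algebra \<AA> \<and>
     game_relations lam \<AA> e f \<and>
     generates_cstar ({e x a |x a. True} \<union> {f y b |y b. True}) \<AA> \<and>
     (\<forall>(\<BB> :: 'c cstar_structure) e' f'.
        unital_cstar_algebra \<BB> \<and> game_relations lam \<BB> e' f' \<longrightarrow>
        (\<exists>\<phi>\<in>unital_star_hom \<AA> \<BB>. (\<forall>x a. \<phi> (e x a) = e' x a) \<and> (\<forall>y b. \<phi> (f y b) = f' y b)))"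

end

theory Submission
  imports Defs
begin

text \<open>
  \<^bold>\<open>From a trace to a strategy.\<close> Let \<open>\<tau>\<close> be a tracial state on the algebra of the game. On the space with
  inner product \<open>\<langle>v, w\<rangle> = \<tau> (v* w)\<close>, let Alice act by left multiplication with the generators \<open>e x a\<close> and Bob
  by right multiplication with the \<open>f y b\<close>. Left and right multiplications commute, right multiplication by a
  projection is self-adjoint because \<open>\<tau>\<close> is a trace, and the vector \<open>\<one>\<close> gives the correlation \<open>\<tau> (e x a f y b)\<close>
  (\<open>qc_correlation_of_tracial_state\<close>).

  \<^bold>\<open>From a strategy to a trace.\<close> Let \<open>P\<close>, \<open>Q\<close>, \<open>\<xi>\<close> be a commuting strategy that wins the game, and let \<open>K\<close> be the
  closed span of the vectors that arise from \<open>\<xi>\<close> by Bob's operators. The imitation property lets Bob determine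
  Alice's answer, which forces \<open>P x a \<xi>\<close> to lie in \<open>K\<close> (\<open>alice_xi_in_cyclic\<close>); hence everything may be restricted
  to \<open>K\<close>, where \<open>\<xi>\<close> is cyclic for Bob's operators and therefore separating for their commutant. Conversely,
  Alice determines Bob's answer: the projection onto the vectors that are annihilated by all of Alice's
  answers losing against \<open>b\<close> commutes with Bob's operators and maps \<open>\<xi>\<close> to \<open>Q y b \<xi>\<close> (\<open>mirror_xi\<close>). So Bob's
  operators have mirror images in their own commutant.

  Mirror images let a factor of a product of Bob's operators move from one end to the other when the product is
  evaluated in the vector state of \<open>\<xi>\<close>, so this state is a trace on the polynomials in Bob's operators
  (\<open>polynomial_trace\<close>). Approximating \<open>T \<xi>\<close> by \<open>w \<xi>\<close> with such a polynomial \<open>w\<close> gives \<open>\<parallel>T* \<xi>\<parallel> = \<parallel>T \<xi>\<parallel>\<close> for every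
  \<open>T\<close> in the commutant, that is, the vector state is a trace on the whole commutant (\<open>vector_state_tracial\<close>).
  The commutant is a C*-algebra, and in it Alice's operators together with the mirror images of Bob's satisfy
  the relations of the game. The universal property yields a homomorphism from the algebra of the game, and
  the trace is pulled back along it. Since the state is a trace on all of the commutant, the pull-back is a
  trace by pure algebra.

  \<^bold>\<open>Sizes.\<close> Hilbert spaces and algebras have to live on prescribed types of at least the size of the continuum.
  Both the vectors of a cyclic subspace and the operators in the commutant are determined by countably many
  complex numbers (\<open>lepoll_if_complex_functions\<close>).
\<close>

section \<open>Semi-inner product spaces\<close>

lemma complex_ring_simps [simp]:
  "carrier complex_ring = UNIV" "a \<otimes>\<^bsub>complex_ring\<^esub> b = a * b" "a \<oplus>\<^bsub>complex_ring\<^esub> b = a + b"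
  "\<one>\<^bsub>complex_ring\<^esub> = 1" "\<zero>\<^bsub>complex_ring\<^esub> = 0"
  by (simp_all add: complex_ring_def)

lemma cring_complex_ring: "cring complex_ring"
proof (rule cringI)
  show "abelian_group complex_ring"
    by (rule abelian_groupI) (auto simp: algebra_simps intro: exI [of _ "- x" for x])
  show "Group.comm_monoid complex_ring"
    by (rule comm_monoidI) (auto simp: algebra_simps)
qed (auto simp: algebra_simps)

text \<open>In a module over \<open>complex_ring\<close> every rule about scalars carries a condition that the scalar lies in
  the carrier. The locale restates the rules without it.\<close>
locale complex_vector_space = module complex_ring H for H :: "(complex, 'h, 'm) module_scheme" (structure)
begin

lemma scale_closed [simp, intro]: "u \<in> carrier H \<Longrightarrow> c \<odot> u \<in> carrier H"
  by (rule smult_closed) auto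

lemma scale_one [simp]: "u \<in> carrier H \<Longrightarrow> 1 \<odot> u = u"
  using smult_one by simp

lemma scale_assoc: "u \<in> carrier H \<Longrightarrow> (c * d) \<odot> u = c \<odot> (d \<odot> u)"
  using smult_assoc1 by simp

lemma scale_add_left: "u \<in> carrier H \<Longrightarrow> (c + d) \<odot> u = c \<odot> u \<oplus> d \<odot> u"
  using smult_l_distr by simp

lemma scale_add_right: "u \<in> carrier H \<Longrightarrow> v \<in> carrier H \<Longrightarrow> c \<odot> (u \<oplus> v) = c \<odot> u \<oplus> c \<odot> v"
  using smult_r_distr by simp

lemma scale_zero_left [simp]: "u \<in> carrier H \<Longrightarrow> 0 \<odot> u = \<zero>"
  using smult_l_null by simp

lemma scale_zero_right [simp]: "c \<odot> \<zero> = \<zero>"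
  using smult_r_null by simp

lemma uminus_eq_scale: "u \<in> carrier H \<Longrightarrow> \<ominus> u = (-1) \<odot> u"
proof -
  assume u: "u \<in> carrier H"
  have "(-1) \<odot> u \<oplus> u = \<zero>"
    using u scale_add_left [of u "-1" 1] by simp
  then show ?thesis using u
    by (simp add: M.minus_equality)
qed

lemma diff_eq_scale: "u \<in> carrier H \<Longrightarrow> v \<in> carrier H \<Longrightarrow> u \<ominus> v = u \<oplus> (-1) \<odot> v"
  by (simp add: a_minus_def uminus_eq_scale)

lemma diff_closed [simp, intro]: "u \<in> carrier H \<Longrightarrow> v \<in> carrier H \<Longrightarrow> u \<ominus> v \<in> carrier H"
  by (simp add: diff_eq_scale)

lemma scale_diff_right:
  "u \<in> carrier H \<Longrightarrow> v \<in> carrier H \<Longrightarrow> c \<odot> (u \<ominus> v) = c \<odot> u \<ominus> c \<odot> v"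
  by (simp add: diff_eq_scale scale_add_right flip: scale_assoc)

lemma diff_self [simp]: "u \<in> carrier H \<Longrightarrow> u \<ominus> u = \<zero>"
  by (simp add: M.r_neg a_minus_def)

lemma diff_eq_zeroD: "u \<ominus> v = \<zero> \<Longrightarrow> u \<in> carrier H \<Longrightarrow> v \<in> carrier H \<Longrightarrow> u = v"
  by (metis M.add.inv_closed M.minus_equality M.minus_minus a_minus_def)

lemma add_diff_cancel: "u \<in> carrier H \<Longrightarrow> v \<in> carrier H \<Longrightarrow> v \<oplus> (u \<ominus> v) = u"
  by (simp add: a_minus_def M.a_lcomm M.r_neg)

end

text \<open>Both the space of a tracial state and a Hilbert space whose completeness cannot be exploited are
  covered by dropping definiteness and completeness.\<close>
locale semi_inner_space = complex_vector_space H
  for H :: "('h, 'm) inner_product_space_scheme" (structure) +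
  assumes ip_add_right:
      "\<lbrakk>u \<in> carrier H; v \<in> carrier H; w \<in> carrier H\<rbrakk> \<Longrightarrow>
        inner_prod H u (v \<oplus> w) = inner_prod H u v + inner_prod H u w"
    and ip_scale_right:
      "\<lbrakk>u \<in> carrier H; v \<in> carrier H\<rbrakk> \<Longrightarrow> inner_prod H u (c \<odot> v) = c * inner_prod H u v"
    and ip_commute:
      "\<lbrakk>u \<in> carrier H; v \<in> carrier H\<rbrakk> \<Longrightarrow> inner_prod H v u = cnj (inner_prod H u v)"
    and ip_nonneg: "u \<in> carrier H \<Longrightarrow> 0 \<le> Re (inner_prod H u u)"
begin

abbreviation ip :: "'h \<Rightarrow> 'h \<Rightarrow> complex" where "ip \<equiv> inner_prod H"
abbreviation nm :: "'h \<Rightarrow> real" where "nm \<equiv> hnorm H"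

lemma ip_add_left:
  "\<lbrakk>u \<in> carrier H; v \<in> carrier H; w \<in> carrier H\<rbrakk> \<Longrightarrow> ip (u \<oplus> v) w = ip u w + ip v w"
  by (metis M.a_closed complex_cnj_add ip_add_right ip_commute)

lemma ip_scale_left: "\<lbrakk>u \<in> carrier H; v \<in> carrier H\<rbrakk> \<Longrightarrow> ip (c \<odot> u) v = cnj c * ip u v"
  by (metis complex_cnj_mult ip_commute ip_scale_right scale_closed)

lemma ip_zero_right [simp]: "u \<in> carrier H \<Longrightarrow> ip u \<zero> = 0"
  by (metis M.zero_closed ip_scale_right mult_zero_left scale_zero_left)

lemma ip_zero_left [simp]: "u \<in> carrier H \<Longrightarrow> ip \<zero> u = 0"
  by (metis M.zero_closed complex_cnj_zero ip_commute ip_zero_right)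

lemma ip_diff_right:
  "\<lbrakk>u \<in> carrier H; v \<in> carrier H; w \<in> carrier H\<rbrakk> \<Longrightarrow> ip u (v \<ominus> w) = ip u v - ip u w"
  by (simp add: diff_eq_scale ip_add_right ip_scale_right)

lemma ip_diff_left:
  "\<lbrakk>u \<in> carrier H; v \<in> carrier H; w \<in> carrier H\<rbrakk> \<Longrightarrow> ip (u \<ominus> v) w = ip u w - ip v w"
  by (simp add: diff_eq_scale ip_add_left ip_scale_left)

lemmas ip_simps = ip_add_left ip_add_right ip_scale_left ip_scale_right ip_diff_left ip_diff_right

lemma ip_sum_right:
  assumes "finite I" "\<And>i. i \<in> I \<Longrightarrow> g i \<in> carrier H" "u \<in> carrier H"
  shows "ip u (\<Oplus>i\<in>I. g i) = (\<Sum>i\<in>I. ip u (g i))"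
  using assms
proof (induction I rule: finite_induct)
  case (insert i I)
  then have "g \<in> I \<rightarrow> carrier H" by auto
  with insert show ?case by (simp add: M.finsum_insert ip_add_right)
qed simp

lemma ip_self: "u \<in> carrier H \<Longrightarrow> ip u u = complex_of_real ((nm u)\<^sup>2)"
  using ip_nonneg [of u] ip_commute [of u u]
  by (auto simp: hnorm_def complex_eq_iff)

lemma nm_nonneg [simp]: "0 \<le> nm u" if "u \<in> carrier H"
  using ip_nonneg [OF that] by (simp add: hnorm_def)

lemma nm_square: "u \<in> carrier H \<Longrightarrow> (nm u)\<^sup>2 = Re (ip u u)"
  by (simp add: ip_self)

lemma nm_zero [simp]: "nm \<zero> = 0"
  by (simp add: hnorm_def)

lemma nm_scale: "u \<in> carrier H \<Longrightarrow> nm (c \<odot> u) = cmod c * nm u"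
proof -
  assume u: "u \<in> carrier H"
  have "ip (c \<odot> u) (c \<odot> u) = (c * cnj c) * ip u u"
    using u by (simp add: ip_scale_left ip_scale_right)
  also have "\<dots> = complex_of_real ((cmod c)\<^sup>2 * (nm u)\<^sup>2)"
    by (simp only: ip_self [OF u] complex_norm_square of_real_mult)
  finally have "(nm (c \<odot> u))\<^sup>2 = (cmod c)\<^sup>2 * (nm u)\<^sup>2"
    using u by (simp add: nm_square del: of_real_power of_real_mult)
  then have "(nm (c \<odot> u))\<^sup>2 = (cmod c * nm u)\<^sup>2" by (simp add: power_mult_distrib)
  then show ?thesis using u by (simp add: power2_eq_iff_nonneg)
qed

lemma nm_add_square:
  assumes "u \<in> carrier H" "v \<in> carrier H"
  shows "(nm (u \<oplus> v))\<^sup>2 = (nm u)\<^sup>2 + 2 * Re (ip u v) + (nm v)\<^sup>2"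
  using assms ip_commute [of u v] by (simp add: nm_square ip_simps)

lemma nm_diff_square:
  assumes "u \<in> carrier H" "v \<in> carrier H"
  shows "(nm (u \<ominus> v))\<^sup>2 = (nm u)\<^sup>2 - 2 * Re (ip u v) + (nm v)\<^sup>2"
  using assms ip_commute [of u v] by (simp add: nm_square ip_simps)

text \<open>Only semidefiniteness is available, so the case of a null vector has to be excluded by letting
  the multiple of it grow.\<close>
lemma cauchy_schwarz:
  assumes u: "u \<in> carrier H" and v: "v \<in> carrier H"
  shows "cmod (ip u v) \<le> nm u * nm v"
proof -
  define b where "b = (cmod (ip u v))\<^sup>2"
  have ineq: "0 \<le> (nm u)\<^sup>2 - 2 * t * b + t\<^sup>2 * b * (nm v)\<^sup>2" for t :: real
  proof -
    define c where "c = complex_of_real t * cnj (ip u v)"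
    have cc: "Re (c * ip u v) = t * b" "(cmod c)\<^sup>2 = t\<^sup>2 * b"
      by (simp_all add: c_def b_def norm_mult power_mult_distrib mult.assoc cmod_power2)
         (simp add: power2_eq_square algebra_simps)
    have "0 \<le> (nm (u \<ominus> c \<odot> v))\<^sup>2" by simp
    also have "\<dots> = (nm u)\<^sup>2 - 2 * (t * b) + t\<^sup>2 * b * (nm v)\<^sup>2"
      using u v cc by (simp add: nm_diff_square ip_simps nm_scale power_mult_distrib)
    finally show ?thesis by simp
  qed
  have "b \<le> (nm u)\<^sup>2 * (nm v)\<^sup>2"
  proof (cases "nm v = 0")
    case True
    have "b = 0"
    proof (rule ccontr)
      assume "b \<noteq> 0"
      then show False
        using ineq [of "((nm u)\<^sup>2 + 1) / b"] True by (simp add: power2_eq_square) (smt (verit) zero_le_power2 power2_eq_square)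
    qed
    then show ?thesis by simp
  next
    case False
    then have "0 < (nm v)\<^sup>2" by simp
    moreover have "b / (nm v)\<^sup>2 \<le> (nm u)\<^sup>2"
    proof -
      have "(1 / (nm v)\<^sup>2)\<^sup>2 * b * (nm v)\<^sup>2 = b / (nm v)\<^sup>2"
        using False by (simp add: power2_eq_square)
      then show ?thesis using ineq [of "1 / (nm v)\<^sup>2"] by simp
    qed
    ultimately show ?thesis by (simp add: pos_divide_le_eq)
  qed
  then have "(cmod (ip u v))\<^sup>2 \<le> (nm u * nm v)\<^sup>2" by (simp add: b_def power_mult_distrib)
  then show ?thesis using u v by (simp add: power2_le_iff_abs_le)
qed

lemma nm_triangle:
  assumes u: "u \<in> carrier H" and v: "v \<in> carrier H"
  shows "nm (u \<oplus> v) \<le> nm u + nm v"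
proof -
  have "Re (ip u v) \<le> nm u * nm v"
    using cauchy_schwarz [OF u v] complex_Re_le_cmod order_trans by blast
  then have "(nm (u \<oplus> v))\<^sup>2 \<le> (nm u + nm v)\<^sup>2"
    using u v by (simp add: nm_add_square power2_sum)
  then show ?thesis using u v by (simp add: power2_le_iff_abs_le)
qed

lemma nm_uminus: "u \<in> carrier H \<Longrightarrow> nm (\<ominus> u) = nm u"
  by (simp add: uminus_eq_scale nm_scale)

lemma nm_diff_commute: "u \<in> carrier H \<Longrightarrow> v \<in> carrier H \<Longrightarrow> nm (u \<ominus> v) = nm (v \<ominus> u)"
  by (metis M.minus_add M.minus_minus a_minus_def nm_uminus M.a_inv_closed M.a_closed M.a_comm)

lemma nm_diff_triangle:
  assumes "u \<in> carrier H" "v \<in> carrier H" "w \<in> carrier H"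
  shows "nm (u \<ominus> w) \<le> nm (u \<ominus> v) + nm (v \<ominus> w)"
proof -
  have "(u \<ominus> v) \<oplus> (v \<ominus> w) = u \<ominus> w"
    using assms by (simp add: a_minus_def M.a_ac M.r_neg M.r_neg1 M.r_neg2)
  then show ?thesis using nm_triangle [of "u \<ominus> v" "v \<ominus> w"] assms by simp
qed

lemma nm_triangle_sub:
  assumes "u \<in> carrier H" "v \<in> carrier H"
  shows "nm u \<le> nm v + nm (u \<ominus> v)"
  using nm_triangle [of v "u \<ominus> v"] assms by (simp add: add_diff_cancel)

lemma parallelogram:
  assumes "u \<in> carrier H" "v \<in> carrier H"
  shows "(nm (u \<oplus> v))\<^sup>2 + (nm (u \<ominus> v))\<^sup>2 = 2 * (nm u)\<^sup>2 + 2 * (nm v)\<^sup>2"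
  using assms by (simp add: nm_add_square nm_diff_square)

end

lemma (in hilbert_space) semi_inner_space: "semi_inner_space H"
  by unfold_locales (auto simp: inner_add_right inner_smult_right inner_nonneg intro: inner_commute)

sublocale hilbert_space \<subseteq> semi_inner_space
  by (rule semi_inner_space)

section \<open>Convergence and orthogonal projections\<close>

context semi_inner_space begin

definition cauchy_seq :: "(nat \<Rightarrow> 'h) \<Rightarrow> bool" where
  "cauchy_seq s \<longleftrightarrow>
     (\<forall>n. s n \<in> carrier H) \<and> (\<forall>\<epsilon>>0. \<exists>N. \<forall>m\<ge>N. \<forall>n\<ge>N. nm (s m \<ominus> s n) < \<epsilon>)"

definition converges :: "(nat \<Rightarrow> 'h) \<Rightarrow> 'h \<Rightarrow> bool" where
  "converges s l \<longleftrightarrow>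
     (\<forall>n. s n \<in> carrier H) \<and> l \<in> carrier H \<and> (\<lambda>n. nm (s n \<ominus> l)) \<longlonglongrightarrow> 0"

lemma convergesD:
  assumes "converges s l"
  shows "s n \<in> carrier H" "l \<in> carrier H" "(\<lambda>n. nm (s n \<ominus> l)) \<longlonglongrightarrow> 0"
  using assms by (auto simp: converges_def)

lemma converges_const: "u \<in> carrier H \<Longrightarrow> converges (\<lambda>n. u) u"
  by (simp add: converges_def)

lemma converges_nm:
  assumes "converges s l"
  shows "(\<lambda>n. nm (s n)) \<longlonglongrightarrow> nm l"
proof -
  note c = convergesD [OF assms]
  have "norm (nm (s n) - nm l) \<le> nm (s n \<ominus> l)" for n
    using nm_triangle_sub [of "s n" l] nm_triangle_sub [of l "s n"] nm_diff_commute [of "s n" l] c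
    by simp
  then have "(\<lambda>n. nm (s n) - nm l) \<longlonglongrightarrow> 0"
    by (intro Lim_null_comparison [OF always_eventually c(3)] allI)
  then show ?thesis by (simp add: LIM_zero_iff)
qed

lemma ip_diff_bound:
  assumes [simp]: "u \<in> carrier H" "u' \<in> carrier H" "v \<in> carrier H" "v' \<in> carrier H"
  shows "cmod (ip u v - ip u' v') \<le> nm (u \<ominus> u') * nm v + nm u' * nm (v \<ominus> v')"
proof -
  have "ip u v - ip u' v' = ip (u \<ominus> u') v + ip u' (v \<ominus> v')"
    by (simp add: ip_simps)
  also have "cmod \<dots> \<le> cmod (ip (u \<ominus> u') v) + cmod (ip u' (v \<ominus> v'))"
    by (rule norm_triangle_ineq)
  also have "\<dots> \<le> nm (u \<ominus> u') * nm v + nm u' * nm (v \<ominus> v')"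
    by (intro add_mono cauchy_schwarz) auto
  finally show ?thesis .
qed

lemma converges_ip:
  assumes s: "converges s l" and t: "converges t k"
  shows "(\<lambda>n. ip (s n) (t n)) \<longlonglongrightarrow> ip l k"
proof -
  note c = convergesD [OF s] convergesD [OF t]
  have "(\<lambda>n. nm (s n \<ominus> l) * nm (t n) + nm l * nm (t n \<ominus> k)) \<longlonglongrightarrow> 0 * nm k + nm l * 0"
    using c converges_nm [OF t] by (intro tendsto_intros) auto
  then have lim: "(\<lambda>n. nm (s n \<ominus> l) * nm (t n) + nm l * nm (t n \<ominus> k)) \<longlonglongrightarrow> 0" by simp
  have "(\<lambda>n. ip (s n) (t n) - ip l k) \<longlonglongrightarrow> 0"
    by (rule Lim_null_comparison [OF always_eventually lim]) (use c ip_diff_bound in auto)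
  then show ?thesis by (simp add: LIM_zero_iff)
qed

definition closed_subspace :: "'h set \<Rightarrow> bool" where
  "closed_subspace M \<longleftrightarrow> M \<subseteq> carrier H \<and> \<zero> \<in> M \<and> (\<forall>u\<in>M. \<forall>v\<in>M. u \<oplus> v \<in> M) \<and>
     (\<forall>c. \<forall>u\<in>M. c \<odot> u \<in> M) \<and> (\<forall>s l. converges s l \<longrightarrow> (\<forall>n. s n \<in> M) \<longrightarrow> l \<in> M)"

lemma closed_subspaceD:
  assumes "closed_subspace M"
  shows "u \<in> M \<Longrightarrow> u \<in> carrier H" "\<zero> \<in> M" "u \<in> M \<Longrightarrow> v \<in> M \<Longrightarrow> u \<oplus> v \<in> M"
    "u \<in> M \<Longrightarrow> c \<odot> u \<in> M" "u \<in> M \<Longrightarrow> v \<in> M \<Longrightarrow> u \<ominus> v \<in> M"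
    "converges s l \<Longrightarrow> (\<And>n. s n \<in> M) \<Longrightarrow> l \<in> M"
  using assms unfolding closed_subspace_def by (auto simp: diff_eq_scale subset_iff)

definition orth :: "'h set \<Rightarrow> 'h set" where
  "orth W = {u \<in> carrier H. \<forall>w\<in>W. ip w u = 0}"

lemma closed_subspace_orth: "W \<subseteq> carrier H \<Longrightarrow> closed_subspace (orth W)"
  unfolding closed_subspace_def
proof (intro conjI allI impI ballI)
  fix s l assume W: "W \<subseteq> carrier H" and s: "converges s l" "\<forall>n. s n \<in> orth W"
  have "ip w l = 0" if "w \<in> W" for w
  proof -
    have "(\<lambda>n. ip w (s n)) \<longlonglongrightarrow> ip w l"
      using W that s by (intro converges_ip converges_const) auto
    moreover have "(\<lambda>n. ip w (s n)) = (\<lambda>n. 0)" using s that by (auto simp: orth_def)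
    ultimately show ?thesis by (simp add: LIMSEQ_const_iff)
  qed
  then show "l \<in> orth W" using s by (auto simp: orth_def converges_def)
qed (auto simp: orth_def ip_simps subset_iff)

lemma orth_commute: "u \<in> carrier H \<Longrightarrow> v \<in> carrier H \<Longrightarrow> ip u v = 0 \<longleftrightarrow> ip v u = 0"
  by (metis complex_cnj_zero_iff ip_commute)

end

text \<open>Completeness is phrased by sequences instead of by metric spaces: a \<open>Metric_space\<close> must have a
  symmetric and non-negative distance on the whole type.\<close>
locale complete_inner_space = semi_inner_space H
  for H :: "('h, 'm) inner_product_space_scheme" (structure) +
  assumes definite: "\<lbrakk>u \<in> carrier H; inner_prod H u u = 0\<rbrakk> \<Longrightarrow> u = \<zero>"
    and cauchy_converges: "cauchy_seq s \<Longrightarrow> \<exists>l. converges s l"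
begin

lemma nm_eq_0D: "u \<in> carrier H \<Longrightarrow> nm u = 0 \<Longrightarrow> u = \<zero>"
  by (simp add: definite ip_self)

text \<open>Vectors are compared by their inner products: this turns identities between vectors into identities
  between complex numbers.\<close>
lemma ip_eqI:
  assumes "u \<in> carrier H" "v \<in> carrier H" "\<And>w. w \<in> carrier H \<Longrightarrow> ip w u = ip w v"
  shows "u = v"
proof -
  have "ip (u \<ominus> v) (u \<ominus> v) = 0" using assms by (simp add: ip_diff_right)
  then show ?thesis using definite diff_eq_zeroD assms by blast
qed

text \<open>By the parallelogram law a minimizing sequence for the distance to the subspace is Cauchy.\<close>
lemma nearest_point:
  assumes M: "closed_subspace M" and u: "u \<in> carrier H"
  shows "\<exists>m\<in>M. \<forall>v\<in>M. nm (u \<ominus> m) \<le> nm (u \<ominus> v)"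
proof -
  note MD = closed_subspaceD [OF M]
  define d where "d = (INF v\<in>M. nm (u \<ominus> v))"
  have bdd: "bdd_below ((\<lambda>v. nm (u \<ominus> v)) ` M)"
    using MD(1) u by (intro bdd_belowI [of _ 0]) auto
  have d_le: "d \<le> nm (u \<ominus> v)" if "v \<in> M" for v
    unfolding d_def using bdd that by (rule cINF_lower)
  have d0: "0 \<le> d" unfolding d_def
    using MD(1,2) u by (intro cINF_greatest) auto
  have "\<exists>v\<in>M. nm (u \<ominus> v) < d + 1 / Suc n" for n
    using cInf_lessD [of "(\<lambda>v. nm (u \<ominus> v)) ` M" "d + 1 / Suc n"] MD(2) unfolding d_def by auto
  then obtain s where sM: "\<And>n. s n \<in> M" and sd: "\<And>n. nm (u \<ominus> s n) < d + 1 / Suc n" by metis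
  have sc [simp]: "s n \<in> carrier H" for n using sM MD(1) by blast
  have close: "(nm (s i \<ominus> s j))\<^sup>2 \<le> 4 * (2 * d + 1) / Suc N" if "N \<le> i" "N \<le> j" for i j N
  proof -
    let ?a = "u \<ominus> s i" and ?b = "u \<ominus> s j" and ?m = "(1/2) \<odot> (s i \<oplus> s j)"
    have "?m \<in> M" using sM by (intro MD(3,4))
    then have "d \<le> nm (u \<ominus> ?m)" by (rule d_le)
    moreover have "?a \<oplus> ?b = 2 \<odot> (u \<ominus> ?m)"
      by (rule ip_eqI) (use u in \<open>simp_all add: ip_simps algebra_simps\<close>)
    moreover have "?b \<ominus> ?a = s i \<ominus> s j"
      by (rule ip_eqI) (use u in \<open>simp_all add: ip_simps algebra_simps\<close>)
    ultimately have "(nm (s i \<ominus> s j))\<^sup>2 + 4 * (nm (u \<ominus> ?m))\<^sup>2 = 2 * (nm ?a)\<^sup>2 + 2 * (nm ?b)\<^sup>2" "d\<^sup>2 \<le> (nm (u \<ominus> ?m))\<^sup>2"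
      using parallelogram [of ?b ?a] u d0 nm_scale [of "u \<ominus> ?m" 2]
      by (simp_all add: M.a_comm power_mult_distrib power_mono)
    moreover have bnd: "(nm (u \<ominus> s k))\<^sup>2 \<le> d\<^sup>2 + (2 * d + 1) / Suc N" if "N \<le> k" for k
    proof -
      let ?e = "1 / real (Suc N)"
      have "1 / real (Suc k) \<le> ?e" using that by (simp add: frac_le)
      then have "nm (u \<ominus> s k) \<le> d + ?e" using sd [of k] by linarith
      then have "(nm (u \<ominus> s k))\<^sup>2 \<le> (d + ?e)\<^sup>2" using u by (simp add: power_mono)
      also have "\<dots> = d\<^sup>2 + 2 * d * ?e + ?e * ?e"
        unfolding power2_sum by (simp add: power2_eq_square del: of_nat_Suc)
      also have "d\<^sup>2 + 2 * d * ?e + ?e * ?e \<le> d\<^sup>2 + 2 * d * ?e + 1 * ?e"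
        by (intro add_left_mono mult_right_mono) auto
      finally show ?thesis by (simp add: add_divide_distrib)
    qed
    ultimately have "(nm (s i \<ominus> s j))\<^sup>2 \<le> 4 * ((2 * d + 1) / Suc N)"
      using bnd [OF that(1)] bnd [OF that(2)] by linarith
    then show ?thesis by simp
  qed
  have "cauchy_seq s" unfolding cauchy_seq_def
  proof (intro conjI allI impI)
    fix \<epsilon> :: real assume "0 < \<epsilon>"
    obtain N where "4 * (2 * d + 1) / \<epsilon>\<^sup>2 < real (Suc N)"
      using reals_Archimedean2 [of "4 * (2 * d + 1) / \<epsilon>\<^sup>2"] of_nat_Suc by (smt (verit))
    then have N: "4 * (2 * d + 1) / Suc N < \<epsilon>\<^sup>2"
      using \<open>0 < \<epsilon>\<close> by (simp add: field_simps)
    show "\<exists>N. \<forall>m\<ge>N. \<forall>n\<ge>N. nm (s m \<ominus> s n) < \<epsilon>"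
    proof (intro exI allI impI)
      fix i j assume "N \<le> i" "N \<le> j"
      then have "(nm (s i \<ominus> s j))\<^sup>2 < \<epsilon>\<^sup>2" using close [of N i j] N by linarith
      then show "nm (s i \<ominus> s j) < \<epsilon>" using \<open>0 < \<epsilon>\<close> by (simp add: power_less_imp_less_base)
    qed
  qed simp
  then obtain m where m: "converges s m" using cauchy_converges by blast
  then have "m \<in> M" using sM MD(6) by blast
  moreover have "nm (u \<ominus> m) \<le> d"
  proof (rule LIMSEQ_le_const)
    show "(\<lambda>n. d + 1 / Suc n + nm (s n \<ominus> m)) \<longlonglongrightarrow> d"
      using tendsto_add [OF tendsto_add [OF tendsto_const [of d] LIMSEQ_inverse_real_of_nat] convergesD(3) [OF m]]
      by (simp add: inverse_eq_divide)
    have "nm (u \<ominus> m) \<le> d + 1 / Suc n + nm (s n \<ominus> m)" for n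
      using nm_diff_triangle [of u "s n" m] u convergesD [OF m] sd [of n] by simp
    then show "\<exists>N. \<forall>n\<ge>N. nm (u \<ominus> m) \<le> d + 1 / Suc n + nm (s n \<ominus> m)" by blast
  qed
  ultimately show ?thesis using d_le order_trans by blast
qed

text \<open>The nearest point is the component in the subspace: if the difference \<open>u - m\<close> had a non-zero inner
  product with some \<open>v\<close> of the subspace, a small step from \<open>m\<close> along \<open>v\<close> would come nearer to \<open>u\<close>.\<close>
theorem orthogonal_decomposition:
  assumes M: "closed_subspace M" and u: "u \<in> carrier H"
  shows "\<exists>m\<in>M. u \<ominus> m \<in> orth M"
proof -
  note MD = closed_subspaceD [OF M]
  obtain m where m: "m \<in> M" and best: "\<And>v. v \<in> M \<Longrightarrow> nm (u \<ominus> m) \<le> nm (u \<ominus> v)"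
    using nearest_point [OF M u] by blast
  let ?r = "u \<ominus> m"
  have [simp]: "m \<in> carrier H" using m MD(1) by blast
  have "ip v ?r = 0" if v: "v \<in> M" for v
  proof (rule ccontr)
    assume nz: "ip v ?r \<noteq> 0"
    have [simp]: "v \<in> carrier H" using v MD(1) by blast
    define b where "b = (cmod (ip v ?r))\<^sup>2"
    have b: "0 < b" using nz by (simp add: b_def)
    \<comment> \<open>The step is so small that the quadratic term stays below the linear gain \<open>2 * t * b\<close>.\<close>
    define t where "t = 1 / ((nm v)\<^sup>2 + 1)"
    have t: "0 < t" "t * (nm v)\<^sup>2 < 1" by (simp_all add: t_def add_nonneg_pos)
    define c where "c = complex_of_real t * ip v ?r"
    have "m \<oplus> c \<odot> v \<in> M" using m v by (intro MD(3,4))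
    then have "nm ?r \<le> nm (u \<ominus> (m \<oplus> c \<odot> v))" by (rule best)
    also have "u \<ominus> (m \<oplus> c \<odot> v) = ?r \<ominus> c \<odot> v"
      by (rule ip_eqI) (use u in \<open>simp_all add: ip_simps algebra_simps\<close>)
    finally have "(nm ?r)\<^sup>2 \<le> (nm (?r \<ominus> c \<odot> v))\<^sup>2" using u by (intro power_mono) auto
    also have "\<dots> = (nm ?r)\<^sup>2 - 2 * Re (ip ?r (c \<odot> v)) + (nm (c \<odot> v))\<^sup>2"
      using u by (intro nm_diff_square) auto
    also have "Re (ip ?r (c \<odot> v)) = t * b"
    proof -
      have "ip ?r (c \<odot> v) = c * cnj (ip v ?r)" using u ip_commute [of v ?r] by (simp add: ip_scale_right)
      also have "\<dots> = complex_of_real (t * b)"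
        unfolding c_def b_def of_real_mult complex_norm_square by (simp add: mult_ac)
      finally show ?thesis by simp
    qed
    also have "(nm (c \<odot> v))\<^sup>2 = t * b * (t * (nm v)\<^sup>2)"
      by (simp add: nm_scale c_def b_def norm_mult power_mult_distrib) (simp add: power2_eq_square)
    finally have "2 * (t * b) \<le> t * b * (t * (nm v)\<^sup>2)" by simp
    also have "\<dots> < t * b * 1" using t b by (intro mult_strict_left_mono) auto
    finally show False using t b by simp
  qed
  moreover have "?r \<in> carrier H" using u by simp
  ultimately show ?thesis using m by (auto simp: orth_def)
qed

lemma double_orth_trivial: "u \<in> M \<Longrightarrow> u \<in> orth M \<Longrightarrow> u = \<zero>"
  using definite by (auto simp: orth_def)

definition proj :: "'h set \<Rightarrow> 'h \<Rightarrow> 'h" where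
  "proj M u = (SOME m. m \<in> M \<and> u \<ominus> m \<in> orth M)"

lemma proj_in: "closed_subspace M \<Longrightarrow> u \<in> carrier H \<Longrightarrow> proj M u \<in> M"
  and diff_proj_in_orth: "closed_subspace M \<Longrightarrow> u \<in> carrier H \<Longrightarrow> u \<ominus> proj M u \<in> orth M"
  using someI_ex [of "\<lambda>m. m \<in> M \<and> u \<ominus> m \<in> orth M"] orthogonal_decomposition [of M u]
  unfolding proj_def by blast+

lemma proj_eqI:
  assumes M: "closed_subspace M" and u: "u \<in> carrier H" and m: "m \<in> M" "u \<ominus> m \<in> orth M"
  shows "proj M u = m"
proof -
  note MD = closed_subspaceD [OF M]
  let ?q = "proj M u"
  have q: "?q \<in> M" "u \<ominus> ?q \<in> orth M" using proj_in diff_proj_in_orth M u by blast+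
  have [simp]: "?q \<in> carrier H" "m \<in> carrier H" using q m MD(1) by blast+
  have "ip v (?q \<ominus> m) = 0" if "v \<in> M" for v
  proof -
    have "ip v (u \<ominus> ?q) = 0" "ip v (u \<ominus> m) = 0" "v \<in> carrier H"
      using q m that MD(1) by (auto simp: orth_def)
    then show ?thesis using u by (simp add: ip_simps)
  qed
  then have "?q \<ominus> m \<in> orth M" by (simp add: orth_def)
  moreover have "?q \<ominus> m \<in> M" using q m by (intro MD(5))
  ultimately show ?thesis using diff_eq_zeroD double_orth_trivial by simp
qed

end

section \<open>Completion\<close>

context semi_inner_space begin

lemma cauchy_seqD: "cauchy_seq s \<Longrightarrow> s n \<in> carrier H"
  by (simp add: cauchy_seq_def)

lemma cauchy_seq_const: "u \<in> carrier H \<Longrightarrow> cauchy_seq (\<lambda>n. u)"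
  by (simp add: cauchy_seq_def)

lemma cauchy_seq_add:
  assumes s: "cauchy_seq s" and t: "cauchy_seq t"
  shows "cauchy_seq (\<lambda>n. s n \<oplus> t n)"
proof -
  note [simp] = cauchy_seqD [OF s] cauchy_seqD [OF t]
  have *: "nm ((s m \<oplus> t m) \<ominus> (s n \<oplus> t n)) \<le> nm (s m \<ominus> s n) + nm (t m \<ominus> t n)" for m n
  proof -
    have "(s m \<oplus> t m) \<ominus> (s n \<oplus> t n) = (s m \<ominus> s n) \<oplus> (t m \<ominus> t n)"
      by (simp add: diff_eq_scale scale_add_right M.a_ac)
    then show ?thesis by (simp add: nm_triangle)
  qed
  have "\<exists>N. \<forall>m\<ge>N. \<forall>n\<ge>N. nm ((s m \<oplus> t m) \<ominus> (s n \<oplus> t n)) < \<epsilon>" if "0 < \<epsilon>" for \<epsilon>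
  proof -
    have "0 < \<epsilon> / 2" using that by simp
    then obtain M N where "\<forall>m\<ge>M. \<forall>n\<ge>M. nm (s m \<ominus> s n) < \<epsilon> / 2" "\<forall>m\<ge>N. \<forall>n\<ge>N. nm (t m \<ominus> t n) < \<epsilon> / 2"
      using s t unfolding cauchy_seq_def by meson
    then have "\<forall>m\<ge>max M N. \<forall>n\<ge>max M N. nm ((s m \<oplus> t m) \<ominus> (s n \<oplus> t n)) < \<epsilon> / 2 + \<epsilon> / 2"
      using * by (meson add_strict_mono le_less_trans max.boundedE)
    then show ?thesis by (intro exI [of _ "max M N"]) simp
  qed
  then show ?thesis by (simp add: cauchy_seq_def)
qed

lemma cauchy_seq_lipschitz:
  assumes s: "cauchy_seq s" and t: "\<And>n. t n \<in> carrier H"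
    and le: "\<And>m n. nm (t m \<ominus> t n) \<le> K * nm (s m \<ominus> s n)"
  shows "cauchy_seq t"
  unfolding cauchy_seq_def
proof (intro conjI allI impI)
  fix \<epsilon> :: real assume "0 < \<epsilon>"
  then have "0 < \<epsilon> / (\<bar>K\<bar> + 1)" by simp
  then obtain N where N: "\<And>m n. m \<ge> N \<Longrightarrow> n \<ge> N \<Longrightarrow> nm (s m \<ominus> s n) < \<epsilon> / (\<bar>K\<bar> + 1)"
    using s unfolding cauchy_seq_def by meson
  have "nm (t m \<ominus> t n) < \<epsilon>" if "m \<ge> N" "n \<ge> N" for m n
  proof -
    have "nm (t m \<ominus> t n) \<le> (\<bar>K\<bar> + 1) * nm (s m \<ominus> s n)"
      using le [of m n] cauchy_seqD [OF s]
      by (smt (verit, ccfv_SIG) diff_closed mult_right_mono nm_nonneg)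
    also have "\<dots> < \<epsilon>" using N [OF that] by (simp add: field_simps)
    finally show ?thesis .
  qed
  then show "\<exists>N. \<forall>m\<ge>N. \<forall>n\<ge>N. nm (t m \<ominus> t n) < \<epsilon>" by blast
qed (use t in auto)

lemma cauchy_seq_scale: "cauchy_seq s \<Longrightarrow> cauchy_seq (\<lambda>n. c \<odot> s n)"
  by (rule cauchy_seq_lipschitz [where K = "cmod c"])
    (auto simp: cauchy_seqD nm_scale simp flip: scale_diff_right)

lemma cauchy_seq_diff: "cauchy_seq s \<Longrightarrow> cauchy_seq t \<Longrightarrow> cauchy_seq (\<lambda>n. s n \<ominus> t n)"
  using cauchy_seq_add [OF _ cauchy_seq_scale, of s t "-1"]
  by (simp add: diff_eq_scale cauchy_seqD)

lemma cauchy_seq_bounded: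
  assumes s: "cauchy_seq s"
  obtains B where "0 < B" "\<And>n. nm (s n) \<le> B"
proof -
  note [simp] = cauchy_seqD [OF s]
  have "norm (nm (s m) - nm (s n)) \<le> nm (s m \<ominus> s n)" for m n
    using nm_triangle_sub [of "s n" "s m"] nm_triangle_sub [of "s m" "s n"] nm_diff_commute [of "s n" "s m"]
    by simp
  then have "Cauchy (\<lambda>n. nm (s n))"
    using s unfolding cauchy_seq_def Cauchy_iff by (meson le_less_trans)
  then have "Bseq (\<lambda>n. nm (s n))" by (rule Cauchy_Bseq)
  then obtain B where "0 < B" "\<And>n. norm (nm (s n)) \<le> B" by (auto simp: Bseq_def)
  then show ?thesis using that by auto
qed

lemma cauchy_seq_ip_near:
  assumes s: "cauchy_seq s" and t: "cauchy_seq t" and "0 < \<epsilon>"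
  obtains N where "\<And>m n m' n'. m \<ge> N \<Longrightarrow> n \<ge> N \<Longrightarrow> m' \<ge> N \<Longrightarrow> n' \<ge> N \<Longrightarrow>
    cmod (ip (s m) (t n) - ip (s m') (t n')) < \<epsilon>"
proof -
  note [simp] = cauchy_seqD [OF s] cauchy_seqD [OF t]
  obtain B C where B: "0 < B" "\<And>n. nm (s n) \<le> B" and C: "0 < C" "\<And>n. nm (t n) \<le> C"
    using cauchy_seq_bounded s t by metis
  have "0 < \<epsilon> / (2 * C)" "0 < \<epsilon> / (2 * B)" using B C \<open>0 < \<epsilon>\<close> by auto
  then obtain M N where M: "\<And>m n. m\<ge>M \<Longrightarrow> n\<ge>M \<Longrightarrow> nm (s m \<ominus> s n) < \<epsilon> / (2 * C)"
    and N: "\<And>m n. m\<ge>N \<Longrightarrow> n\<ge>N \<Longrightarrow> nm (t m \<ominus> t n) < \<epsilon> / (2 * B)"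
    using s t unfolding cauchy_seq_def by meson
  show ?thesis
  proof
    fix m n m' n' assume *: "m \<ge> max M N" "n \<ge> max M N" "m' \<ge> max M N" "n' \<ge> max M N"
    have "cmod (ip (s m) (t n) - ip (s m') (t n')) \<le>
        nm (s m \<ominus> s m') * nm (t n) + nm (s m') * nm (t n \<ominus> t n')"
      by (rule ip_diff_bound) auto
    also have "\<dots> \<le> nm (s m \<ominus> s m') * C + B * nm (t n \<ominus> t n')"
      using B C by (intro add_mono mult_left_mono mult_right_mono) auto
    also have "\<dots> < (\<epsilon> / (2 * C)) * C + B * (\<epsilon> / (2 * B))"
      using B C M [of m m'] N [of n n'] * by (intro add_strict_mono mult_strict_left_mono mult_strict_right_mono) auto
    also have "\<dots> = \<epsilon>" using B C by simp
    finally show "cmod (ip (s m) (t n) - ip (s m') (t n')) < \<epsilon>" .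
  qed
qed

lemma cauchy_seq_ip_convergent:
  assumes "cauchy_seq s" "cauchy_seq t"
  shows "convergent (\<lambda>n. ip (s n) (t n))"
proof (rule Cauchy_convergent, unfold Cauchy_iff, intro allI impI)
  fix \<epsilon> :: real assume "0 < \<epsilon>"
  then obtain N where "\<And>m n m' n'. m \<ge> N \<Longrightarrow> n \<ge> N \<Longrightarrow> m' \<ge> N \<Longrightarrow> n' \<ge> N \<Longrightarrow>
    cmod (ip (s m) (t n) - ip (s m') (t n')) < \<epsilon>"
    using cauchy_seq_ip_near [OF assms] by metis
  then show "\<exists>M. \<forall>m\<ge>M. \<forall>n\<ge>M. cmod (ip (s m) (t m) - ip (s n) (t n)) < \<epsilon>" by blast
qed

text \<open>A Cauchy sequence is represented by the functional that its would-be limit defines. Two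
  sequences with the same limit give the same functional, so that no quotient is needed.\<close>
definition limit_functional :: "(nat \<Rightarrow> 'h) \<Rightarrow> 'h \<Rightarrow> complex" where
  "limit_functional s = (\<lambda>w. if w \<in> carrier H then lim (\<lambda>n. ip w (s n)) else 0)"

lemma limit_functional_tendsto:
  "cauchy_seq s \<Longrightarrow> w \<in> carrier H \<Longrightarrow> (\<lambda>n. ip w (s n)) \<longlonglongrightarrow> limit_functional s w"
  using cauchy_seq_ip_convergent [OF cauchy_seq_const, of w s]
  by (simp add: limit_functional_def convergent_LIMSEQ_iff)

lemma limit_functional_outside: "w \<notin> carrier H \<Longrightarrow> limit_functional s w = 0"
  by (simp add: limit_functional_def)

lemma limit_functional_eqI:
  assumes "cauchy_seq s" "\<And>w. w \<in> carrier H \<Longrightarrow> (\<lambda>n. ip w (s n)) \<longlonglongrightarrow> h w"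
    "\<And>w. w \<notin> carrier H \<Longrightarrow> h w = 0"
  shows "limit_functional s = h"
  using assms limit_functional_tendsto [OF assms(1)] limit_functional_outside
  by (metis (no_types) LIMSEQ_unique ext)

text \<open>The square \<open>\<parallel>s n\<parallel>\<^sup>2\<close> is close to the inner product of \<open>s n\<close> with one
  fixed member of the sequence, and that tends to zero.\<close>
lemma cauchy_seq_weakly_null:
  assumes s: "cauchy_seq s" and null: "\<And>w. w \<in> carrier H \<Longrightarrow> (\<lambda>n. ip w (s n)) \<longlonglongrightarrow> 0"
  shows "(\<lambda>n. nm (s n)) \<longlonglongrightarrow> 0"
proof -
  note [simp] = cauchy_seqD [OF s]
  have "(\<lambda>n. ip (s n) (s n)) \<longlonglongrightarrow> 0"
  proof (rule LIMSEQ_I)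
    fix \<epsilon> :: real assume "0 < \<epsilon>"
    then have "0 < \<epsilon> / 2" by simp
    then obtain N where N: "\<And>m n m' n'. m \<ge> N \<Longrightarrow> n \<ge> N \<Longrightarrow> m' \<ge> N \<Longrightarrow> n' \<ge> N \<Longrightarrow>
        cmod (ip (s m) (s n) - ip (s m') (s n')) < \<epsilon> / 2"
      using cauchy_seq_ip_near [OF s s] by metis
    obtain M where M: "\<And>n. n \<ge> M \<Longrightarrow> cmod (ip (s N) (s n)) < \<epsilon> / 2"
      using LIMSEQ_D [OF null [of "s N"] \<open>0 < \<epsilon> / 2\<close>] by auto
    have "cmod (ip (s n) (s n)) < \<epsilon>" if "n \<ge> max M N" for n
    proof -
      have "cmod (ip (s n) (s n)) \<le> cmod (ip (s n) (s n) - ip (s N) (s n)) + cmod (ip (s N) (s n))"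
        by (metis diff_add_cancel norm_triangle_ineq)
      then show ?thesis using N [of n n N n] M [of n] that by simp
    qed
    then show "\<exists>no. \<forall>n\<ge>no. norm (ip (s n) (s n) - 0) < \<epsilon>" by (intro exI [of _ "max M N"]) simp
  qed
  then have "(\<lambda>n. Re (ip (s n) (s n))) \<longlonglongrightarrow> Re 0" by (rule tendsto_Re)
  then have "(\<lambda>n. sqrt (Re (ip (s n) (s n)))) \<longlonglongrightarrow> sqrt 0" by (intro tendsto_real_sqrt) simp
  then show ?thesis by (simp add: hnorm_def)
qed

definition representative :: "('h \<Rightarrow> complex) \<Rightarrow> nat \<Rightarrow> 'h" where
  "representative h = (SOME s. cauchy_seq s \<and> limit_functional s = h)"

definition completion :: "('h \<Rightarrow> complex) inner_product_space" where
  "completion = \<lparr>carrier = limit_functional ` Collect cauchy_seq,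
     mult = undefined, one = undefined, zero = (\<lambda>_. 0), add = (\<lambda>h k w. h w + k w),
     smult = (\<lambda>c h w. c * h w),
     inner_prod = (\<lambda>h k. lim (\<lambda>n. ip (representative h n) (representative k n)))\<rparr>"

lemma completion_simps:
  "carrier completion = limit_functional ` Collect cauchy_seq"
  "\<zero>\<^bsub>completion\<^esub> = (\<lambda>_. 0)"
  "h \<oplus>\<^bsub>completion\<^esub> k = (\<lambda>w. h w + k w)"
  "c \<odot>\<^bsub>completion\<^esub> h = (\<lambda>w. c * h w)"
  by (simp_all add: completion_def)

lemma limit_functional_in: "cauchy_seq s \<Longrightarrow> limit_functional s \<in> carrier completion"
  by (simp add: completion_simps)

lemma completionE:
  assumes "h \<in> carrier completion"
  obtains s where "cauchy_seq s" "h = limit_functional s"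
  using assms by (auto simp: completion_simps)

lemma limit_functional_add:
  assumes s: "cauchy_seq s" and t: "cauchy_seq t"
  shows "limit_functional s \<oplus>\<^bsub>completion\<^esub> limit_functional t = limit_functional (\<lambda>n. s n \<oplus> t n)"
  unfolding completion_simps
  by (rule limit_functional_eqI [symmetric])
    (use assms in \<open>auto simp: cauchy_seqD ip_add_right limit_functional_outside
       intro: cauchy_seq_add tendsto_add limit_functional_tendsto\<close>)

lemma limit_functional_scale:
  assumes s: "cauchy_seq s"
  shows "c \<odot>\<^bsub>completion\<^esub> limit_functional s = limit_functional (\<lambda>n. c \<odot> s n)"
  unfolding completion_simps
  by (rule limit_functional_eqI [symmetric])
    (use assms in \<open>auto simp: cauchy_seqD ip_scale_right limit_functional_outside
       intro: cauchy_seq_scale tendsto_mult_left limit_functional_tendsto\<close>)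

lemma limit_functional_zero: "limit_functional (\<lambda>n. \<zero>) = \<zero>\<^bsub>completion\<^esub>"
  unfolding completion_simps by (rule limit_functional_eqI) (auto intro: cauchy_seq_const)

lemma limit_functional_eqD:
  assumes s: "cauchy_seq s" and t: "cauchy_seq t" and eq: "limit_functional s = limit_functional t"
  shows "(\<lambda>n. nm (s n \<ominus> t n)) \<longlonglongrightarrow> 0"
proof (rule cauchy_seq_weakly_null)
  show "cauchy_seq (\<lambda>n. s n \<ominus> t n)" using s t by (rule cauchy_seq_diff)
  fix w assume "w \<in> carrier H"
  then have "(\<lambda>n. ip w (s n) - ip w (t n)) \<longlonglongrightarrow> limit_functional s w - limit_functional t w"
    using s t by (intro tendsto_diff limit_functional_tendsto)
  then show "(\<lambda>n. ip w (s n \<ominus> t n)) \<longlonglongrightarrow> 0"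
    using \<open>w \<in> carrier H\<close> s t eq by (simp add: ip_diff_right cauchy_seqD)
qed

text \<open>The inner product of \<open>completion\<close> is computed from chosen representatives; any other pair of Cauchy
  sequences gives the same value, because sequences with equal functionals approach each other.\<close>
lemma inner_limit_functional:
  assumes s: "cauchy_seq s" and t: "cauchy_seq t"
  shows "(\<lambda>n. ip (s n) (t n)) \<longlonglongrightarrow> inner_prod completion (limit_functional s) (limit_functional t)"
proof -
  let ?s = "representative (limit_functional s)" and ?t = "representative (limit_functional t)"
  have s': "cauchy_seq ?s" "limit_functional ?s = limit_functional s"
    using someI_ex [of "\<lambda>r. cauchy_seq r \<and> limit_functional r = limit_functional s"] s
    unfolding representative_def by blast+
  have t': "cauchy_seq ?t" "limit_functional ?t = limit_functional t"
    using someI_ex [of "\<lambda>r. cauchy_seq r \<and> limit_functional r = limit_functional t"] t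
    unfolding representative_def by blast+
  note [simp] = cauchy_seqD [OF s] cauchy_seqD [OF t] cauchy_seqD [OF s'(1)] cauchy_seqD [OF t'(1)]
  obtain B C where B: "\<And>n. nm (?t n) \<le> B" and C: "\<And>n. nm (s n) \<le> C" and "0 < B" "0 < C"
    using cauchy_seq_bounded s t'(1) by metis
  have lim: "(\<lambda>n. nm (?s n \<ominus> s n) * B + C * nm (?t n \<ominus> t n)) \<longlonglongrightarrow> 0"
    using limit_functional_eqD [OF s'(1) s s'(2)] limit_functional_eqD [OF t'(1) t t'(2)]
    by (auto intro!: tendsto_eq_intros)
  have "(\<lambda>n. ip (?s n) (?t n) - ip (s n) (t n)) \<longlonglongrightarrow> 0"
  proof (rule Lim_null_comparison [OF always_eventually lim], intro allI)
    fix n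
    have "cmod (ip (?s n) (?t n) - ip (s n) (t n)) \<le> nm (?s n \<ominus> s n) * nm (?t n) + nm (s n) * nm (?t n \<ominus> t n)"
      by (rule ip_diff_bound) auto
    also have "\<dots> \<le> nm (?s n \<ominus> s n) * B + C * nm (?t n \<ominus> t n)"
      using B C by (intro add_mono mult_left_mono mult_right_mono) auto
    finally show "norm (ip (?s n) (?t n) - ip (s n) (t n)) \<le> nm (?s n \<ominus> s n) * B + C * nm (?t n \<ominus> t n)" .
  qed
  moreover have "(\<lambda>n. ip (?s n) (?t n)) \<longlonglongrightarrow> inner_prod completion (limit_functional s) (limit_functional t)"
    using cauchy_seq_ip_convergent [OF s'(1) t'(1)]
    by (simp add: completion_def convergent_LIMSEQ_iff)
  ultimately show ?thesis using tendsto_diff by fastforce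
qed

lemma complex_vector_space_completion: "complex_vector_space completion"
  unfolding complex_vector_space_def
proof (rule moduleI [OF cring_complex_ring])
  show "abelian_group completion"
  proof (rule abelian_groupI)
    fix h k assume "h \<in> carrier completion" "k \<in> carrier completion"
    then show "h \<oplus>\<^bsub>completion\<^esub> k \<in> carrier completion"
      using limit_functional_in [OF cauchy_seq_add]
      by (elim completionE) (simp add: limit_functional_add)
  next
    show "\<zero>\<^bsub>completion\<^esub> \<in> carrier completion"
      using limit_functional_in [OF cauchy_seq_const [OF M.zero_closed]]
      by (simp add: limit_functional_zero)
  next
    fix h assume "h \<in> carrier completion"
    then obtain s where s: "cauchy_seq s" "h = limit_functional s" by (rule completionE)
    then have "(-1) \<odot>\<^bsub>completion\<^esub> h \<in> carrier completion"
      by (simp add: limit_functional_scale limit_functional_in cauchy_seq_scale)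
    then show "\<exists>k\<in>carrier completion. k \<oplus>\<^bsub>completion\<^esub> h = \<zero>\<^bsub>completion\<^esub>"
      by (rule bexI [rotated]) (simp add: completion_simps)
  qed (auto simp: completion_simps(2-) algebra_simps)
next
  fix c h assume "h \<in> carrier completion"
  then show "c \<odot>\<^bsub>completion\<^esub> h \<in> carrier completion"
    using limit_functional_in [OF cauchy_seq_scale]
    by (elim completionE) (simp add: limit_functional_scale)
qed (auto simp: completion_simps(2-) algebra_simps)

lemma semi_inner_space_completion: "semi_inner_space completion"
  unfolding semi_inner_space_def
proof (intro conjI complex_vector_space_completion semi_inner_space_axioms.intro)
  fix h k l assume "h \<in> carrier completion" "k \<in> carrier completion" "l \<in> carrier completion"
  then obtain s t r where c: "cauchy_seq s" "cauchy_seq t" "cauchy_seq r"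
    and eq: "h = limit_functional s" "k = limit_functional t" "l = limit_functional r" by (elim completionE)
  have "(\<lambda>n. ip (s n) (t n \<oplus> r n)) \<longlonglongrightarrow> inner_prod completion h (k \<oplus>\<^bsub>completion\<^esub> l)"
    unfolding eq limit_functional_add [OF c(2,3)] by (intro inner_limit_functional cauchy_seq_add c)
  moreover have "(\<lambda>n. ip (s n) (t n \<oplus> r n)) \<longlonglongrightarrow> inner_prod completion h k + inner_prod completion h l"
    using tendsto_add [OF inner_limit_functional inner_limit_functional, OF c(1,2) c(1,3)] c
    by (simp add: eq ip_add_right cauchy_seqD)
  ultimately show "inner_prod completion h (k \<oplus>\<^bsub>completion\<^esub> l) = inner_prod completion h k + inner_prod completion h l"
    by (rule LIMSEQ_unique)
next
  fix h k c assume "h \<in> carrier completion" "k \<in> carrier completion"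
  then obtain s t where c: "cauchy_seq s" "cauchy_seq t"
    and eq: "h = limit_functional s" "k = limit_functional t" by (elim completionE)
  have "(\<lambda>n. ip (s n) (c \<odot> t n)) \<longlonglongrightarrow> inner_prod completion h (c \<odot>\<^bsub>completion\<^esub> k)"
    unfolding eq limit_functional_scale [OF c(2)] by (intro inner_limit_functional cauchy_seq_scale c)
  moreover have "(\<lambda>n. ip (s n) (c \<odot> t n)) \<longlonglongrightarrow> c * inner_prod completion h k"
    using tendsto_mult_left [OF inner_limit_functional, OF c(1,2)] c
    by (simp add: eq ip_scale_right cauchy_seqD)
  ultimately show "inner_prod completion h (c \<odot>\<^bsub>completion\<^esub> k) = c * inner_prod completion h k"
    by (rule LIMSEQ_unique)
next
  fix h k assume "h \<in> carrier completion" "k \<in> carrier completion"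
  then obtain s t where c: "cauchy_seq s" "cauchy_seq t"
    and eq: "h = limit_functional s" "k = limit_functional t" by (elim completionE)
  have "ip (t n) (s n) = cnj (ip (s n) (t n))" for n
    using c by (intro ip_commute cauchy_seqD)
  then have "(\<lambda>n. ip (t n) (s n)) \<longlonglongrightarrow> cnj (inner_prod completion h k)"
    using tendsto_cnj [OF inner_limit_functional, OF c(1,2)] by (simp add: eq)
  then show "inner_prod completion k h = cnj (inner_prod completion h k)"
    using inner_limit_functional [OF c(2,1)] LIMSEQ_unique by (simp add: eq)
next
  fix h assume "h \<in> carrier completion"
  then obtain s where c: "cauchy_seq s" and eq: "h = limit_functional s" by (elim completionE)
  show "0 \<le> Re (inner_prod completion h h)"
    using tendsto_Re [OF inner_limit_functional, OF c c] ip_nonneg cauchy_seqD [OF c]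
    unfolding eq by (intro LIMSEQ_le_const [of _ _ 0]) auto
qed

definition embed :: "'h \<Rightarrow> 'h \<Rightarrow> complex" where
  "embed u = limit_functional (\<lambda>n. u)"

lemma embed_in: "u \<in> carrier H \<Longrightarrow> embed u \<in> carrier completion"
  by (simp add: embed_def limit_functional_in cauchy_seq_const)

lemma inner_embed:
  "u \<in> carrier H \<Longrightarrow> v \<in> carrier H \<Longrightarrow> inner_prod completion (embed u) (embed v) = ip u v"
  using inner_limit_functional [of "\<lambda>n. u" "\<lambda>n. v"] cauchy_seq_const
  by (simp add: embed_def LIMSEQ_const_iff)

abbreviation "cdist h k \<equiv> hnorm completion (h \<ominus>\<^bsub>completion\<^esub> k)"

lemma hnorm_limit_functional_diff:
  assumes s: "cauchy_seq s" and t: "cauchy_seq t"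
  shows "(\<lambda>n. nm (s n \<ominus> t n)) \<longlonglongrightarrow>
    cdist (limit_functional s) (limit_functional t)"
proof -
  interpret C: semi_inner_space completion by (rule semi_inner_space_completion)
  have d: "cauchy_seq (\<lambda>n. s n \<ominus> t n)" using s t by (rule cauchy_seq_diff)
  have "limit_functional s \<ominus>\<^bsub>completion\<^esub> limit_functional t = limit_functional (\<lambda>n. s n \<ominus> t n)"
    using s t by (simp add: C.diff_eq_scale limit_functional_in limit_functional_scale
      limit_functional_add cauchy_seq_scale diff_eq_scale cauchy_seqD)
  then show ?thesis
    using tendsto_real_sqrt [OF tendsto_Re [OF inner_limit_functional [OF d d]]]
    by (simp add: hnorm_def)
qed

lemma embed_tendsto:
  assumes s: "cauchy_seq s"
  shows "(\<lambda>n. cdist (limit_functional s) (embed (s n))) \<longlonglongrightarrow> 0"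
proof (rule LIMSEQ_I)
  interpret C: semi_inner_space completion by (rule semi_inner_space_completion)
  fix \<epsilon> :: real assume "0 < \<epsilon>"
  then have "0 < \<epsilon> / 2" by simp
  then obtain N where N: "\<And>m n. m \<ge> N \<Longrightarrow> n \<ge> N \<Longrightarrow> nm (s m \<ominus> s n) < \<epsilon> / 2"
    using s unfolding cauchy_seq_def by meson
  have "cdist (limit_functional s) (embed (s n)) \<le> \<epsilon> / 2" if "n \<ge> N" for n
  proof (rule LIMSEQ_le_const2)
    show "(\<lambda>m. nm (s m \<ominus> s n)) \<longlonglongrightarrow> cdist (limit_functional s) (embed (s n))"
      unfolding embed_def using s
      by (intro hnorm_limit_functional_diff cauchy_seq_const cauchy_seqD)
    show "\<exists>M. \<forall>m\<ge>M. nm (s m \<ominus> s n) \<le> \<epsilon> / 2" using N that less_imp_le by meson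
  qed
  then show "\<exists>N. \<forall>n\<ge>N. norm (cdist (limit_functional s) (embed (s n)) - 0) < \<epsilon>"
    using \<open>0 < \<epsilon>\<close> s by (intro exI [of _ N])
      (fastforce simp: limit_functional_in embed_in cauchy_seqD)
qed

text \<open>A Cauchy sequence of functionals is approximated, with errors tending to zero, by embedded vectors. These
  vectors form a Cauchy sequence, whose functional is the limit.\<close>
theorem complete_inner_space_completion: "complete_inner_space completion"
proof -
  interpret C: semi_inner_space completion by (rule semi_inner_space_completion)
  show ?thesis
  proof
    fix h assume h: "h \<in> carrier completion" "inner_prod completion h h = 0"
    then obtain s where s: "cauchy_seq s" and eq: "h = limit_functional s" by (elim completionE)
    note [simp] = cauchy_seqD [OF s]
    have "(\<lambda>n. sqrt (Re (ip (s n) (s n)))) \<longlonglongrightarrow> sqrt (Re 0)"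
      using inner_limit_functional [OF s s] h(2) unfolding eq
      by (intro tendsto_real_sqrt tendsto_Re) simp
    then have 0: "(\<lambda>n. nm w * nm (s n)) \<longlonglongrightarrow> 0" for w
      by (auto simp: hnorm_def intro: tendsto_mult_right_zero)
    have "limit_functional s = \<zero>\<^bsub>completion\<^esub>" unfolding completion_simps
    proof (rule limit_functional_eqI [OF s])
      fix w assume "w \<in> carrier H"
      then show "(\<lambda>n. ip w (s n)) \<longlonglongrightarrow> 0"
        by (intro Lim_null_comparison [OF always_eventually 0 [of w]] allI cauchy_schwarz) auto
    qed simp
    then show "h = \<zero>\<^bsub>completion\<^esub>" by (simp add: eq)
  next
    fix h assume h: "C.cauchy_seq h"
    note [simp] = C.cauchy_seqD [OF h]
    have "\<exists>v\<in>carrier H. cdist (h k) (embed v) < 1 / Suc k" for k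
    proof -
      obtain s where s: "cauchy_seq s" and eq: "h k = limit_functional s"
        using C.cauchy_seqD [OF h, of k] by (elim completionE)
      then show ?thesis
        using LIMSEQ_D [OF embed_tendsto [OF s], of "1 / Suc k"] cauchy_seqD [OF s] by (auto simp: abs_less_iff)
    qed
    then obtain v where v [simp]: "\<And>k. v k \<in> carrier H"
      and close: "\<And>k. cdist (h k) (embed (v k)) < 1 / Suc k" by metis
    note [simp] = embed_in
    have near: "nm (v j \<ominus> v k) \<le> 1 / Suc j + cdist (h j) (h k) + 1 / Suc k" for j k
    proof -
      have "nm (v j \<ominus> v k) = cdist (embed (v j)) (embed (v k))"
        using hnorm_limit_functional_diff [OF cauchy_seq_const cauchy_seq_const, of "v j" "v k"]
        by (simp add: embed_def LIMSEQ_const_iff)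
      also have "\<dots> \<le> cdist (embed (v j)) (h j) + cdist (h j) (embed (v k))"
        by (rule C.nm_diff_triangle) auto
      also have "cdist (h j) (embed (v k)) \<le>
          cdist (h j) (h k) + cdist (h k) (embed (v k))"
        by (rule C.nm_diff_triangle) auto
      also have "cdist (embed (v j)) (h j) = cdist (h j) (embed (v j))"
        by (rule C.nm_diff_commute) auto
      finally show ?thesis using close [of j] close [of k] by linarith
    qed
    have small: "\<exists>N. \<forall>k\<ge>N. 1 / Suc k < \<epsilon>" if "0 < \<epsilon>" for \<epsilon> :: real
      using LIMSEQ_D [OF LIMSEQ_inverse_real_of_nat that] by (simp add: inverse_eq_divide)
    have vc: "cauchy_seq v" unfolding cauchy_seq_def
    proof (intro conjI allI impI v)
      fix \<epsilon> :: real assume "0 < \<epsilon>"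
      then have e3: "0 < \<epsilon> / 3" by simp
      obtain M where M: "\<forall>k\<ge>M. 1 / Suc k < \<epsilon> / 3" using small [OF e3] by blast
      obtain N where N: "\<forall>j\<ge>N. \<forall>k\<ge>N. cdist (h j) (h k) < \<epsilon> / 3"
        using h e3 unfolding C.cauchy_seq_def by meson
      have "nm (v j \<ominus> v k) < \<epsilon>" if "j \<ge> max M N" "k \<ge> max M N" for j k
      proof -
        have "1 / Suc j < \<epsilon> / 3" "1 / Suc k < \<epsilon> / 3" "cdist (h j) (h k) < \<epsilon> / 3"
          using M N that by auto
        then show ?thesis using near [of j k] by linarith
      qed
      then show "\<exists>N. \<forall>m\<ge>N. \<forall>n\<ge>N. nm (v m \<ominus> v n) < \<epsilon>" by blast
    qed
    have lim: "(\<lambda>k. 1 / Suc k + cdist (limit_functional v) (embed (v k))) \<longlonglongrightarrow> 0"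
      using tendsto_add [OF LIMSEQ_inverse_real_of_nat embed_tendsto [OF vc]] by (simp add: inverse_eq_divide)
    have "norm (cdist (h k) (limit_functional v)) \<le>
        1 / Suc k + cdist (limit_functional v) (embed (v k))" for k
      using C.nm_diff_triangle [of "h k" "embed (v k)" "limit_functional v"] close [of k]
        C.nm_diff_commute [of "embed (v k)" "limit_functional v"] vc
      by (simp add: limit_functional_in)
    then have "(\<lambda>k. cdist (h k) (limit_functional v)) \<longlonglongrightarrow> 0"
      by (intro Lim_null_comparison [OF always_eventually lim] allI)
    then show "\<exists>l. C.converges h l"
      using vc by (intro exI [of _ "limit_functional v"]) (simp add: C.converges_def limit_functional_in)
  qed
qed

end

section \<open>Commuting projection-valued measures\<close>

context semi_inner_space begin

definition projector :: "('h \<Rightarrow> 'h) \<Rightarrow> bool" where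
  "projector T \<longleftrightarrow> (\<forall>u\<in>carrier H. T u \<in> carrier H) \<and>
     (\<forall>u\<in>carrier H. \<forall>v\<in>carrier H. T (u \<oplus> v) = T u \<oplus> T v) \<and>
     (\<forall>c. \<forall>u\<in>carrier H. T (c \<odot> u) = c \<odot> T u) \<and>
     (\<forall>u\<in>carrier H. T (T u) = T u) \<and>
     (\<forall>u\<in>carrier H. \<forall>v\<in>carrier H. ip (T u) v = ip u (T v))"

lemma projectorD:
  assumes "projector T" "u \<in> carrier H"
  shows "T u \<in> carrier H" "v \<in> carrier H \<Longrightarrow> T (u \<oplus> v) = T u \<oplus> T v" "T (c \<odot> u) = c \<odot> T u"
    "T (T u) = T u" "v \<in> carrier H \<Longrightarrow> ip (T u) v = ip u (T v)"
  using assms unfolding projector_def by blast+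

lemma projector_diff:
  "projector T \<Longrightarrow> u \<in> carrier H \<Longrightarrow> v \<in> carrier H \<Longrightarrow> T (u \<ominus> v) = T u \<ominus> T v"
  by (simp add: diff_eq_scale projectorD [of T])

lemma projector_zero: "projector T \<Longrightarrow> T \<zero> = \<zero>"
  using projectorD(3) [of T \<zero> 0] projectorD(1) [of T \<zero>] by simp

text \<open>Boundedness is automatic: \<open>\<parallel>T u\<parallel>\<^sup>2 = \<langle>u, T u\<rangle>\<close> for a self-adjoint idempotent.\<close>
lemma nm_projector_le:
  assumes T: "projector T" and u: "u \<in> carrier H"
  shows "nm (T u) \<le> nm u"
proof -
  note [simp] = projectorD [OF T]
  have "ip (T u) (T u) = ip u (T u)" using u by simp
  then have "(nm (T u))\<^sup>2 \<le> nm u * nm (T u)"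
    using cauchy_schwarz [of u "T u"] u complex_Re_le_cmod order_trans by (fastforce simp: nm_square)
  moreover have "0 \<le> nm (T u)" "0 \<le> nm u" using u by simp_all
  ultimately show ?thesis
    by (metis mult_right_le_imp_le order_le_less power2_eq_square)
qed

lemma (in hilbert_space) projection_operator_projector: "projection_operator H T \<Longrightarrow> projector T"
  by (auto simp: projection_operator_def bounded_operator_def projector_def)

text \<open>A self-adjoint \<open>T\<close> satisfies \<open>\<langle>w, T u\<rangle> = \<langle>T w, u\<rangle>\<close>, so that on functionals it acts by composition.\<close>
definition extend :: "('h \<Rightarrow> 'h) \<Rightarrow> ('h \<Rightarrow> complex) \<Rightarrow> 'h \<Rightarrow> complex" where
  "extend T h = (\<lambda>w. if w \<in> carrier H then h (T w) else 0)"

lemma cauchy_seq_projector: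
  assumes T: "projector T" and s: "cauchy_seq s"
  shows "cauchy_seq (\<lambda>n. T (s n))"
proof (rule cauchy_seq_lipschitz [OF s, where K = 1])
  note [simp] = cauchy_seqD [OF s]
  show "T (s n) \<in> carrier H" for n by (simp add: projectorD(1) [OF T])
  show "nm (T (s m) \<ominus> T (s n)) \<le> 1 * nm (s m \<ominus> s n)" for m n
    using nm_projector_le [OF T, of "s m \<ominus> s n"] by (simp add: projector_diff [OF T])
qed

lemma extend_limit_functional:
  assumes T: "projector T" and s: "cauchy_seq s"
  shows "extend T (limit_functional s) = limit_functional (\<lambda>n. T (s n))"
proof (rule limit_functional_eqI [symmetric, OF cauchy_seq_projector [OF T s]])
  fix w assume w: "w \<in> carrier H"
  then have "(\<lambda>n. ip (T w) (s n)) \<longlonglongrightarrow> limit_functional s (T w)"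
    by (intro limit_functional_tendsto [OF s] projectorD(1) [OF T])
  then show "(\<lambda>n. ip w (T (s n))) \<longlonglongrightarrow> extend T (limit_functional s) w"
    using w s by (simp add: extend_def projectorD(5) [OF T] cauchy_seqD)
qed (simp add: extend_def)

lemma extend_embed: "projector T \<Longrightarrow> u \<in> carrier H \<Longrightarrow> extend T (embed u) = embed (T u)"
  by (simp add: embed_def extend_limit_functional cauchy_seq_const)

lemma projector_extend:
  assumes T: "projector T"
  shows "semi_inner_space.projector completion (extend T)"
proof -
  interpret C: semi_inner_space completion by (rule semi_inner_space_completion)
  note TL = extend_limit_functional [OF T] cauchy_seq_projector [OF T]
  show ?thesis unfolding C.projector_def
  proof (intro conjI ballI allI)
    fix h assume "h \<in> carrier completion"
    then obtain s where s: "cauchy_seq s" and eq: "h = limit_functional s" by (elim completionE)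
    show "extend T h \<in> carrier completion" "extend T (extend T h) = extend T h"
      using s by (simp_all add: eq TL limit_functional_in projectorD(4) [OF T] cauchy_seqD)
    fix k assume "k \<in> carrier completion"
    then obtain t where t: "cauchy_seq t" and eq': "k = limit_functional t" by (elim completionE)
    have "(\<lambda>n. ip (T (s n)) (t n)) \<longlonglongrightarrow> inner_prod completion (extend T h) k"
      using s t by (simp add: eq eq' TL inner_limit_functional)
    moreover have "(\<lambda>n. ip (s n) (T (t n))) \<longlonglongrightarrow> inner_prod completion h (extend T k)"
      using s t by (simp add: eq eq' TL inner_limit_functional)
    ultimately show "inner_prod completion (extend T h) k = inner_prod completion h (extend T k)"
      using s t LIMSEQ_unique by (simp add: projectorD(5) [OF T] cauchy_seqD)
    show "extend T (h \<oplus>\<^bsub>completion\<^esub> k) = extend T h \<oplus>\<^bsub>completion\<^esub> extend T k"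
      by (auto simp: extend_def completion_simps(3))
  next
    fix c h
    show "extend T (c \<odot>\<^bsub>completion\<^esub> h) = c \<odot>\<^bsub>completion\<^esub> extend T h"
      by (auto simp: extend_def completion_simps(4))
  qed
qed

lemma finsum_completion:
  assumes "finite I" "\<And>i. i \<in> I \<Longrightarrow> g i \<in> carrier completion"
  shows "(\<Oplus>\<^bsub>completion\<^esub>i\<in>I. g i) = (\<lambda>w. \<Sum>i\<in>I. g i w)"
proof -
  interpret C: semi_inner_space completion by (rule semi_inner_space_completion)
  show ?thesis using assms
  proof (induction I rule: finite_induct)
    case (insert i I)
    then have "g \<in> I \<rightarrow> carrier completion" by auto
    with insert show ?case by (simp add: C.M.finsum_insert completion_simps(3))
  qed (simp add: completion_simps(2))
qed

end

locale commuting_pvms = semi_inner_space H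
  for H :: "('h, 'm) inner_product_space_scheme" (structure) +
  fixes P :: "'x::finite \<Rightarrow> 'a::finite \<Rightarrow> 'h \<Rightarrow> 'h" and Q :: "'y::finite \<Rightarrow> 'b::finite \<Rightarrow> 'h \<Rightarrow> 'h"
    and \<xi> :: 'h
  assumes xi: "\<xi> \<in> carrier H" "inner_prod H \<xi> \<xi> = 1"
    and P: "projector (P x a)" and Q: "projector (Q y b)"
    and P_sum: "u \<in> carrier H \<Longrightarrow> (\<Oplus>a\<in>UNIV. P x a u) = u"
    and Q_sum: "u \<in> carrier H \<Longrightarrow> (\<Oplus>b\<in>UNIV. Q y b u) = u"
    and commute: "u \<in> carrier H \<Longrightarrow> P x a (Q y b u) = Q y b (P x a u)"
begin

lemma PQ_closed [simp]: "u \<in> carrier H \<Longrightarrow> P x a u \<in> carrier H" "u \<in> carrier H \<Longrightarrow> Q y b u \<in> carrier H"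
  by (rule projectorD(1) [OF P], assumption) (rule projectorD(1) [OF Q])

lemma extend_sum:
  assumes "\<And>i. projector (T i)" "\<And>u. u \<in> carrier H \<Longrightarrow> (\<Oplus>i\<in>UNIV. T i u) = u"
    and "h \<in> carrier completion"
  shows "(\<Oplus>\<^bsub>completion\<^esub>i\<in>(UNIV::'i::finite set). extend (T i) h) = h"
proof -
  interpret C: semi_inner_space completion by (rule semi_inner_space_completion)
  obtain s where s: "cauchy_seq s" and eq: "h = limit_functional s"
    using assms(3) by (elim completionE)
  have "(\<lambda>w. \<Sum>i\<in>UNIV. extend (T i) h w) = h"
  proof (unfold eq, rule limit_functional_eqI [symmetric, OF s])
    fix w assume w: "w \<in> carrier H"
    have "(\<lambda>n. \<Sum>i\<in>UNIV. ip w (T i (s n))) \<longlonglongrightarrow> (\<Sum>i\<in>UNIV. extend (T i) (limit_functional s) w)"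
      using assms(1) s w
      by (intro tendsto_sum) (simp add: extend_limit_functional limit_functional_tendsto cauchy_seq_projector)
    moreover have "(\<Sum>i\<in>UNIV. ip w (T i (s n))) = ip w (s n)" for n
      using ip_sum_right [of UNIV "\<lambda>i. T i (s n)" w] assms(1,2) cauchy_seqD [OF s] w
      by (simp add: projectorD(1) [OF assms(1)])
    ultimately show "(\<lambda>n. ip w (s n)) \<longlonglongrightarrow> (\<Sum>i\<in>UNIV. extend (T i) (limit_functional s) w)"
      by simp
  qed (simp add: extend_def)
  then show ?thesis
    using C.projectorD(1) [OF projector_extend [OF assms(1)] assms(3)] by (simp add: finsum_completion)
qed

lemma commuting_pvms_completion:
  "commuting_pvms completion (\<lambda>x a. extend (P x a)) (\<lambda>y b. extend (Q y b)) (embed \<xi>)"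
  unfolding commuting_pvms_def
proof (intro conjI semi_inner_space_completion commuting_pvms_axioms.intro)
  fix u :: "'h \<Rightarrow> complex" and x a y b assume "u \<in> carrier completion"
  show "extend (P x a) (extend (Q y b) u) = extend (Q y b) (extend (P x a) u)"
    by (auto simp: extend_def commute)
qed (auto simp: projector_extend P Q extend_sum P_sum Q_sum embed_in xi inner_embed)

lemma correlation_completion:
  "inner_prod completion (embed \<xi>) (extend (P x a) (extend (Q y b) (embed \<xi>))) = ip \<xi> (P x a (Q y b \<xi>))"
  by (simp add: extend_embed P Q xi inner_embed)

end

text \<open>The word vectors \<open>T i\<^sub>1 (\<dots> (T i\<^sub>n \<xi>))\<close> span the cyclic subspace.\<close>
definition word_vectors :: "('i \<Rightarrow> 'h \<Rightarrow> 'h) \<Rightarrow> 'h \<Rightarrow> 'h set" where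
  "word_vectors T \<xi> = range (\<lambda>ws. foldr T ws \<xi>)"

context complete_inner_space begin

lemma double_orth_incl: "W \<subseteq> carrier H \<Longrightarrow> W \<subseteq> orth (orth W)"
  by (auto simp: orth_def orth_commute)

text \<open>If \<open>T\<close> maps \<open>W\<close> into the closed span of \<open>W\<close>, then by self-adjointness it preserves the
  orthogonal complement of \<open>W\<close>, and hence also the closed span.\<close>
lemma projector_orth:
  assumes T: "projector T" and W: "W \<subseteq> carrier H" and inv: "T ` W \<subseteq> orth (orth W)" and u: "u \<in> orth W"
  shows "T u \<in> orth W"
proof -
  have uc: "u \<in> carrier H" using u by (simp add: orth_def)
  have "ip w (T u) = 0" if "w \<in> W" for w
  proof -
    have wc: "w \<in> carrier H" using that W by blast
    have "T w \<in> orth (orth W)" using that inv by blast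
    then have "ip u (T w) = 0" using u by (auto simp: orth_def)
    then have "ip (T w) u = 0" using orth_commute [OF uc projectorD(1) [OF T wc]] by blast
    then show ?thesis using projectorD(5) [OF T wc uc] by simp
  qed
  then show ?thesis using projectorD(1) [OF T uc] by (simp add: orth_def)
qed

lemma projector_double_orth:
  assumes T: "projector T" and W: "W \<subseteq> carrier H" and inv: "T ` W \<subseteq> orth (orth W)" and u: "u \<in> orth (orth W)"
  shows "T u \<in> orth (orth W)"
proof (rule projector_orth [OF T])
  have "T ` orth W \<subseteq> orth W" using projector_orth [OF T W inv] by blast
  also have "\<dots> \<subseteq> orth (orth (orth W))" by (rule double_orth_incl) (auto simp: orth_def)
  finally show "T ` orth W \<subseteq> orth (orth (orth W))" .
qed (use u in \<open>auto simp: orth_def\<close>)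

text \<open>The closed linear span, obtained as a double orthogonal complement. In this form, a vector of the
  subspace that is orthogonal to all word vectors vanishes by definiteness alone.\<close>
definition cyclic_subspace :: "('i \<Rightarrow> 'h \<Rightarrow> 'h) \<Rightarrow> 'h \<Rightarrow> 'h set" where
  "cyclic_subspace T \<xi> = orth (orth (word_vectors T \<xi>))"

context
  fixes T :: "'i \<Rightarrow> 'h \<Rightarrow> 'h" and \<xi> :: 'h
  assumes T: "\<And>i. projector (T i)" and xi: "\<xi> \<in> carrier H"
begin

lemma word_closed: "foldr T ws \<xi> \<in> carrier H"
  by (induction ws) (auto simp: xi projectorD(1) [OF T])

lemma word_vectors_subset: "word_vectors T \<xi> \<subseteq> carrier H"
  using word_closed by (auto simp: word_vectors_def)

lemma closed_subspace_cyclic: "closed_subspace (cyclic_subspace T \<xi>)"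
  unfolding cyclic_subspace_def by (rule closed_subspace_orth) (auto simp: orth_def)

lemma word_in_cyclic: "foldr T ws \<xi> \<in> cyclic_subspace T \<xi>"
  using double_orth_incl [OF word_vectors_subset] unfolding cyclic_subspace_def by (auto simp: word_vectors_def)

lemma cyclic_invariant: "u \<in> cyclic_subspace T \<xi> \<Longrightarrow> T i u \<in> cyclic_subspace T \<xi>"
  unfolding cyclic_subspace_def
proof (rule projector_double_orth [OF T word_vectors_subset])
  have "T i ` word_vectors T \<xi> \<subseteq> word_vectors T \<xi>"
    by (auto simp: word_vectors_def intro: range_eqI [where x = "i # ws" for ws])
  then show "T i ` word_vectors T \<xi> \<subseteq> orth (orth (word_vectors T \<xi>))"
    using double_orth_incl [OF word_vectors_subset] by blast
qed

lemma cyclic_total: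
  assumes "u \<in> cyclic_subspace T \<xi>" "\<And>ws. ip (foldr T ws \<xi>) u = 0"
  shows "u = \<zero>"
proof -
  have "u \<in> orth (word_vectors T \<xi>)"
    using assms closed_subspaceD(1) [OF closed_subspace_cyclic] by (auto simp: orth_def word_vectors_def)
  then show ?thesis using assms(1) unfolding cyclic_subspace_def by (rule double_orth_trivial)
qed

end

text \<open>Only the carrier is cut down. All operations stay the same, and so do the operators that leave the
  subspace invariant.\<close>
context
  fixes K assumes K: "closed_subspace K"
begin

lemma subspace_minus:
  "complex_vector_space (H\<lparr>carrier := K\<rparr>) \<Longrightarrow> u \<in> K \<Longrightarrow> v \<in> K \<Longrightarrow> u \<ominus>\<^bsub>H\<lparr>carrier := K\<rparr>\<^esub> v = u \<ominus> v"
  using complex_vector_space.diff_eq_scale [of "H\<lparr>carrier := K\<rparr>" u v] closed_subspaceD(1) [OF K]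
  by (simp add: diff_eq_scale)

lemma complex_vector_space_subspace: "complex_vector_space (H\<lparr>carrier := K\<rparr>)"
  unfolding complex_vector_space_def
proof (rule moduleI [OF cring_complex_ring])
  note KD = closed_subspaceD [OF K]
  show "abelian_group (H\<lparr>carrier := K\<rparr>)"
  proof (rule abelian_groupI; clarsimp)
    fix u assume u: "u \<in> K"
    then have "(-1) \<odot> u \<in> K" "(-1) \<odot> u \<oplus> u = \<zero>"
      using KD(1,4) uminus_eq_scale [of u] M.l_neg [of u] by auto
    then show "\<exists>v\<in>K. v \<oplus> u = \<zero>" by blast
  qed (use KD(1-3) in \<open>auto intro: M.a_assoc M.a_comm\<close>)
qed (use closed_subspaceD [OF K] in \<open>auto simp: scale_add_left scale_add_right scale_assoc\<close>)

lemma complete_inner_space_subspace: "complete_inner_space (H\<lparr>carrier := K\<rparr>)"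
proof -
  note KD = closed_subspaceD [OF K]
  interpret S: complex_vector_space "H\<lparr>carrier := K\<rparr>" by (rule complex_vector_space_subspace)
  interpret S: semi_inner_space "H\<lparr>carrier := K\<rparr>"
    by unfold_locales (use KD(1) in \<open>auto simp: ip_add_right ip_scale_right ip_nonneg intro: ip_commute\<close>)
  have diff: "u \<in> K \<Longrightarrow> v \<in> K \<Longrightarrow> u \<ominus>\<^bsub>H\<lparr>carrier := K\<rparr>\<^esub> v = u \<ominus> v" for u v
    by (rule subspace_minus [OF complex_vector_space_subspace])
  have nm: "S.nm = nm" by (simp add: hnorm_def fun_eq_iff)
  show ?thesis
  proof
    fix s assume s: "S.cauchy_seq s"
    then have sK: "\<And>n. s n \<in> K" by (simp add: S.cauchy_seq_def)
    have "cauchy_seq s" using s sK KD(1) unfolding S.cauchy_seq_def cauchy_seq_def by (simp add: diff nm)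
    then obtain l where l: "converges s l" using cauchy_converges by blast
    then have "l \<in> K" using sK KD(6) by blast
    then have "S.converges s l" using l sK by (simp add: S.converges_def converges_def diff nm)
    then show "\<exists>l. S.converges s l" ..
  qed (use KD(1) definite in auto)
qed

lemma projector_subspace:
  assumes "projector T" "\<And>u. u \<in> K \<Longrightarrow> T u \<in> K"
  shows "semi_inner_space.projector (H\<lparr>carrier := K\<rparr>) T"
proof -
  interpret S: complete_inner_space "H\<lparr>carrier := K\<rparr>" by (rule complete_inner_space_subspace)
  show ?thesis using assms closed_subspaceD(1) [OF K] by (simp add: S.projector_def projector_def)
qed

lemma finsum_subspace:
  assumes "finite I" "\<And>i. i \<in> I \<Longrightarrow> g i \<in> K"
  shows "(\<Oplus>\<^bsub>H\<lparr>carrier := K\<rparr>\<^esub>i\<in>I. g i) = (\<Oplus>i\<in>I. g i)"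
proof -
  interpret S: complete_inner_space "H\<lparr>carrier := K\<rparr>" by (rule complete_inner_space_subspace)
  show ?thesis using assms
  proof (induction I rule: finite_induct)
    case (insert i I)
    then have "g \<in> I \<rightarrow> K" "g \<in> I \<rightarrow> carrier H" using closed_subspaceD(1) [OF K] by auto
    with insert show ?case using closed_subspaceD(1) [OF K]
      by (simp add: S.M.finsum_insert M.finsum_insert)
  qed simp
qed

end

lemma commuting_pvms_subspace:
  assumes "commuting_pvms H P Q \<xi>" and K: "closed_subspace K" and xi: "\<xi> \<in> K"
    and PK: "\<And>x a u. u \<in> K \<Longrightarrow> P x a u \<in> K" and QK: "\<And>y b u. u \<in> K \<Longrightarrow> Q y b u \<in> K"
  shows "commuting_pvms (H\<lparr>carrier := K\<rparr>) P Q \<xi>"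
proof -
  interpret commuting_pvms H P Q \<xi> by fact
  interpret S: complete_inner_space "H\<lparr>carrier := K\<rparr>" by (rule complete_inner_space_subspace [OF K])
  have KC: "u \<in> carrier H" if "u \<in> K" for u using closed_subspaceD(1) [OF K] that .
  show ?thesis unfolding commuting_pvms_def
  proof (intro conjI S.semi_inner_space_axioms commuting_pvms_axioms.intro)
    show "S.projector (P x a)" "S.projector (Q y b)" for x a y b
      using P Q PK QK by (auto intro: projector_subspace [OF K])
    fix u assume "u \<in> carrier (H\<lparr>carrier := K\<rparr>)"
    then have u: "u \<in> K" by simp
    show "(\<Oplus>\<^bsub>H\<lparr>carrier := K\<rparr>\<^esub>a\<in>UNIV. P x a u) = u" for x
      using finsum_subspace [OF K, of UNIV "\<lambda>a. P x a u"] PK [OF u] P_sum [OF KC [OF u]] by simp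
    show "(\<Oplus>\<^bsub>H\<lparr>carrier := K\<rparr>\<^esub>b\<in>UNIV. Q y b u) = u" for y
      using finsum_subspace [OF K, of UNIV "\<lambda>b. Q y b u"] QK [OF u] Q_sum [OF KC [OF u]] by simp
    show "P x a (Q y b u) = Q y b (P x a u)" for x a y b by (rule commute [OF KC [OF u]])
  qed (use \<open>\<xi> \<in> K\<close> commuting_pvms.xi(2) [OF assms(1)] in simp_all)
qed

end

section \<open>Carriers of small cardinality\<close>

text \<open>Sets of naturals are coded by ternary expansions with digits 0 and 1. At the first place where two sets
  differ, the digit outweighs everything that follows, since \<open>1/3 + 1/9 + \<dots> = 1/2 < 1\<close>.\<close>
lemma nat_set_lepoll_real: "(UNIV :: nat set set) \<lesssim> (UNIV :: real set)"
proof -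
  define d :: "nat set \<Rightarrow> nat \<Rightarrow> real" where "d S n = (if n \<in> S then (1/3) ^ n else 0)" for S n
  have d: "0 \<le> d S n" "d S n \<le> (1/3) ^ n" for S n by (simp_all add: d_def)
  have geo: "summable (\<lambda>n. (1/3 :: real) ^ n)" by (rule summable_geometric) simp
  have sm: "summable (d S)" for S
    by (rule summable_comparison_test' [OF geo, of 0]) (use d in auto)
  have less: "suminf (d T) < suminf (d S)" if n: "n \<in> S" "n \<notin> T" and below: "\<And>k. k < n \<Longrightarrow> k \<in> S \<longleftrightarrow> k \<in> T" for S T n
  proof -
    have head: "sum (d S) {..<Suc n} = sum (d T) {..<Suc n} + (1/3) ^ n"
      using n below by (simp add: d_def)
    have "(\<Sum>k. d T (k + Suc n)) \<le> (\<Sum>k. (1/3) ^ Suc n * (1/3) ^ k)"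
    proof (rule suminf_le)
      show "d T (k + Suc n) \<le> (1/3) ^ Suc n * (1/3) ^ k" for k
        using d(2) [of T "k + Suc n"] by (simp add: power_add mult.commute)
      show "summable (\<lambda>k. d T (k + Suc n))" using sm by (rule summable_ignore_initial_segment)
      show "summable (\<lambda>k. (1/3 :: real) ^ Suc n * (1/3) ^ k)" using geo by (rule summable_mult)
    qed
    also have "\<dots> = (1/3) ^ Suc n * (3/2)"
      using suminf_geometric [of "1/3 :: real"] by (subst suminf_mult [OF geo]) simp
    also have "\<dots> < (1/3) ^ n" by simp
    finally have "(\<Sum>k. d T (k + Suc n)) < (1/3) ^ n" .
    moreover have "0 \<le> (\<Sum>k. d S (k + Suc n))"
      using d by (intro suminf_nonneg summable_ignore_initial_segment sm)
    ultimately show ?thesis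
      using head suminf_split_initial_segment [OF sm, of S "Suc n"] suminf_split_initial_segment [OF sm, of T "Suc n"]
      by linarith
  qed
  have "inj (\<lambda>S. suminf (d S))"
  proof (rule injI, rule ccontr)
    fix S T assume eq: "suminf (d S) = suminf (d T)" and "S \<noteq> T"
    then obtain m where "(m \<in> S) \<noteq> (m \<in> T)" by blast
    then obtain n where "(n \<in> S) \<noteq> (n \<in> T)" "\<And>k. k < n \<Longrightarrow> (k \<in> S) = (k \<in> T)"
      using exists_least_iff [of "\<lambda>n. (n \<in> S) \<noteq> (n \<in> T)"] by blast
    then show False using less [of n S T] less [of n T S] eq by auto
  qed
  then show ?thesis unfolding lepoll_def by blast
qed

text \<open>A complex number is determined by the rational lower cuts of its real and its imaginary part, so a
  function on a countable set is determined by a subset of a countable set.\<close>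
lemma complex_functions_lepoll_nat_sets:
  "(UNIV :: ('i::countable \<Rightarrow> complex) set) \<lesssim> (UNIV :: nat set set)"
proof -
  define part :: "bool \<Rightarrow> complex \<Rightarrow> real" where "part b z = (if b then Re z else Im z)" for b z
  define code :: "('i \<Rightarrow> complex) \<Rightarrow> ('i \<times> bool \<times> rat) set"
    where "code g = {(i, b, q). real_of_rat q < part b (g i)}" for g
  have le: "part b (g i) \<le> part b (h i)" if "code g = code h" for g h b i
  proof (rule ccontr)
    assume "\<not> ?thesis"
    then obtain q where "part b (h i) < of_rat q" "of_rat q < part b (g i)"
      using of_rat_dense by (meson not_le)
    then have "(i, b, q) \<in> code g" "(i, b, q) \<notin> code h" by (auto simp: code_def)
    then show False using that by simp
  qed
  have "inj code"
  proof (rule injI, rule ext)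
    fix g h i assume "code g = code h"
    then have "part b (g i) = part b (h i)" for b using le by (metis antisym)
    from this [of True] this [of False] show "g i = h i" by (simp add: part_def complex_eq_iff)
  qed
  then have "inj (\<lambda>g. to_nat ` code g)" by (auto simp: inj_def inj_image_eq_iff)
  then show ?thesis unfolding lepoll_def by blast
qed

text \<open>This is how objects get onto a given type of the size of the continuum: it suffices that they are
  determined by countably many complex numbers.\<close>
lemma lepoll_if_complex_functions:
  assumes "(UNIV :: real set) \<lesssim> (UNIV :: 'k set)"
    and "inj_on (g :: 's \<Rightarrow> 'i::countable \<Rightarrow> complex) C"
  shows "\<exists>J :: 's \<Rightarrow> 'k. inj_on J C"
proof -
  have "(UNIV :: ('i \<Rightarrow> complex) set) \<lesssim> (UNIV :: 'k set)"
    by (rule lepoll_trans [OF complex_functions_lepoll_nat_sets lepoll_trans [OF nat_set_lepoll_real assms(1)]])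
  then obtain f :: "('i \<Rightarrow> complex) \<Rightarrow> 'k" where "inj f" by (auto simp: lepoll_def)
  then have "inj_on (f \<circ> g) C" using assms(2) by (auto simp: inj_on_def)
  then show ?thesis by blast
qed

section \<open>Transport of a Hilbert space to another type\<close>

lemma mcomplete_iff_sequences:
  assumes "Metric_space M d"
  shows "Metric_space.mcomplete M d \<longleftrightarrow>
    (\<forall>s. (\<forall>n. s n \<in> M) \<and> (\<forall>\<epsilon>>0. \<exists>N. \<forall>m\<ge>N. \<forall>n\<ge>N. d (s m) (s n) < \<epsilon>) \<longrightarrow>
      (\<exists>l\<in>M. (\<lambda>n. d (s n) l) \<longlonglongrightarrow> 0))"
proof -
  interpret Metric_space M d by fact
  have cau: "MCauchy s \<longleftrightarrow> (\<forall>n. s n \<in> M) \<and> (\<forall>\<epsilon>>0. \<exists>N. \<forall>m\<ge>N. \<forall>n\<ge>N. d (s m) (s n) < \<epsilon>)" for s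
    by (auto simp: MCauchy_def image_subset_iff)
  have lim: "limitin mtopology s l sequentially \<longleftrightarrow> l \<in> M \<and> (\<lambda>n. d (s n) l) \<longlonglongrightarrow> 0"
    if "\<forall>n. s n \<in> M" for s l
    using that by (auto simp: limit_metric_sequentially LIMSEQ_iff)
  show ?thesis unfolding mcomplete_def cau using lim by blast
qed

text \<open>Elements outside the carrier are read as zero. Then the distance that the operations induce is
  symmetric and non-negative on the whole type, as the notion of a metric space requires.\<close>
locale hilbert_transport = complete_inner_space H
  for H :: "('h, 'm) inner_product_space_scheme" (structure) +
  fixes J :: "'h \<Rightarrow> 'k"
  assumes J: "inj_on J (carrier H)"
begin

definition decode :: "'k \<Rightarrow> 'h" where
  "decode v = (if v \<in> J ` carrier H then inv_into (carrier H) J v else \<zero>)"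

lemma decode_J [simp]: "u \<in> carrier H \<Longrightarrow> decode (J u) = u"
  by (simp add: decode_def J)

lemma decode_closed [simp]: "decode v \<in> carrier H"
  by (auto simp: decode_def inv_into_into)

lemma J_decode: "v \<in> J ` carrier H \<Longrightarrow> J (decode v) = v"
  by (auto simp: J)

lemma J_eq_iff: "u \<in> carrier H \<Longrightarrow> v \<in> carrier H \<Longrightarrow> J u = J v \<longleftrightarrow> u = v"
  using J by (simp add: inj_on_eq_iff)

definition copy :: "'k inner_product_space" where
  "copy = \<lparr>carrier = J ` carrier H, mult = undefined, one = undefined, zero = J \<zero>,
     add = (\<lambda>u v. J (decode u \<oplus> decode v)), smult = (\<lambda>c u. J (c \<odot> decode u)),
     inner_prod = (\<lambda>u v. ip (decode u) (decode v))\<rparr>"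

lemma copy_simps [simp]:
  "carrier copy = J ` carrier H" "\<zero>\<^bsub>copy\<^esub> = J \<zero>" "u \<oplus>\<^bsub>copy\<^esub> v = J (decode u \<oplus> decode v)"
  "c \<odot>\<^bsub>copy\<^esub> u = J (c \<odot> decode u)" "inner_prod copy u v = ip (decode u) (decode v)"
  by (simp_all add: copy_def)

lemma module_copy: "module complex_ring copy"
proof (rule moduleI [OF cring_complex_ring])
  show "abelian_group copy"
  proof (rule abelian_groupI)
    fix v assume "v \<in> carrier copy"
    then show "\<exists>w\<in>carrier copy. w \<oplus>\<^bsub>copy\<^esub> v = \<zero>\<^bsub>copy\<^esub>"
      by (intro bexI [of _ "J (\<ominus> decode v)"]) (auto simp: M.l_neg)
  qed (auto simp: M.a_ac)
qed (auto simp: scale_add_left scale_add_right scale_assoc)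

lemma hnorm_copy_diff: "hnorm copy (u \<ominus>\<^bsub>copy\<^esub> v) = nm (decode u \<ominus> decode v)"
proof -
  have "\<ominus>\<^bsub>copy\<^esub> v = J (\<ominus> decode v)"
    unfolding a_inv_def [of copy] m_inv_def [of "add_monoid copy"]
  proof (rule the_equality)
    fix w assume w: "w \<in> carrier (add_monoid copy) \<and> v \<otimes>\<^bsub>add_monoid copy\<^esub> w = \<one>\<^bsub>add_monoid copy\<^esub> \<and>
        w \<otimes>\<^bsub>add_monoid copy\<^esub> v = \<one>\<^bsub>add_monoid copy\<^esub>"
    then have "decode w \<oplus> decode v = \<zero>" by (auto simp: J_eq_iff)
    then have "decode w = \<ominus> decode v" by (simp add: M.minus_equality)
    then show "w = J (\<ominus> decode v)" using w J_decode [of w] by simp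
  qed (auto simp: M.l_neg M.r_neg)
  then show ?thesis by (simp add: hnorm_def a_minus_def)
qed

theorem hilbert_space_copy: "hilbert_space copy"
  unfolding hilbert_space_def
proof (intro conjI module_copy hilbert_space_axioms.intro)
  let ?d = "\<lambda>u v. hnorm copy (u \<ominus>\<^bsub>copy\<^esub> v)"
  have M: "Metric_space (carrier copy) ?d"
    unfolding hnorm_copy_diff
  proof
    show "nm (decode u \<ominus> decode v) = nm (decode v \<ominus> decode u)" for u v
      by (rule nm_diff_commute) auto
    show "nm (decode u \<ominus> decode w) \<le> nm (decode u \<ominus> decode v) + nm (decode v \<ominus> decode w)" for u v w
      by (rule nm_diff_triangle) auto
    fix u v assume "u \<in> carrier copy" "v \<in> carrier copy"
    then show "nm (decode u \<ominus> decode v) = 0 \<longleftrightarrow> u = v"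
      using nm_eq_0D [of "decode u \<ominus> decode v"] diff_eq_zeroD by fastforce
  qed simp
  show "Metric_space.mcomplete (carrier copy) ?d"
    unfolding hnorm_copy_diff mcomplete_iff_sequences [OF M, unfolded hnorm_copy_diff]
  proof (intro allI impI)
    fix s :: "nat \<Rightarrow> 'k" assume "(\<forall>n. s n \<in> carrier copy) \<and>
      (\<forall>\<epsilon>>0. \<exists>N. \<forall>m\<ge>N. \<forall>n\<ge>N. nm (decode (s m) \<ominus> decode (s n)) < \<epsilon>)"
    then have "cauchy_seq (\<lambda>n. decode (s n))" by (simp add: cauchy_seq_def)
    then obtain l where "converges (\<lambda>n. decode (s n)) l" using cauchy_converges by blast
    then show "\<exists>l\<in>carrier copy. (\<lambda>n. nm (decode (s n) \<ominus> decode l)) \<longlonglongrightarrow> 0"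
      by (intro bexI [of _ "J l"]) (auto simp: converges_def)
  qed
qed (auto simp: ip_add_right ip_scale_right ip_nonneg dest: definite intro: ip_commute)

definition copy_op :: "('h \<Rightarrow> 'h) \<Rightarrow> 'k \<Rightarrow> 'k" where
  "copy_op T v = J (T (decode v))"

lemma projection_operator_copy:
  assumes T: "projector T"
  shows "projection_operator copy (copy_op T)"
proof -
  note [simp] = projectorD [OF T]
  have "hnorm copy (copy_op T u) \<le> 1 * hnorm copy u" for u
    using nm_projector_le [OF T, of "decode u"] by (simp add: hnorm_def copy_op_def)
  then have ex: "\<exists>C. \<forall>u\<in>carrier copy. hnorm copy (copy_op T u) \<le> C * hnorm copy u" by blast
  show ?thesis
    unfolding projection_operator_def bounded_operator_def by (intro conjI ex) (auto simp: copy_op_def)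
qed

lemma finsum_copy:
  assumes "finite I" "\<And>i. i \<in> I \<Longrightarrow> g i \<in> carrier H"
  shows "(\<Oplus>\<^bsub>copy\<^esub>i\<in>I. J (g i)) = J (\<Oplus>i\<in>I. g i)"
proof -
  interpret C: module complex_ring copy by (rule module_copy)
  show ?thesis using assms
  proof (induction I rule: finite_induct)
    case (insert i I)
    then have "g \<in> I \<rightarrow> carrier H" by auto
    with insert show ?case by (simp add: C.M.finsum_insert M.finsum_insert)
  qed simp
qed

lemma PVM_copy:
  assumes T: "\<And>i. projector (T i)" and sum: "\<And>u. u \<in> carrier H \<Longrightarrow> (\<Oplus>i\<in>UNIV. T i u) = u"
  shows "PVM copy (\<lambda>i::'i::finite. copy_op (T i))"
  unfolding PVM_def
proof (intro conjI allI ballI projection_operator_copy T)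
  fix u assume "u \<in> carrier copy"
  then show "(\<Oplus>\<^bsub>copy\<^esub>i\<in>UNIV. copy_op (T i) u) = u"
    using projectorD(1) [OF T] sum J_decode by (simp add: copy_op_def finsum_copy)
qed

end

lemma qc_correlationsI:
  fixes H :: "('h, 'm) inner_product_space_scheme" and J :: "'h \<Rightarrow> 'k"
  assumes "complete_inner_space H" "commuting_pvms H P Q \<xi>" "inj_on J (carrier H)"
    and p: "\<And>x y a b. complex_of_real (p a b x y) = inner_prod H \<xi> (P x a (Q y b \<xi>))"
  shows "p \<in> qc_correlations TYPE('k)"
proof -
  interpret commuting_pvms H P Q \<xi> by fact
  interpret complete_inner_space H by fact
  interpret hilbert_transport H J by unfold_locales fact
  have "PVM copy (\<lambda>a. copy_op (P x a))" "PVM copy (\<lambda>b. copy_op (Q y b))" for x y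
    using P Q P_sum Q_sum PVM_copy by metis+
  moreover have "hnorm copy (J \<xi>) = 1" by (simp add: hnorm_def xi)
  ultimately show ?thesis
    unfolding qc_correlations_def
    by (intro CollectI exI [of _ copy] exI [of _ "J \<xi>"] exI [of _ "\<lambda>x a. copy_op (P x a)"]
        exI [of _ "\<lambda>y b. copy_op (Q y b)"])
      (auto simp: hilbert_space_copy xi copy_op_def commute p)
qed

section \<open>The commutant as a C*-algebra\<close>

context complete_inner_space begin

definition adjoint_pair :: "('h \<Rightarrow> 'h) \<Rightarrow> ('h \<Rightarrow> 'h) \<Rightarrow> bool" where
  "adjoint_pair T T' \<longleftrightarrow> (\<forall>u\<in>carrier H. T u \<in> carrier H \<and> T' u \<in> carrier H) \<and>
     (\<forall>u\<in>carrier H. \<forall>v\<in>carrier H. ip (T u) v = ip u (T' v))"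

text \<open>Operators are taken below to be bounded maps that possess an adjoint. Linearity then follows by moving
  the map to the other side of the inner product.\<close>
lemma adjoint_pairD:
  assumes "adjoint_pair T T'" and u: "u \<in> carrier H"
  shows "T u \<in> carrier H" "T' u \<in> carrier H" "v \<in> carrier H \<Longrightarrow> ip (T u) v = ip u (T' v)"
    "v \<in> carrier H \<Longrightarrow> ip (T' u) v = ip u (T v)"
    "v \<in> carrier H \<Longrightarrow> T (u \<oplus> v) = T u \<oplus> T v" "T (c \<odot> u) = c \<odot> T u"
proof -
  have cl [simp]: "\<And>u. u \<in> carrier H \<Longrightarrow> T u \<in> carrier H" "\<And>u. u \<in> carrier H \<Longrightarrow> T' u \<in> carrier H"
    and adj: "\<And>u v. u \<in> carrier H \<Longrightarrow> v \<in> carrier H \<Longrightarrow> ip (T u) v = ip u (T' v)"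
    using assms(1) by (auto simp: adjoint_pair_def)
  have adj': "ip (T' w) v = ip w (T v)" if "w \<in> carrier H" "v \<in> carrier H" for w v
    using ip_commute [of v "T' w"] ip_commute [of "T v" w] adj [of v w] that by simp
  show "T u \<in> carrier H" "T' u \<in> carrier H" "v \<in> carrier H \<Longrightarrow> ip (T u) v = ip u (T' v)"
    "v \<in> carrier H \<Longrightarrow> ip (T' u) v = ip u (T v)"
    using u adj adj' by auto
  show "T (c \<odot> u) = c \<odot> T u"
    by (rule ip_eqI) (use u in \<open>simp_all add: ip_simps flip: adj'\<close>)
  show "T (u \<oplus> v) = T u \<oplus> T v" if "v \<in> carrier H"
    by (rule ip_eqI) (use u that in \<open>simp_all add: ip_simps flip: adj'\<close>)
qed

lemma adjoint_pair_sym: "adjoint_pair T T' \<Longrightarrow> adjoint_pair T' T"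
  using adjoint_pairD(1,2,4) unfolding adjoint_pair_def [of T' T] by blast

lemma adjoint_pair_unique:
  assumes "adjoint_pair T T'" "adjoint_pair T T''" "u \<in> carrier H"
  shows "T' u = T'' u"
proof (rule ip_eqI)
  fix w assume w: "w \<in> carrier H"
  show "ip w (T' u) = ip w (T'' u)"
    using adjoint_pairD(3) [OF assms(1) w assms(3)] adjoint_pairD(3) [OF assms(2) w assms(3)] by simp
qed (use adjoint_pairD(2) assms in blast)+

definition bound_by :: "('h \<Rightarrow> 'h) \<Rightarrow> real \<Rightarrow> bool" where
  "bound_by T C \<longleftrightarrow> 0 \<le> C \<and> (\<forall>u\<in>carrier H. nm (T u) \<le> C * nm u)"

definition opnorm :: "('h \<Rightarrow> 'h) \<Rightarrow> real" where
  "opnorm T = Inf (Collect (bound_by T))"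

lemma opnorm_le: "bound_by T C \<Longrightarrow> opnorm T \<le> C"
  unfolding opnorm_def by (rule cInf_lower) (auto simp: bound_by_def intro: bdd_belowI [of _ 0])

lemma bound_by_opnorm:
  assumes "bound_by T C"
  shows "bound_by T (opnorm T)"
proof -
  have ne: "Collect (bound_by T) \<noteq> {}" using assms by blast
  have "nm (T u) \<le> opnorm T * nm u" if u: "u \<in> carrier H" for u
  proof (cases "nm u = 0")
    case True
    then show ?thesis using assms u by (auto simp: bound_by_def)
  next
    case False
    then have pos: "0 < nm u" using u nm_nonneg [of u] by linarith
    have "nm (T u) / nm u \<le> opnorm T" unfolding opnorm_def
      by (rule cInf_greatest [OF ne]) (use u pos in \<open>auto simp: bound_by_def divide_le_eq\<close>)
    then show ?thesis using pos by (simp add: divide_le_eq)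
  qed
  moreover have "0 \<le> opnorm T" unfolding opnorm_def
    by (rule cInf_greatest [OF ne]) (simp add: bound_by_def)
  ultimately show ?thesis by (simp add: bound_by_def)
qed

lemma bound_by_adjoint:
  assumes T: "adjoint_pair T T'" and C: "bound_by T C"
  shows "bound_by T' C"
  unfolding bound_by_def
proof (intro conjI ballI)
  show "0 \<le> C" using C by (simp add: bound_by_def)
  fix u assume u: "u \<in> carrier H"
  have [simp]: "T' u \<in> carrier H" "T (T' u) \<in> carrier H"
    using adjoint_pairD(1,2) [OF T] u by auto
  have "ip (T' u) (T' u) = ip u (T (T' u))" using u by (simp add: adjoint_pairD(4) [OF T])
  then have "(nm (T' u))\<^sup>2 = Re (ip u (T (T' u)))" by (simp add: nm_square)
  also have "\<dots> \<le> nm u * nm (T (T' u))"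
    using cauchy_schwarz [of u "T (T' u)"] complex_Re_le_cmod [of "ip u (T (T' u))"] u by simp
  also have "\<dots> \<le> nm u * (C * nm (T' u))"
    using C u by (intro mult_left_mono) (auto simp: bound_by_def)
  finally have le: "nm (T' u) * nm (T' u) \<le> (C * nm u) * nm (T' u)" by (simp add: power2_eq_square mult_ac)
  show "nm (T' u) \<le> C * nm u"
  proof (cases "nm (T' u) = 0")
    case True
    then show ?thesis using \<open>0 \<le> C\<close> u by simp
  next
    case False
    then have "0 < nm (T' u)" by (simp add: order_less_le)
    then show ?thesis using le mult_right_le_imp_le by blast
  qed
qed

end

locale projector_family = complete_inner_space H
  for H :: "('h, 'm) inner_product_space_scheme" (structure) +
  fixes R :: "'i \<Rightarrow> 'h \<Rightarrow> 'h"
  assumes R: "projector (R i)"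
begin

text \<open>Operators vanish outside the carrier, so that an operator is determined by its values on the
  carrier.\<close>
definition commutant :: "('h \<Rightarrow> 'h) set" where
  "commutant = {T. (\<exists>T'. adjoint_pair T T') \<and> (\<exists>C. bound_by T C) \<and>
     (\<forall>i. \<forall>u\<in>carrier H. T (R i u) = R i (T u)) \<and> (\<forall>u. u \<notin> carrier H \<longrightarrow> T u = \<zero>)}"

definition adj :: "('h \<Rightarrow> 'h) \<Rightarrow> 'h \<Rightarrow> 'h" where
  "adj T u = (if u \<in> carrier H then (SOME T'. adjoint_pair T T') u else \<zero>)"

lemma commutantI:
  assumes "adjoint_pair T T'" "bound_by T C" "\<And>i u. u \<in> carrier H \<Longrightarrow> T (R i u) = R i (T u)"
    "\<And>u. u \<notin> carrier H \<Longrightarrow> T u = \<zero>"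
  shows "T \<in> commutant"
  using assms unfolding commutant_def by blast

lemma adjoint_pair_adj:
  assumes "T \<in> commutant"
  shows "adjoint_pair T (adj T)"
proof -
  define T' where "T' = (SOME T'. adjoint_pair T T')"
  have "adjoint_pair T T'"
    using assms unfolding T'_def by (intro someI_ex [of "adjoint_pair T"]) (simp add: commutant_def)
  then show ?thesis by (simp add: adjoint_pair_def adj_def flip: T'_def)
qed

lemma commutantD:
  assumes "T \<in> commutant"
  shows "bound_by T (opnorm T)" "u \<in> carrier H \<Longrightarrow> T (R i u) = R i (T u)"
    "u \<notin> carrier H \<Longrightarrow> T u = \<zero>" "0 \<le> opnorm T" "u \<in> carrier H \<Longrightarrow> nm (T u) \<le> opnorm T * nm u"
    "T \<zero> = \<zero>"
proof -
  show *: "bound_by T (opnorm T)" using assms bound_by_opnorm unfolding commutant_def by blast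
  show "u \<in> carrier H \<Longrightarrow> T (R i u) = R i (T u)" "u \<notin> carrier H \<Longrightarrow> T u = \<zero>"
    using assms unfolding commutant_def by blast+
  show "0 \<le> opnorm T" "u \<in> carrier H \<Longrightarrow> nm (T u) \<le> opnorm T * nm u"
    using * by (auto simp: bound_by_def)
  show "T \<zero> = \<zero>"
    using adjoint_pairD(6) [OF adjoint_pair_adj [OF assms], of \<zero> 0] adjoint_pairD(1) [OF adjoint_pair_adj [OF assms], of \<zero>]
    by simp
qed

lemmas commutant_linear = adjoint_pairD [OF adjoint_pair_adj]

lemma commutant_closed: "T \<in> commutant \<Longrightarrow> T u \<in> carrier H"
  using commutant_linear(1) commutantD(3) by (metis M.zero_closed)

lemma commutant_eqI:
  assumes "S \<in> commutant" "T \<in> commutant" "\<And>u. u \<in> carrier H \<Longrightarrow> S u = T u"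
  shows "S = T"
proof
  fix u show "S u = T u"
    using assms(3) [of u] commutantD(3) [OF assms(1), of u] commutantD(3) [OF assms(2), of u]
    by (cases "u \<in> carrier H") auto
qed

lemma adj_eqI:
  assumes "T \<in> commutant" "adjoint_pair T T'" "\<And>u. u \<notin> carrier H \<Longrightarrow> T' u = \<zero>"
  shows "adj T = T'"
proof
  fix u show "adj T u = T' u"
    using assms adjoint_pair_unique [OF adjoint_pair_adj [OF assms(1)] assms(2)]
    by (cases "u \<in> carrier H") (auto simp: adj_def)
qed

lemma adj_commutant:
  assumes T: "T \<in> commutant"
  shows "adj T \<in> commutant"
proof (rule commutantI)
  note [simp] = commutant_linear(1,2) [OF T] projectorD(1) [OF R]
  show "adjoint_pair (adj T) T" by (rule adjoint_pair_sym [OF adjoint_pair_adj [OF T]])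
  show "bound_by (adj T) (opnorm T)"
    by (rule bound_by_adjoint [OF adjoint_pair_adj [OF T] commutantD(1) [OF T]])
  show "adj T u = \<zero>" if "u \<notin> carrier H" for u using that by (simp add: adj_def)
  show "adj T (R i u) = R i (adj T u)" if u: "u \<in> carrier H" for i u
  proof (rule ip_eqI)
    fix w assume w: "w \<in> carrier H"
    have "ip w (adj T (R i u)) = ip (R i (T w)) u"
      using u w by (simp add: projectorD(5) [OF R] flip: commutant_linear(3) [OF T])
    also have "\<dots> = ip (T (R i w)) u" using w by (simp add: commutantD(2) [OF T])
    also have "\<dots> = ip w (R i (adj T u))"
      using u w by (simp add: commutant_linear(3) [OF T] projectorD(5) [OF R])
    finally show "ip w (adj T (R i u)) = ip w (R i (adj T u))" .
  qed (use u in simp_all)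
qed

lemma adj_adj: "T \<in> commutant \<Longrightarrow> adj (adj T) = T"
  by (rule adj_eqI) (auto intro: adj_commutant adjoint_pair_sym adjoint_pair_adj commutantD(3))

definition op_add where "op_add S T = (\<lambda>u. S u \<oplus> T u)"
definition op_scale where "op_scale c T = (\<lambda>u. c \<odot> T u)"
definition op_mult where "op_mult S T = (\<lambda>u. S (T u))" for S T :: "'h \<Rightarrow> 'h"
definition op_one where "op_one = (\<lambda>u. if u \<in> carrier H then u else \<zero>)"
definition op_zero :: "'h \<Rightarrow> 'h" where "op_zero = (\<lambda>u. \<zero>)"

lemma op_add:
  assumes S: "S \<in> commutant" and T: "T \<in> commutant"
  shows "op_add S T \<in> commutant" "adj (op_add S T) = op_add (adj S) (adj T)"
    "opnorm (op_add S T) \<le> opnorm S + opnorm T"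
proof -
  note [simp] = commutant_linear(1,2) [OF S] commutant_linear(1,2) [OF T] projectorD(1) [OF R]
  have ap: "adjoint_pair (op_add S T) (op_add (adj S) (adj T))"
    by (auto simp: adjoint_pair_def op_add_def ip_simps commutant_linear(3) [OF S] commutant_linear(3) [OF T])
  have bd: "bound_by (op_add S T) (opnorm S + opnorm T)" unfolding bound_by_def
  proof (intro conjI ballI)
    fix u assume u: "u \<in> carrier H"
    show "nm (op_add S T u) \<le> (opnorm S + opnorm T) * nm u"
      using nm_triangle [of "S u" "T u"] commutantD(5) [OF S u] commutantD(5) [OF T u] u
      by (simp add: op_add_def distrib_right)
  qed (use commutantD(4) S T in simp)
  show "op_add S T \<in> commutant"
    by (rule commutantI [OF ap bd])
      (auto simp: op_add_def projectorD(2) [OF R] commutantD(2,3) [OF S] commutantD(2,3) [OF T])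
  then show "adj (op_add S T) = op_add (adj S) (adj T)"
    by (rule adj_eqI [OF _ ap]) (simp add: op_add_def adj_def)
  show "opnorm (op_add S T) \<le> opnorm S + opnorm T" by (rule opnorm_le [OF bd])
qed

lemma op_scale:
  assumes T: "T \<in> commutant"
  shows "op_scale c T \<in> commutant" "adj (op_scale c T) = op_scale (cnj c) (adj T)"
    "opnorm (op_scale c T) \<le> cmod c * opnorm T"
proof -
  note [simp] = commutant_linear(1,2) [OF T] projectorD(1) [OF R]
  have ap: "adjoint_pair (op_scale c T) (op_scale (cnj c) (adj T))"
    by (auto simp: adjoint_pair_def op_scale_def ip_simps commutant_linear(3) [OF T])
  have bd: "bound_by (op_scale c T) (cmod c * opnorm T)" unfolding bound_by_def
  proof (intro conjI ballI)
    fix u assume u: "u \<in> carrier H"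
    show "nm (op_scale c T u) \<le> cmod c * opnorm T * nm u"
      using mult_left_mono [OF commutantD(5) [OF T u], of "cmod c"] u
      by (simp add: op_scale_def nm_scale mult.assoc)
  qed (use commutantD(4) T in simp)
  show "op_scale c T \<in> commutant"
    by (rule commutantI [OF ap bd]) (auto simp: op_scale_def projectorD(3) [OF R] commutantD(2,3) [OF T])
  then show "adj (op_scale c T) = op_scale (cnj c) (adj T)"
    by (rule adj_eqI [OF _ ap]) (simp add: op_scale_def adj_def)
  show "opnorm (op_scale c T) \<le> cmod c * opnorm T" by (rule opnorm_le [OF bd])
qed

lemma op_mult:
  assumes S: "S \<in> commutant" and T: "T \<in> commutant"
  shows "op_mult S T \<in> commutant" "adj (op_mult S T) = op_mult (adj T) (adj S)"
    "opnorm (op_mult S T) \<le> opnorm S * opnorm T"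
proof -
  note [simp] = commutant_linear(1,2) [OF S] commutant_linear(1,2) [OF T] projectorD(1) [OF R]
  have ap: "adjoint_pair (op_mult S T) (op_mult (adj T) (adj S))"
    by (auto simp: adjoint_pair_def op_mult_def commutant_linear(3) [OF S] commutant_linear(3) [OF T])
  have bd: "bound_by (op_mult S T) (opnorm S * opnorm T)" unfolding bound_by_def
  proof (intro conjI ballI)
    fix u assume u: "u \<in> carrier H"
    have "nm (S (T u)) \<le> opnorm S * nm (T u)" using u by (intro commutantD(5) [OF S]) simp
    also have "\<dots> \<le> opnorm S * (opnorm T * nm u)"
      using commutantD(4) [OF S] commutantD(5) [OF T u] by (rule mult_left_mono [rotated])
    finally show "nm (op_mult S T u) \<le> opnorm S * opnorm T * nm u" by (simp add: op_mult_def mult.assoc)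
  qed (use commutantD(4) S T in simp)
  show "op_mult S T \<in> commutant"
    by (rule commutantI [OF ap bd])
      (auto simp: op_mult_def commutantD(2,3,6) [OF S] commutantD(2,3) [OF T])
  then show "adj (op_mult S T) = op_mult (adj T) (adj S)"
    by (rule adj_eqI [OF _ ap]) (simp add: op_mult_def commutantD(3) [OF adj_commutant [OF S]] commutantD(6) [OF adj_commutant [OF T]])
  show "opnorm (op_mult S T) \<le> opnorm S * opnorm T" by (rule opnorm_le [OF bd])
qed

lemma op_one: "op_one \<in> commutant"
  by (rule commutantI [where T' = op_one and C = 1])
    (auto simp: op_one_def adjoint_pair_def bound_by_def projectorD(1) [OF R])

lemma op_zero: "op_zero \<in> commutant" "opnorm op_zero = 0"
proof -
  have bd: "bound_by op_zero 0" by (simp add: op_zero_def bound_by_def)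
  show "op_zero \<in> commutant"
    by (rule commutantI [where T' = op_zero, OF _ bd])
      (auto simp: op_zero_def adjoint_pair_def projector_zero [OF R])
  show "opnorm op_zero = 0"
    using opnorm_le [OF bd] bound_by_opnorm [OF bd] by (simp add: bound_by_def)
qed

lemma opnorm_eq_0D:
  assumes T: "T \<in> commutant" and "opnorm T = 0"
  shows "T = op_zero"
proof (rule commutant_eqI [OF T op_zero(1)])
  fix u assume u: "u \<in> carrier H"
  have [simp]: "T u \<in> carrier H" using commutant_linear(1) [OF T u] .
  have "nm (T u) \<le> 0" using commutantD(5) [OF T u] \<open>opnorm T = 0\<close> by simp
  then have "nm (T u) = 0" using nm_nonneg [OF \<open>T u \<in> carrier H\<close>] by (rule antisym)
  then show "T u = op_zero u" by (simp add: nm_eq_0D op_zero_def)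
qed

lemma opnorm_scale:
  assumes T: "T \<in> commutant"
  shows "opnorm (op_scale c T) = cmod c * opnorm T"
proof (cases "c = 0")
  case True
  then have "op_scale c T = op_zero" using commutant_closed [OF T] by (simp add: op_scale_def op_zero_def)
  then show ?thesis using True by (simp add: op_zero)
next
  case False
  have "op_scale (1/c) (op_scale c T) = T"
    using False commutant_closed [OF T] by (auto simp: op_scale_def simp flip: scale_assoc)
  then have "opnorm T \<le> cmod (1/c) * opnorm (op_scale c T)"
    using op_scale(3) [OF op_scale(1) [OF T], of "1/c" c] by simp
  then have "cmod c * opnorm T \<le> opnorm (op_scale c T)"
    using False by (simp add: norm_divide field_simps)
  then show ?thesis using op_scale(3) [OF T, of c] by simp
qed

lemma opnorm_adj: "T \<in> commutant \<Longrightarrow> opnorm (adj T) \<le> opnorm T"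
  by (intro opnorm_le bound_by_adjoint [OF adjoint_pair_adj] commutantD(1))

lemma cstar_identity:
  assumes T: "T \<in> commutant"
  shows "opnorm (op_mult (adj T) T) = (opnorm T)\<^sup>2"
proof (rule antisym)
  note A = adj_commutant [OF T]
  have "opnorm (op_mult (adj T) T) \<le> opnorm (adj T) * opnorm T" by (rule op_mult(3) [OF A T])
  also have "\<dots> \<le> opnorm T * opnorm T"
    using opnorm_adj [OF T] commutantD(4) [OF T] by (rule mult_right_mono)
  finally show "opnorm (op_mult (adj T) T) \<le> (opnorm T)\<^sup>2" by (simp add: power2_eq_square)
  let ?c = "opnorm (op_mult (adj T) T)"
  have c0: "0 \<le> ?c" by (rule commutantD(4) [OF op_mult(1) [OF A T]])
  have "bound_by T (sqrt ?c)" unfolding bound_by_def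
  proof (intro conjI ballI)
    fix u assume u: "u \<in> carrier H"
    note [simp] = commutant_linear(1,2) [OF T]
    have "(nm (T u))\<^sup>2 = Re (ip u (op_mult (adj T) T u))"
      using u by (simp add: nm_square op_mult_def commutant_linear(3) [OF T])
    also have "\<dots> \<le> nm u * nm (op_mult (adj T) T u)"
      using cauchy_schwarz [of u "op_mult (adj T) T u"] u complex_Re_le_cmod order_trans
        commutant_closed [OF op_mult(1) [OF A T]] by blast
    also have "\<dots> \<le> nm u * (?c * nm u)"
      using u commutantD(5) [OF op_mult(1) [OF A T] u] by (intro mult_left_mono) auto
    also have "\<dots> = (sqrt ?c * nm u)\<^sup>2" using c0 by (simp add: power_mult_distrib) (simp add: power2_eq_square)
    finally show "nm (T u) \<le> sqrt ?c * nm u"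
      by (rule power2_le_imp_le) (use c0 u in simp)
  qed (use c0 in simp)
  then have "opnorm T \<le> sqrt ?c" by (rule opnorm_le)
  then have "(opnorm T)\<^sup>2 \<le> (sqrt ?c)\<^sup>2" using commutantD(4) [OF T] by (rule power_mono)
  then show "(opnorm T)\<^sup>2 \<le> ?c" using c0 by simp
qed

definition op_diff where "op_diff S T = op_add S (op_scale (-1) T)"

lemma op_diff: "S \<in> commutant \<Longrightarrow> T \<in> commutant \<Longrightarrow> op_diff S T \<in> commutant"
  by (simp add: op_diff_def op_add op_scale)

lemma op_diff_apply: "S \<in> commutant \<Longrightarrow> T \<in> commutant \<Longrightarrow> op_diff S T u = S u \<ominus> T u"
  by (simp add: op_diff_def op_add_def op_scale_def diff_eq_scale commutant_closed)

lemma adj_op_diff: "S \<in> commutant \<Longrightarrow> T \<in> commutant \<Longrightarrow> adj (op_diff S T) = op_diff (adj S) (adj T)"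
  by (simp add: op_diff_def op_add op_scale)

text \<open>A norm-Cauchy sequence of operators converges pointwise, and so does the sequence of the adjoints; the
  two limits are adjoint to each other. Commutation with the family and operator norm bounds pass to the
  limit, as they are conditions on inner products and norms at single vectors.\<close>
lemma commutant_complete:
  assumes T: "\<And>n. T n \<in> commutant"
    and cauchy: "\<And>\<epsilon>. 0 < \<epsilon> \<Longrightarrow> \<exists>N. \<forall>m\<ge>N. \<forall>n\<ge>N. opnorm (op_diff (T m) (T n)) < \<epsilon>"
  shows "\<exists>L\<in>commutant. (\<lambda>n. opnorm (op_diff (T n) L)) \<longlonglongrightarrow> 0"
proof -
  have Tu [simp]: "T n u \<in> carrier H" "adj (T n) u \<in> carrier H" for n u
    using commutant_closed T adj_commutant by auto
  have cs: "cauchy_seq (\<lambda>n. S n u)"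
    if u: "u \<in> carrier H" and S: "\<And>n. S n u \<in> carrier H"
      and le: "\<And>m n. nm (S m u \<ominus> S n u) \<le> opnorm (op_diff (T m) (T n)) * nm u"
    for S :: "nat \<Rightarrow> 'h \<Rightarrow> 'h" and u
    unfolding cauchy_seq_def
  proof (intro conjI allI impI S)
    fix \<epsilon> :: real assume e: "0 < \<epsilon>"
    then obtain N where N: "\<And>m n. m\<ge>N \<Longrightarrow> n\<ge>N \<Longrightarrow> opnorm (op_diff (T m) (T n)) < \<epsilon> / (nm u + 1)"
      using cauchy [of "\<epsilon> / (nm u + 1)"] nm_nonneg [OF u] by (auto simp: add_nonneg_pos)
    have "nm (S m u \<ominus> S n u) < \<epsilon>" if "m \<ge> N" "n \<ge> N" for m n
    proof -
      have "nm (S m u \<ominus> S n u) \<le> opnorm (op_diff (T m) (T n)) * (nm u + 1)"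
        using le [of m n] commutantD(4) [OF op_diff [OF T T], of m n] by (simp add: distrib_left)
      also have "\<dots> < \<epsilon> / (nm u + 1) * (nm u + 1)"
        using N [OF that] nm_nonneg [OF u] by (intro mult_strict_right_mono) auto
      also have "\<dots> = \<epsilon>" using nm_nonneg [OF u] by (simp add: add_nonneg_eq_0_iff)
      finally show ?thesis .
    qed
    then show "\<exists>N. \<forall>m\<ge>N. \<forall>n\<ge>N. nm (S m u \<ominus> S n u) < \<epsilon>" by blast
  qed
  have le: "nm (T m u \<ominus> T n u) \<le> opnorm (op_diff (T m) (T n)) * nm u" if "u \<in> carrier H" for m n u
    using commutantD(5) [OF op_diff [OF T T] that] by (simp add: op_diff_apply T)
  have "\<exists>l. converges (\<lambda>n. T n u) l" if "u \<in> carrier H" for u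
    by (rule cauchy_converges [OF cs]) (use that le in auto)
  then obtain L0 where L0: "\<And>u. u \<in> carrier H \<Longrightarrow> converges (\<lambda>n. T n u) (L0 u)" by metis
  have "\<exists>l. converges (\<lambda>n. adj (T n) u) l" if "u \<in> carrier H" for u
  proof (rule cauchy_converges [OF cs])
    show "nm (adj (T m) u \<ominus> adj (T n) u) \<le> opnorm (op_diff (T m) (T n)) * nm u" for m n
    proof -
      have "adj (T m) u \<ominus> adj (T n) u = adj (op_diff (T m) (T n)) u"
        by (simp add: adj_op_diff op_diff_apply T adj_commutant)
      moreover have "bound_by (adj (op_diff (T m) (T n))) (opnorm (op_diff (T m) (T n)))"
        by (intro bound_by_adjoint [OF adjoint_pair_adj] commutantD(1) op_diff T)
      ultimately show ?thesis using that by (simp add: bound_by_def)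
    qed
  qed (use that in auto)
  then obtain L' where L': "\<And>u. u \<in> carrier H \<Longrightarrow> converges (\<lambda>n. adj (T n) u) (L' u)" by metis
  define L where "L u = (if u \<in> carrier H then L0 u else \<zero>)" for u
  have L: "converges (\<lambda>n. T n u) (L u)" if "u \<in> carrier H" for u using L0 that by (simp add: L_def)
  have Lc [simp]: "L u \<in> carrier H" "L' u \<in> carrier H" if "u \<in> carrier H" for u
    using convergesD(2) L L' that by blast+
  have ap: "adjoint_pair L L'" unfolding adjoint_pair_def
  proof (intro conjI ballI)
    fix u v assume u: "u \<in> carrier H" and v: "v \<in> carrier H"
    have "(\<lambda>n. ip (T n u) v) \<longlonglongrightarrow> ip (L u) v" by (intro converges_ip L converges_const u v)
    moreover have "(\<lambda>n. ip u (adj (T n) v)) \<longlonglongrightarrow> ip u (L' v)" by (intro converges_ip L' converges_const u v)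
    ultimately show "ip (L u) v = ip u (L' v)"
      using u v LIMSEQ_unique by (simp add: commutant_linear(3) [OF T])
  qed auto
  have close: "bound_by (\<lambda>u. T n u \<ominus> L u) \<epsilon>"
    if N: "\<And>m n. m\<ge>N \<Longrightarrow> n\<ge>N \<Longrightarrow> opnorm (op_diff (T m) (T n)) < \<epsilon>" and n: "n \<ge> N" for n N \<epsilon>
    unfolding bound_by_def
  proof (intro conjI ballI)
    show "0 \<le> \<epsilon>" using N [OF n n] commutantD(4) [OF op_diff [OF T T], of n n] by simp
    fix u assume u: "u \<in> carrier H"
    have "converges (\<lambda>m. T n u \<ominus> T m u) (T n u \<ominus> L u)"
    proof -
      have "nm ((T n u \<ominus> T m u) \<ominus> (T n u \<ominus> L u)) = nm (T m u \<ominus> L u)" for m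
      proof -
        have "(T n u \<ominus> T m u) \<ominus> (T n u \<ominus> L u) = L u \<ominus> T m u"
          by (rule ip_eqI) (use u in \<open>simp_all add: ip_simps\<close>)
        then show ?thesis using u by (simp add: nm_diff_commute)
      qed
      then show ?thesis using convergesD(3) [OF L [OF u]] u by (simp add: converges_def)
    qed
    then have "(\<lambda>m. nm (T n u \<ominus> T m u)) \<longlonglongrightarrow> nm (T n u \<ominus> L u)" by (rule converges_nm)
    moreover have "\<forall>m\<ge>N. nm (T n u \<ominus> T m u) \<le> \<epsilon> * nm u"
    proof (intro allI impI)
      fix m assume m: "m \<ge> N"
      have "opnorm (op_diff (T n) (T m)) * nm u \<le> \<epsilon> * nm u"
        using N [OF n m] u by (intro mult_right_mono) auto
      then show "nm (T n u \<ominus> T m u) \<le> \<epsilon> * nm u" using le [OF u, of n m] by linarith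
    qed
    ultimately show "nm (T n u \<ominus> L u) \<le> \<epsilon> * nm u" by (intro LIMSEQ_le_const2) blast+
  qed
  obtain N1 where N1: "\<And>m n. m\<ge>N1 \<Longrightarrow> n\<ge>N1 \<Longrightarrow> opnorm (op_diff (T m) (T n)) < 1"
    using cauchy [of 1] by auto
  have bd: "bound_by L (opnorm (T N1) + 1)" unfolding bound_by_def
  proof (intro conjI ballI)
    show "0 \<le> opnorm (T N1) + 1" using commutantD(4) [OF T, of N1] by simp
    fix u assume u: "u \<in> carrier H"
    have "nm (L u) \<le> nm (T N1 u) + nm (T N1 u \<ominus> L u)"
      using nm_triangle_sub [of "L u" "T N1 u"] nm_diff_commute [of "L u" "T N1 u"] u by simp
    also have "\<dots> \<le> opnorm (T N1) * nm u + 1 * nm u"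
      using commutantD(5) [OF T u, of N1] close [OF N1, of N1] u by (intro add_mono) (auto simp: bound_by_def)
    finally show "nm (L u) \<le> (opnorm (T N1) + 1) * nm u" by (simp add: distrib_right)
  qed
  have LA: "L \<in> commutant"
  proof (rule commutantI [OF ap bd])
    note [simp] = projectorD(1) [OF R]
    fix i u assume u: "u \<in> carrier H"
    show "L (R i u) = R i (L u)"
    proof (rule ip_eqI)
      fix w assume w: "w \<in> carrier H"
      have "(\<lambda>n. ip w (T n (R i u))) \<longlonglongrightarrow> ip w (L (R i u))"
        by (intro converges_ip L converges_const w) (use u in simp)
      moreover have "(\<lambda>n. ip (R i w) (T n u)) \<longlonglongrightarrow> ip (R i w) (L u)"
        by (intro converges_ip L converges_const u) (use w in simp)
      moreover have "ip w (T n (R i u)) = ip (R i w) (T n u)" for n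
        using u w by (simp add: commutantD(2) [OF T] projectorD(5) [OF R])
      ultimately have "ip w (L (R i u)) = ip (R i w) (L u)" using LIMSEQ_unique by simp
      then show "ip w (L (R i u)) = ip w (R i (L u))" using u w by (simp add: projectorD(5) [OF R])
    qed (use u in simp_all)
  qed (simp add: L_def)
  moreover have "(\<lambda>n. opnorm (op_diff (T n) L)) \<longlonglongrightarrow> 0"
  proof (rule LIMSEQ_I)
    fix \<epsilon> :: real assume e: "0 < \<epsilon>"
    then obtain N where N: "\<And>m n. m\<ge>N \<Longrightarrow> n\<ge>N \<Longrightarrow> opnorm (op_diff (T m) (T n)) < \<epsilon> / 2"
      using cauchy [of "\<epsilon> / 2"] by auto
    have "norm (opnorm (op_diff (T n) L) - 0) < \<epsilon>" if "n \<ge> N" for n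
    proof -
      have "op_diff (T n) L = (\<lambda>u. T n u \<ominus> L u)" using op_diff_apply [OF T LA] by blast
      then have "opnorm (op_diff (T n) L) \<le> \<epsilon> / 2" using opnorm_le [OF close [OF N that]] by simp
      then show ?thesis using commutantD(4) [OF op_diff [OF T LA], of n] e by simp
    qed
    then show "\<exists>N. \<forall>n\<ge>N. norm (opnorm (op_diff (T n) L) - 0) < \<epsilon>" by blast
  qed
  ultimately show ?thesis by blast
qed

end

text \<open>The injection \<open>J\<close> moves the operators to the type of the game algebra, where the universal property can
  be applied. As in the transport of a Hilbert space, elements outside the carrier are read as zero, so that
  the distance is a metric in the sense of \<open>Metric_space\<close>.\<close>
locale coded_commutant = projector_family H R
  for H :: "('h, 'm) inner_product_space_scheme" (structure) and R :: "'i \<Rightarrow> 'h \<Rightarrow> 'h" +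
  fixes J :: "('h \<Rightarrow> 'h) \<Rightarrow> 'c"
  assumes J: "inj_on J commutant"
begin

definition decode :: "'c \<Rightarrow> 'h \<Rightarrow> 'h" where
  "decode x = (if x \<in> J ` commutant then inv_into commutant J x else op_zero)"

lemma decode_J [simp]: "T \<in> commutant \<Longrightarrow> decode (J T) = T"
  by (simp add: decode_def J)

lemma decode_in [simp]: "decode x \<in> commutant"
  by (auto simp: decode_def inv_into_into op_zero)

lemma J_decode: "x \<in> J ` commutant \<Longrightarrow> J (decode x) = x"
  by (auto simp: J)

lemma J_eq_iff: "S \<in> commutant \<Longrightarrow> T \<in> commutant \<Longrightarrow> J S = J T \<longleftrightarrow> S = T"
  using J by (simp add: inj_on_eq_iff)

definition alg :: "'c cstar_structure" where
  "alg = \<lparr>carrier = J ` commutant, mult = (\<lambda>x y. J (op_mult (decode x) (decode y))), one = J op_one,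
     zero = J op_zero, add = (\<lambda>x y. J (op_add (decode x) (decode y))),
     smult = (\<lambda>c x. J (op_scale c (decode x))), star = (\<lambda>x. J (adj (decode x))),
     cnorm = (\<lambda>x. opnorm (decode x))\<rparr>"

lemma alg_simps [simp]:
  "carrier alg = J ` commutant" "x \<otimes>\<^bsub>alg\<^esub> y = J (op_mult (decode x) (decode y))" "\<one>\<^bsub>alg\<^esub> = J op_one"
  "\<zero>\<^bsub>alg\<^esub> = J op_zero" "x \<oplus>\<^bsub>alg\<^esub> y = J (op_add (decode x) (decode y))"
  "c \<odot>\<^bsub>alg\<^esub> x = J (op_scale c (decode x))" "star alg x = J (adj (decode x))" "cnorm alg x = opnorm (decode x)"
  by (simp_all add: alg_def)

lemmas op_in [simp] = op_add(1) op_scale(1) op_mult(1) op_one op_zero(1) adj_commutant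

lemma op_arith1:
  assumes T: "T \<in> commutant"
  shows "op_add op_zero T = T" "op_add (op_scale (-1) T) T = op_zero" "op_add T (op_scale (-1) T) = op_zero"
    "op_mult op_one T = T" "op_mult T op_one = T"
    "op_scale (c + d) T = op_add (op_scale c T) (op_scale d T)"
    "op_scale (c * d) T = op_scale c (op_scale d T)" "op_scale 1 T = T"
proof -
  note [simp] = commutant_closed [OF T]
  show "op_add op_zero T = T" "op_add (op_scale (-1) T) T = op_zero" "op_add T (op_scale (-1) T) = op_zero"
    by (simp_all add: op_add_def op_zero_def op_scale_def M.l_neg M.r_neg flip: uminus_eq_scale)
  show "op_mult op_one T = T" "op_scale (c + d) T = op_add (op_scale c T) (op_scale d T)"
    "op_scale (c * d) T = op_scale c (op_scale d T)" "op_scale 1 T = T"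
    by (simp_all add: op_mult_def op_one_def op_scale_def op_add_def scale_add_left scale_assoc)
  show "op_mult T op_one = T"
    by (rule commutant_eqI [OF op_mult(1) [OF T op_one] T]) (simp add: op_mult_def op_one_def)
qed

lemma op_arith2:
  assumes S: "S \<in> commutant" and T: "T \<in> commutant"
  shows "op_add S T = op_add T S" "op_scale c (op_add S T) = op_add (op_scale c S) (op_scale c T)"
    "op_mult (op_scale c S) T = op_scale c (op_mult S T)"
    "op_mult S (op_scale c T) = op_scale c (op_mult S T)"
  using commutant_closed [OF S] commutant_closed [OF T] commutant_linear(6) [OF S]
  by (simp_all add: op_add_def op_scale_def op_mult_def scale_add_right M.a_comm)

lemma op_arith3:
  assumes S: "S \<in> commutant" and T: "T \<in> commutant" and U: "U \<in> commutant"
  shows "op_add (op_add S T) U = op_add S (op_add T U)"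
    "op_mult (op_mult S T) U = op_mult S (op_mult T U)"
    "op_mult (op_add S T) U = op_add (op_mult S U) (op_mult T U)"
    "op_mult S (op_add T U) = op_add (op_mult S T) (op_mult S U)"
  using commutant_closed [OF S] commutant_closed [OF T] commutant_closed [OF U] commutant_linear(5) [OF S]
  by (simp_all add: op_add_def op_mult_def M.a_assoc)

lemmas op_arith = op_arith1 op_arith2(2-) op_arith3

lemma abelian_group_alg: "abelian_group alg"
proof (rule abelian_groupI)
  fix x assume "x \<in> carrier alg"
  then show "\<exists>y\<in>carrier alg. y \<oplus>\<^bsub>alg\<^esub> x = \<zero>\<^bsub>alg\<^esub>"
    by (intro bexI [of _ "J (op_scale (-1) (decode x))"]) (auto simp: op_arith)
next
  fix x y assume "x \<in> carrier alg" "y \<in> carrier alg"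
  then show "x \<oplus>\<^bsub>alg\<^esub> y = y \<oplus>\<^bsub>alg\<^esub> x" using op_arith2(1) [of "decode x" "decode y"] by simp
qed (auto simp: op_arith)

lemma ring_alg: "ring alg"
proof (rule ringI [OF abelian_group_alg])
  show "Group.monoid alg" by (rule monoidI) (auto simp: op_arith)
qed (auto simp: op_arith)

lemma module_alg: "module complex_ring alg"
  by (rule moduleI [OF cring_complex_ring abelian_group_alg]) (auto simp: op_arith)

lemma cnorm_alg_diff: "cnorm alg (x \<ominus>\<^bsub>alg\<^esub> y) = opnorm (op_diff (decode x) (decode y))"
proof -
  interpret G: abelian_group alg by (rule abelian_group_alg)
  have "\<ominus>\<^bsub>alg\<^esub> y = J (op_scale (-1) (decode y))"
    unfolding a_inv_def [of alg] m_inv_def [of "add_monoid alg"]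
  proof (rule the_equality)
    fix z assume z: "z \<in> carrier (add_monoid alg) \<and> y \<otimes>\<^bsub>add_monoid alg\<^esub> z = \<one>\<^bsub>add_monoid alg\<^esub> \<and>
        z \<otimes>\<^bsub>add_monoid alg\<^esub> y = \<one>\<^bsub>add_monoid alg\<^esub>"
    then have "op_add (decode z) (decode y) = op_zero" by (auto simp: J_eq_iff)
    then have "op_add (op_add (decode z) (decode y)) (op_scale (-1) (decode y)) = op_scale (-1) (decode y)"
      by (simp add: op_arith)
    then have "decode z = op_scale (-1) (decode y)"
      using op_arith2(1) [of "decode z" op_zero] by (simp add: op_arith)
    then show "z = J (op_scale (-1) (decode y))" using z J_decode [of z] by simp
  qed (auto simp: op_arith)
  then show ?thesis by (simp add: a_minus_def op_diff_def)
qed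

theorem unital_cstar_algebra_alg: "unital_cstar_algebra alg"
  unfolding unital_cstar_algebra_def
proof (intro conjI ring_alg module_alg unital_cstar_algebra_axioms.intro)
  let ?d = "\<lambda>x y. cnorm alg (x \<ominus>\<^bsub>alg\<^esub> y)"
  let ?f = "\<lambda>x y. opnorm (op_diff (decode x) (decode y))"
  have M: "Metric_space (carrier alg) ?f"
  proof
    note [simp] = commutant_closed
    show "0 \<le> ?f x y" for x y by (rule commutantD(4) [OF op_diff]) auto
    show "?f x y = ?f y x" for x y
    proof -
      have "op_diff (decode x) (decode y) = op_scale (-1) (op_diff (decode y) (decode x))"
        by (rule commutant_eqI)
          (simp_all add: op_diff op_scale(1), simp add: op_scale_def op_diff_apply diff_eq_scale scale_add_right M.a_comm flip: scale_assoc)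
      then show ?thesis using opnorm_scale [OF op_diff, of "decode y" "decode x" "-1"] by simp
    qed
    show "?f x z \<le> ?f x y + ?f y z" for x y z
    proof -
      have "op_diff (decode x) (decode z) = op_add (op_diff (decode x) (decode y)) (op_diff (decode y) (decode z))"
      proof (rule commutant_eqI)
        fix u assume "u \<in> carrier H"
        show "op_diff (decode x) (decode z) u = op_add (op_diff (decode x) (decode y)) (op_diff (decode y) (decode z)) u"
          by (rule ip_eqI) (simp_all add: op_add_def op_diff_apply ip_simps)
      qed (simp_all add: op_diff)
      then show ?thesis using op_add(3) [OF op_diff op_diff] by simp
    qed
    fix x y assume xy: "x \<in> carrier alg" "y \<in> carrier alg"
    show "?f x y = 0 \<longleftrightarrow> x = y"
    proof
      assume "?f x y = 0"
      then have 0: "op_diff (decode x) (decode y) = op_zero" by (intro opnorm_eq_0D op_diff) auto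
      have "decode x = decode y"
      proof
        fix u
        have "decode x u \<ominus> decode y u = \<zero>" using fun_cong [OF 0, of u] by (simp add: op_diff_apply op_zero_def)
        then show "decode x u = decode y u" by (rule diff_eq_zeroD) auto
      qed
      then show "x = y" using xy J_decode by (metis alg_simps(1))
    next
      assume "x = y"
      then have "op_diff (decode x) (decode y) = op_zero" by (simp add: op_diff_def op_arith)
      then show "?f x y = 0" by (simp add: op_zero)
    qed
  qed
  show "Metric_space.mcomplete (carrier alg) ?d"
    unfolding cnorm_alg_diff mcomplete_iff_sequences [OF M]
  proof (intro allI impI)
    fix s :: "nat \<Rightarrow> 'c" assume s: "(\<forall>n. s n \<in> carrier alg) \<and> (\<forall>\<epsilon>>0. \<exists>N. \<forall>m\<ge>N. \<forall>n\<ge>N. ?f (s m) (s n) < \<epsilon>)"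
    then have "\<exists>L\<in>commutant. (\<lambda>n. opnorm (op_diff (decode (s n)) L)) \<longlonglongrightarrow> 0"
      by (intro commutant_complete) auto
    then show "\<exists>l\<in>carrier alg. (\<lambda>n. ?f (s n) l) \<longlonglongrightarrow> 0" by auto
  qed
next
  fix x assume x: "x \<in> carrier alg"
  show "cnorm alg x = 0 \<longleftrightarrow> x = \<zero>\<^bsub>alg\<^esub>"
    using x opnorm_eq_0D op_zero(2) by (auto simp: J_eq_iff)
  show "cnorm alg (star alg x \<otimes>\<^bsub>alg\<^esub> x) = (cnorm alg x)\<^sup>2"
    by (simp add: cstar_identity)
  fix c show "cnorm alg (c \<odot>\<^bsub>alg\<^esub> x) = cmod c * cnorm alg x" by (simp add: opnorm_scale)
qed (auto simp: op_arith op_add op_scale op_mult adj_adj commutantD(4))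

text \<open>Members of the commutant vanish outside the carrier, whereas a projection of the Hilbert space is
  arbitrary there; hence the cut-off.\<close>
definition restrict_op :: "('h \<Rightarrow> 'h) \<Rightarrow> 'h \<Rightarrow> 'h" where
  "restrict_op T u = (if u \<in> carrier H then T u else \<zero>)"

lemma restrict_op_commutant:
  assumes T: "projector T" and comm: "\<And>i u. u \<in> carrier H \<Longrightarrow> T (R i u) = R i (T u)"
  shows "restrict_op T \<in> commutant" "adj (restrict_op T) = restrict_op T"
    "op_mult (restrict_op T) (restrict_op T) = restrict_op T"
proof -
  note [simp] = projectorD(1,4) [OF T] projectorD(1) [OF R] projector_zero [OF T]
  have ap: "adjoint_pair (restrict_op T) (restrict_op T)"
    by (auto simp: adjoint_pair_def restrict_op_def projectorD(5) [OF T])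
  show "restrict_op T \<in> commutant"
    by (rule commutantI [OF ap, of 1])
      (auto simp: restrict_op_def bound_by_def nm_projector_le [OF T] comm)
  then show "adj (restrict_op T) = restrict_op T"
    by (rule adj_eqI [OF _ ap]) (simp add: restrict_op_def)
  show "op_mult (restrict_op T) (restrict_op T) = restrict_op T"
    by (auto simp: op_mult_def restrict_op_def)
qed

lemma cstar_projection_J:
  "projector T \<Longrightarrow> (\<And>i u. u \<in> carrier H \<Longrightarrow> T (R i u) = R i (T u)) \<Longrightarrow> cstar_projection alg (J (restrict_op T))"
  using restrict_op_commutant [of T] by (simp add: cstar_projection_def)

lemma finsum_alg:
  assumes "finite I" "\<And>i. i \<in> I \<Longrightarrow> T i \<in> commutant"
  shows "(\<lambda>u. \<Oplus>i\<in>I. T i u) \<in> commutant \<and> (\<Oplus>\<^bsub>alg\<^esub>i\<in>I. J (T i)) = J (\<lambda>u. \<Oplus>i\<in>I. T i u)"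
proof -
  interpret G: abelian_group alg by (rule abelian_group_alg)
  show ?thesis using assms
  proof (induction I rule: finite_induct)
    case empty
    show ?case using op_zero(1) by (simp add: op_zero_def)
  next
    case (insert i I)
    then have "T i \<in> commutant" and IH: "(\<lambda>u. \<Oplus>i\<in>I. T i u) \<in> commutant"
      "(\<Oplus>\<^bsub>alg\<^esub>i\<in>I. J (T i)) = J (\<lambda>u. \<Oplus>i\<in>I. T i u)" by auto
    have "(\<lambda>i. T i u) \<in> I \<rightarrow> carrier H" "T i u \<in> carrier H" for u
      using insert.prems commutant_closed by auto
    then have eq: "(\<lambda>u. \<Oplus>i\<in>insert i I. T i u) = op_add (T i) (\<lambda>u. \<Oplus>i\<in>I. T i u)"
      using insert.hyps by (simp add: op_add_def M.finsum_insert)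
    have "(\<lambda>i. J (T i)) \<in> I \<rightarrow> carrier alg" using insert.prems by auto
    then have "(\<Oplus>\<^bsub>alg\<^esub>i\<in>insert i I. J (T i)) = J (T i) \<oplus>\<^bsub>alg\<^esub> J (\<lambda>u. \<Oplus>i\<in>I. T i u)"
      using insert.hyps \<open>T i \<in> commutant\<close> IH(2) by (simp add: G.finsum_insert del: alg_simps(5))
    then show ?case unfolding eq using \<open>T i \<in> commutant\<close> IH(1) by simp
  qed
qed

end

section \<open>The trace\<close>

text \<open>The vector \<open>\<xi>\<close> is cyclic for the family \<open>R\<close>, and every \<open>R i\<close> has a mirror image \<open>S i\<close> in the
  commutant that acts on \<open>\<xi>\<close> in the same way.\<close>
locale mirrored_family = projector_family H R
  for H :: "('h, 'm) inner_product_space_scheme" (structure) and R :: "'i \<Rightarrow> 'h \<Rightarrow> 'h" +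
  fixes S :: "'i \<Rightarrow> 'h \<Rightarrow> 'h" and \<xi> :: 'h
  assumes xi: "\<xi> \<in> carrier H"
    and S: "projector (S i)"
    and SR: "u \<in> carrier H \<Longrightarrow> S i (R j u) = R j (S i u)"
    and mirror: "S i \<xi> = R i \<xi>"
    and total: "\<lbrakk>u \<in> carrier H; \<And>ws. inner_prod H (foldr R ws \<xi>) u = 0\<rbrakk> \<Longrightarrow> u = \<zero>"
begin

text \<open>The second argument is the adjoint of the first. It is carried along since the trace property is used
  in the form \<open>\<parallel>w* \<xi>\<parallel> = \<parallel>w \<xi>\<parallel>\<close>.\<close>
inductive polynomial :: "('h \<Rightarrow> 'h) \<Rightarrow> ('h \<Rightarrow> 'h) \<Rightarrow> bool" where
  one: "polynomial (\<lambda>u. u) (\<lambda>u. u)"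
| gen: "polynomial w w' \<Longrightarrow> polynomial (\<lambda>u. R i (w u)) (\<lambda>u. w' (R i u))"
| sum: "polynomial w w' \<Longrightarrow> polynomial v v' \<Longrightarrow> polynomial (\<lambda>u. w u \<oplus> v u) (\<lambda>u. w' u \<oplus> v' u)"
| scale: "polynomial w w' \<Longrightarrow> polynomial (\<lambda>u. c \<odot> w u) (\<lambda>u. cnj c \<odot> w' u)"

lemma R_closed [simp]: "u \<in> carrier H \<Longrightarrow> R i u \<in> carrier H"
  by (rule projectorD(1) [OF R])

lemma S_closed [simp]: "u \<in> carrier H \<Longrightarrow> S i u \<in> carrier H"
  by (rule projectorD(1) [OF S])

lemma polynomial_adjoint: "polynomial w w' \<Longrightarrow> adjoint_pair w w'"
proof (induction rule: polynomial.induct)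
  case one
  then show ?case by (simp add: adjoint_pair_def)
next
  case (gen w w' i)
  then show ?case by (simp add: adjoint_pair_def projectorD(5) [OF R])
qed (simp_all add: adjoint_pair_def ip_simps)

lemma polynomial_S:
  assumes "polynomial w w'" "u \<in> carrier H"
  shows "S i (w u) = w (S i u) \<and> S i (w' u) = w' (S i u)"
  using assms
proof (induction arbitrary: u rule: polynomial.induct)
  case (gen w w' j)
  have "w u \<in> carrier H" using adjoint_pairD(1) [OF polynomial_adjoint [OF gen.hyps]] gen.prems by blast
  with gen show ?case by (simp add: SR)
next
  case (sum w w' v v')
  have "w u \<in> carrier H" "w' u \<in> carrier H" "v u \<in> carrier H" "v' u \<in> carrier H"
    using adjoint_pairD(1,2) [OF polynomial_adjoint [OF sum.hyps(1)]]
      adjoint_pairD(1,2) [OF polynomial_adjoint [OF sum.hyps(2)]] sum.prems by blast+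
  with sum show ?case by (simp add: projectorD(2) [OF S])
next
  case (scale w w' c)
  have "w u \<in> carrier H" "w' u \<in> carrier H"
    using adjoint_pairD(1,2) [OF polynomial_adjoint [OF scale.hyps]] scale.prems by blast+
  with scale show ?case by (simp add: projectorD(3) [OF S])
qed simp

lemma polynomial_commutant:
  assumes "polynomial w w'" and T: "T \<in> commutant" and u: "u \<in> carrier H"
  shows "T (w u) = w (T u)"
  using assms(1) u
proof (induction rule: polynomial.induct)
  case (gen w w' i)
  then show ?case
    using adjoint_pairD(1) [OF polynomial_adjoint [OF gen.hyps]] by (simp add: commutantD(2) [OF T])
next
  case (sum w w' v v')
  then show ?case
    using adjoint_pairD(1) [OF polynomial_adjoint [OF sum.hyps(1)]]
      adjoint_pairD(1) [OF polynomial_adjoint [OF sum.hyps(2)]] by (simp add: commutant_linear(5) [OF T])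
next
  case (scale w w' c)
  then show ?case
    using adjoint_pairD(1) [OF polynomial_adjoint [OF scale.hyps]] by (simp add: commutant_linear(6) [OF T])
qed simp

text \<open>A generator moves from the left end of a product to the right end: at the vector it turns into its
  mirror image, which passes through the product and turns back.\<close>
lemma polynomial_trace:
  assumes "polynomial w w'"
    and "\<And>u. u \<in> carrier H \<Longrightarrow> X u \<in> carrier H"
    and "\<And>u v. u \<in> carrier H \<Longrightarrow> v \<in> carrier H \<Longrightarrow> X (u \<oplus> v) = X u \<oplus> X v"
    and "\<And>c u. u \<in> carrier H \<Longrightarrow> X (c \<odot> u) = c \<odot> X u"
    and "\<And>i u. u \<in> carrier H \<Longrightarrow> S i (X u) = X (S i u)"
  shows "ip \<xi> (w (X \<xi>)) = ip \<xi> (X (w \<xi>))"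
  using assms
proof (induction arbitrary: X rule: polynomial.induct)
  case (gen w w' i X)
  have wc [simp]: "\<And>u. u \<in> carrier H \<Longrightarrow> w u \<in> carrier H"
    using adjoint_pairD(1) [OF polynomial_adjoint [OF gen.hyps]] .
  note [simp] = xi gen.prems(1)
  have "ip \<xi> (R i (w (X \<xi>))) = ip (S i \<xi>) (w (X \<xi>))" by (simp add: mirror projectorD(5) [OF R])
  also have "\<dots> = ip \<xi> (S i (w (X \<xi>)))" by (rule projectorD(5) [OF S]) simp_all
  also have "S i (w (X \<xi>)) = w (X (R i \<xi>))"
    using polynomial_S [OF gen.hyps] by (simp add: gen.prems(4) mirror)
  also have "ip \<xi> (w (X (R i \<xi>))) = ip \<xi> (X (R i (w \<xi>)))"
    by (rule gen.IH) (simp_all add: gen.prems projectorD(2,3) [OF R] SR)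
  finally show ?case .
next
  case (sum w w' v v' X)
  note c = adjoint_pairD(1) [OF polynomial_adjoint [OF sum.hyps(1)]]
    adjoint_pairD(1) [OF polynomial_adjoint [OF sum.hyps(2)]]
  show ?case using sum.IH(1) [OF sum.prems] sum.IH(2) [OF sum.prems]
    by (simp add: c sum.prems(1,2) xi ip_simps)
next
  case (scale w w' c X)
  note c = adjoint_pairD(1) [OF polynomial_adjoint [OF scale.hyps]]
  show ?case using scale.IH [OF scale.prems]
    by (simp add: c scale.prems(1,3) xi ip_simps)
qed simp

lemma polynomial_adjoint_norm:
  assumes w: "polynomial w w'"
  shows "nm (w' \<xi>) = nm (w \<xi>)"
proof -
  note ap = polynomial_adjoint [OF w]
  note ap' = adjoint_pair_sym [OF ap]
  note [simp] = xi adjoint_pairD(1,2) [OF ap]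
  have "ip (w' \<xi>) (w' \<xi>) = ip \<xi> (w (w' \<xi>))" by (simp add: adjoint_pairD(4) [OF ap])
  also have "\<dots> = ip \<xi> (w' (w \<xi>))"
    by (rule polynomial_trace [OF w]) (simp_all add: adjoint_pairD(5,6) [OF ap'] polynomial_S [OF w])
  also have "\<dots> = ip (w \<xi>) (w \<xi>)" by (simp add: adjoint_pairD(3) [OF ap])
  finally show ?thesis by (simp add: hnorm_def)
qed

text \<open>The vectors that are approximated by polynomials in the family, applied to \<open>\<xi>\<close>, form a closed subspace.
  The component of a vector that is orthogonal to it is orthogonal to the word vectors, and so it vanishes.\<close>
lemma polynomial_dense:
  assumes u: "u \<in> carrier H" and "0 < \<epsilon>"
  shows "\<exists>w w'. polynomial w w' \<and> nm (u \<ominus> w \<xi>) < \<epsilon>"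
proof -
  define M where "M = {u \<in> carrier H. \<forall>\<epsilon>>0. \<exists>w w'. polynomial w w' \<and> nm (u \<ominus> w \<xi>) < \<epsilon>}"
  have wc: "w \<xi> \<in> carrier H" if "polynomial w w'" for w w'
    using adjoint_pairD(1) [OF polynomial_adjoint [OF that] xi] .
  have poly_M: "w \<xi> \<in> M" if "polynomial w w'" for w w'
  proof -
    have "nm (w \<xi> \<ominus> w \<xi>) < \<epsilon>" if "0 < \<epsilon>" for \<epsilon> using wc [OF \<open>polynomial w w'\<close>] that by simp
    then show ?thesis unfolding M_def using wc [OF that] that by blast
  qed
  have Mc: "M \<subseteq> carrier H" by (auto simp: M_def)
  have M: "closed_subspace M" unfolding closed_subspace_def
  proof (intro conjI ballI allI impI Mc)
    show "\<zero> \<in> M" using poly_M [OF polynomial.scale [OF polynomial.one], of 0] xi by simp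
  next
    fix u v assume uv: "u \<in> M" "v \<in> M"
    then have [simp]: "u \<in> carrier H" "v \<in> carrier H" using Mc by auto
    have "\<exists>w w'. polynomial w w' \<and> nm ((u \<oplus> v) \<ominus> w \<xi>) < \<epsilon>" if "0 < \<epsilon>" for \<epsilon>
    proof -
      have "0 < \<epsilon> / 2" using that by simp
      then obtain w w' x x' where w: "polynomial w w'" "nm (u \<ominus> w \<xi>) < \<epsilon> / 2"
        and x: "polynomial x x'" "nm (v \<ominus> x \<xi>) < \<epsilon> / 2"
        using uv unfolding M_def by blast
      note [simp] = wc [OF w(1)] wc [OF x(1)]
      have "(u \<oplus> v) \<ominus> (w \<xi> \<oplus> x \<xi>) = (u \<ominus> w \<xi>) \<oplus> (v \<ominus> x \<xi>)"
        by (rule ip_eqI) (simp_all add: ip_simps)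
      then have "nm ((u \<oplus> v) \<ominus> (w \<xi> \<oplus> x \<xi>)) < \<epsilon>"
        using nm_triangle [of "u \<ominus> w \<xi>" "v \<ominus> x \<xi>"] w(2) x(2) by simp
      then show ?thesis using polynomial.sum [OF w(1) x(1)] by blast
    qed
    then show "u \<oplus> v \<in> M" by (simp add: M_def)
  next
    fix c u assume u: "u \<in> M"
    then have [simp]: "u \<in> carrier H" using Mc by auto
    have "\<exists>w w'. polynomial w w' \<and> nm (c \<odot> u \<ominus> w \<xi>) < \<epsilon>" if "0 < \<epsilon>" for \<epsilon>
    proof -
      have pos: "0 < cmod c + 1" by (simp add: add_nonneg_pos)
      then have "0 < \<epsilon> / (cmod c + 1)" using that by simp
      then obtain w w' where w: "polynomial w w'" "nm (u \<ominus> w \<xi>) < \<epsilon> / (cmod c + 1)"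
        using u unfolding M_def by blast
      note [simp] = wc [OF w(1)]
      have "nm (c \<odot> u \<ominus> c \<odot> w \<xi>) = cmod c * nm (u \<ominus> w \<xi>)"
        by (simp add: nm_scale flip: scale_diff_right)
      also have "\<dots> \<le> (cmod c + 1) * nm (u \<ominus> w \<xi>)" by (intro mult_right_mono) auto
      also have "\<dots> < \<epsilon>" using w(2) pos by (simp add: field_simps)
      finally show ?thesis using polynomial.scale [OF w(1)] by blast
    qed
    then show "c \<odot> u \<in> M" by (simp add: M_def)
  next
    fix s l assume s: "converges s l" "\<forall>n. s n \<in> M"
    note [simp] = convergesD(1,2) [OF s(1)]
    have "\<exists>w w'. polynomial w w' \<and> nm (l \<ominus> w \<xi>) < \<epsilon>" if "0 < \<epsilon>" for \<epsilon>
    proof -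
      have e: "0 < \<epsilon> / 2" using that by simp
      obtain n where n: "nm (s n \<ominus> l) < \<epsilon> / 2"
        using LIMSEQ_D [OF convergesD(3) [OF s(1)] e] by auto
      obtain w w' where w: "polynomial w w'" "nm (s n \<ominus> w \<xi>) < \<epsilon> / 2"
        using s(2) e unfolding M_def by blast
      have "nm (l \<ominus> w \<xi>) < \<epsilon>"
        using nm_diff_triangle [of l "s n" "w \<xi>"] nm_diff_commute [of l "s n"] wc [OF w(1)] n w(2) by simp
      then show ?thesis using w(1) by blast
    qed
    then show "l \<in> M" by (simp add: M_def)
  qed
  have words: "foldr R ws \<xi> \<in> M" for ws
  proof -
    have "\<exists>w w'. polynomial w w' \<and> foldr R ws \<xi> = w \<xi>"
    proof (induction ws)
      case Nil
      show ?case using polynomial.one by auto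
    next
      case (Cons i ws)
      then show ?case using polynomial.gen by fastforce
    qed
    then show ?thesis using poly_M by auto
  qed
  have pu: "proj M u \<in> M" "u \<ominus> proj M u \<in> orth M" using proj_in diff_proj_in_orth M u by blast+
  have "u \<ominus> proj M u = \<zero>"
    by (rule total) (use pu words in \<open>auto simp: orth_def\<close>)
  then have "u \<in> M" using pu u Mc diff_eq_zeroD by (metis subsetD)
  then show ?thesis using \<open>0 < \<epsilon>\<close> by (simp add: M_def)
qed

text \<open>Approximate \<open>T \<xi>\<close> by \<open>w \<xi>\<close>. As \<open>T\<close> commutes with \<open>w\<close>, the squares of \<open>\<parallel>w* \<xi> - T* \<xi>\<parallel>\<close> and
  \<open>\<parallel>w \<xi> - T \<xi>\<parallel>\<close> differ by \<open>\<parallel>T* \<xi>\<parallel>\<^sup>2 - \<parallel>T \<xi>\<parallel>\<^sup>2\<close> only, whence this difference is not negative.\<close>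
lemma nm_le_nm_adj:
  assumes T: "T \<in> commutant"
  shows "nm (T \<xi>) \<le> nm (adj T \<xi>)"
proof -
  note [simp] = xi commutant_closed [OF T] commutant_closed [OF adj_commutant [OF T]]
  have "(nm (T \<xi>))\<^sup>2 \<le> (nm (adj T \<xi>))\<^sup>2 + \<epsilon>" if "0 < \<epsilon>" for \<epsilon>
  proof -
    have "0 < sqrt \<epsilon>" using that by simp
    then obtain w w' where w: "polynomial w w'" and near: "nm (T \<xi> \<ominus> w \<xi>) < sqrt \<epsilon>"
      using polynomial_dense [of "T \<xi>" "sqrt \<epsilon>"] commutant_closed [OF T] by blast
    note ap = polynomial_adjoint [OF w]
    note [simp] = adjoint_pairD(1,2) [OF ap]
    have "ip (w' \<xi>) (adj T \<xi>) = ip \<xi> (w (adj T \<xi>))" by (simp add: adjoint_pairD(4) [OF ap])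
    also have "\<dots> = ip \<xi> (adj T (w \<xi>))" by (simp add: polynomial_commutant [OF w adj_commutant [OF T]])
    also have "\<dots> = ip (T \<xi>) (w \<xi>)" by (simp add: commutant_linear(3) [OF T])
    finally have eq: "ip (w' \<xi>) (adj T \<xi>) = ip (T \<xi>) (w \<xi>)" .
    have "0 \<le> (nm (w' \<xi> \<ominus> adj T \<xi>))\<^sup>2" by simp
    also have "\<dots> = (nm (w \<xi>))\<^sup>2 - 2 * Re (ip (T \<xi>) (w \<xi>)) + (nm (adj T \<xi>))\<^sup>2"
      by (simp add: nm_diff_square eq polynomial_adjoint_norm [OF w])
    also have "\<dots> = (nm (T \<xi> \<ominus> w \<xi>))\<^sup>2 - (nm (T \<xi>))\<^sup>2 + (nm (adj T \<xi>))\<^sup>2"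
      by (simp add: nm_diff_square)
    also have "(nm (T \<xi> \<ominus> w \<xi>))\<^sup>2 \<le> \<epsilon>"
      using power_mono [OF less_imp_le [OF near], of 2] that by simp
    finally show ?thesis by simp
  qed
  then have "(nm (T \<xi>))\<^sup>2 \<le> (nm (adj T \<xi>))\<^sup>2" by (rule field_le_epsilon)
  then show ?thesis by (rule power2_le_imp_le) simp
qed

lemma ip_adj_self:
  assumes T: "T \<in> commutant"
  shows "ip (adj T \<xi>) (adj T \<xi>) = ip (T \<xi>) (T \<xi>)"
proof -
  have "nm (adj T \<xi>) = nm (T \<xi>)"
    using nm_le_nm_adj [OF T] nm_le_nm_adj [OF adj_commutant [OF T]] by (simp add: adj_adj [OF T])
  then show ?thesis
    using commutant_closed [OF T] commutant_closed [OF adj_commutant [OF T]] by (simp add: ip_self)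
qed

text \<open>The identity \<open>\<parallel>T* \<xi>\<parallel> = \<parallel>T \<xi>\<parallel>\<close> is the trace property for the products of an operator with its own
  adjoint.\<close>
theorem vector_state_tracial:
  assumes T: "T \<in> commutant" and U: "U \<in> commutant"
  shows "ip \<xi> (T (U \<xi>)) = ip \<xi> (U (T \<xi>))"
proof -
  define V where "V = adj T"
  have V: "V \<in> commutant" and VT: "adj V = T" using T by (simp_all add: V_def adj_commutant adj_adj)
  note [simp] = xi commutant_closed [OF T] commutant_closed [OF U] commutant_closed [OF V]
    commutant_closed [OF adj_commutant [OF U]]
  \<comment> \<open>Both sides are sesquilinear forms, applied to \<open>V\<close> and \<open>U\<close>, that agree on the diagonal. Polarization at
    \<open>V + U\<close> and \<open>V + \<i> U\<close> shows that they agree.\<close>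
  have "ip (T \<xi>) (T \<xi>) = ip (V \<xi>) (V \<xi>)" "ip (adj U \<xi>) (adj U \<xi>) = ip (U \<xi>) (U \<xi>)"
    using ip_adj_self [OF V] ip_adj_self [OF U] by (simp_all add: VT)
  moreover have "ip (T \<xi> \<oplus> adj U \<xi>) (T \<xi> \<oplus> adj U \<xi>) = ip (V \<xi> \<oplus> U \<xi>) (V \<xi> \<oplus> U \<xi>)"
    using ip_adj_self [OF op_add(1) [OF V U]] by (simp add: op_add(2) [OF V U] VT) (simp add: op_add_def)
  moreover have "ip (T \<xi> \<oplus> (-\<i>) \<odot> adj U \<xi>) (T \<xi> \<oplus> (-\<i>) \<odot> adj U \<xi>) = ip (V \<xi> \<oplus> \<i> \<odot> U \<xi>) (V \<xi> \<oplus> \<i> \<odot> U \<xi>)"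
    using ip_adj_self [OF op_add(1) [OF V op_scale(1) [OF U, of \<i>]]]
    by (simp add: op_add(2) [OF V op_scale(1) [OF U]] op_scale(2) [OF U] VT) (simp add: op_add_def op_scale_def)
  ultimately have "ip (T \<xi>) (adj U \<xi>) + ip (adj U \<xi>) (T \<xi>) = ip (V \<xi>) (U \<xi>) + ip (U \<xi>) (V \<xi>)"
    "\<i> * (ip (adj U \<xi>) (T \<xi>) - ip (T \<xi>) (adj U \<xi>)) = \<i> * (ip (V \<xi>) (U \<xi>) - ip (U \<xi>) (V \<xi>))"
    by (simp_all add: ip_simps algebra_simps)
  then have "ip (adj U \<xi>) (T \<xi>) = ip (V \<xi>) (U \<xi>)"
    by (simp add: complex_eq_iff)
  moreover have "ip (adj U \<xi>) (T \<xi>) = ip \<xi> (U (T \<xi>))" by (simp add: commutant_linear(4) [OF U])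
  moreover have "ip (V \<xi>) (U \<xi>) = ip \<xi> (T (U \<xi>))" by (simp add: V_def commutant_linear(4) [OF T])
  ultimately show ?thesis by simp
qed

text \<open>The vector is separating for the commutant, since it is cyclic for the family.\<close>
lemma separating:
  assumes T: "T \<in> commutant" and U: "U \<in> commutant" and eq: "T \<xi> = U \<xi>"
  shows "T = U"
proof (rule commutant_eqI [OF T U])
  note [simp] = xi commutant_closed [OF T] commutant_closed [OF U]
    commutant_closed [OF adj_commutant [OF T]] commutant_closed [OF adj_commutant [OF U]]
  have wc [simp]: "foldr R ws \<xi> \<in> carrier H" for ws by (induction ws) auto
  have words: "T (foldr R ws \<xi>) = U (foldr R ws \<xi>)" for ws
    by (induction ws) (simp_all add: eq commutantD(2) [OF T] commutantD(2) [OF U])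
  have adj: "adj T v = adj U v" if v: "v \<in> carrier H" for v
  proof -
    have "ip (foldr R ws \<xi>) (adj T v \<ominus> adj U v) = 0" for ws
      using v words [of ws]
      by (simp add: ip_diff_right flip: commutant_linear(3) [OF T] commutant_linear(3) [OF U])
    then have "adj T v \<ominus> adj U v = \<zero>" by (intro total) auto
    then show ?thesis by (rule diff_eq_zeroD) auto
  qed
  fix u assume u: "u \<in> carrier H"
  show "T u = U u"
    by (rule ip_eqI) (use u adj in \<open>simp_all flip: commutant_linear(4) [OF T] commutant_linear(4) [OF U]\<close>)
qed

text \<open>Hence the commutant, which need not be separable in norm, has at most the cardinality of the continuum.\<close>
lemma coefficients_inj: "inj_on (\<lambda>T v. ip (foldr R v \<xi>) (T \<xi>)) commutant"
proof (rule inj_onI)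
  fix T U assume T: "T \<in> commutant" and U: "U \<in> commutant"
    and eq: "(\<lambda>v. ip (foldr R v \<xi>) (T \<xi>)) = (\<lambda>v. ip (foldr R v \<xi>) (U \<xi>))"
  have wc: "foldr R ws \<xi> \<in> carrier H" for ws by (induction ws) (auto simp: xi)
  have "ip (foldr R ws \<xi>) (T \<xi> \<ominus> U \<xi>) = 0" for ws
    using fun_cong [OF eq, of ws] wc commutant_closed [OF T] commutant_closed [OF U]
    by (simp add: ip_diff_right)
  then have "T \<xi> \<ominus> U \<xi> = \<zero>"
    using commutant_closed [OF T] commutant_closed [OF U] by (intro total) auto
  then have "T \<xi> = U \<xi>" using diff_eq_zeroD commutant_closed T U by blast
  then show "T = U" by (rule separating [OF T U])
qed

end

section \<open>Perfect strategies of imitation games\<close>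

context complete_inner_space begin

text \<open>Expand \<open>v\<close> along the projections: \<open>\<langle>u, v\<rangle>\<close> is the sum of the \<open>\<langle>T i u, T i v\<rangle>\<close>.\<close>
lemma pvm_orthogonal:
  assumes T: "\<And>i::'i::finite. projector (T i)" and sum: "(\<Oplus>i\<in>UNIV. T i v) = v"
    and u: "u \<in> carrier H" and v: "v \<in> carrier H" and disj: "\<And>i. T i u = \<zero> \<or> T i v = \<zero>"
  shows "ip u v = 0"
proof -
  note [simp] = projectorD(1) [OF T u] projectorD(1) [OF T v]
  have "ip u v = (\<Sum>i\<in>UNIV. ip u (T i v))"
    using ip_sum_right [of UNIV "\<lambda>i. T i v" u] u by (simp add: sum)
  also have "ip u (T i v) = ip (T i u) (T i v)" for i
    using projectorD(5) [OF T u projectorD(1) [OF T v], of i i] projectorD(4) [OF T v] by simp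
  then have "(\<Sum>i\<in>UNIV. ip u (T i v)) = 0"
    using disj by (intro sum.neutral) (metis ip_zero_left ip_zero_right projectorD(1) [OF T u] projectorD(1) [OF T v])
  finally show ?thesis .
qed

lemma projector_proj:
  assumes M: "closed_subspace M"
  shows "projector (proj M)"
  unfolding projector_def
proof (intro conjI ballI allI)
  note MD = closed_subspaceD [OF M] and pin = proj_in [OF M] and dio = diff_proj_in_orth [OF M]
  have O: "closed_subspace (orth M)" using MD(1) by (intro closed_subspace_orth) blast
  note OD = closed_subspaceD [OF O]
  fix u assume u: "u \<in> carrier H"
  show pc: "proj M u \<in> carrier H" using pin [OF u] by (rule MD(1))
  show "proj M (proj M u) = proj M u"
    by (rule proj_eqI [OF M pc pin [OF u]]) (use pc OD(2) in simp)
  show "proj M (c \<odot> u) = c \<odot> proj M u" for c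
    by (rule proj_eqI [OF M]) (use u pc pin dio MD(4) OD(4) in \<open>simp_all flip: scale_diff_right\<close>)
  fix v assume v: "v \<in> carrier H"
  have qc: "proj M v \<in> carrier H" using pin [OF v] by (rule MD(1))
  have "(u \<oplus> v) \<ominus> (proj M u \<oplus> proj M v) = (u \<ominus> proj M u) \<oplus> (v \<ominus> proj M v)"
    by (rule ip_eqI) (use u v pc qc in \<open>simp_all add: ip_simps\<close>)
  then have "(u \<oplus> v) \<ominus> (proj M u \<oplus> proj M v) \<in> orth M" using OD(3) [OF dio [OF u] dio [OF v]] by simp
  then show "proj M (u \<oplus> v) = proj M u \<oplus> proj M v"
    using u v pin MD(3) by (intro proj_eqI [OF M]) auto
  have "ip (proj M u) (v \<ominus> proj M v) = 0" "ip (proj M v) (u \<ominus> proj M u) = 0"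
    using dio [OF u] dio [OF v] pin [OF u] pin [OF v] by (auto simp: orth_def)
  then have "ip (proj M u) v = ip (proj M u) (proj M v)" "ip (u \<ominus> proj M u) (proj M v) = 0"
    using u v pc qc orth_commute [of "proj M v" "u \<ominus> proj M u"] by (simp_all add: ip_diff_right)
  then show "ip (proj M u) v = ip u (proj M v)" using u v pc qc by (simp add: ip_diff_left)
qed

lemma proj_commute:
  assumes M: "closed_subspace M" and T: "projector T" and inv: "\<And>u. u \<in> M \<Longrightarrow> T u \<in> M" and u: "u \<in> carrier H"
  shows "proj M (T u) = T (proj M u)"
proof (rule proj_eqI [OF M])
  note MD = closed_subspaceD [OF M]
  have Mc: "M \<subseteq> carrier H" using MD(1) by blast
  have pc: "proj M u \<in> M" by (rule proj_in [OF M u])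
  show "T u \<in> carrier H" by (rule projectorD(1) [OF T u])
  show "T (proj M u) \<in> M" by (rule inv [OF pc])
  have "T ` M \<subseteq> orth (orth M)" using inv double_orth_incl [OF Mc] by blast
  then have "T (u \<ominus> proj M u) \<in> orth M"
    by (rule projector_orth [OF T Mc _ diff_proj_in_orth [OF M u]])
  then show "T u \<ominus> T (proj M u) \<in> orth M"
    using u MD(1) [OF pc] by (simp add: projector_diff [OF T])
qed

end

locale perfect_strategy = complete_inner_space H + commuting_pvms H P Q \<xi>
  for H :: "('h, 'm) inner_product_space_scheme" (structure)
    and P :: "'x::finite \<Rightarrow> 'a::finite \<Rightarrow> 'h \<Rightarrow> 'h" and Q :: "'y::finite \<Rightarrow> 'b::finite \<Rightarrow> 'h \<Rightarrow> 'h"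
    and \<xi> :: 'h +
  fixes lam :: "('x, 'y, 'a, 'b) rule"
  assumes imitation: "imitation_game lam"
    and losing: "lam x y a b = 0 \<Longrightarrow> P x a (Q y b \<xi>) = \<zero>"
begin

lemma separate_a:
  assumes "a \<noteq> a'"
  shows "\<exists>y. \<forall>b. lam x y a b = 0 \<or> lam x y a' b = 0"
  using imitation assms unfolding imitation_game_def by fastforce

lemma separate_b:
  assumes "b \<noteq> b'"
  shows "\<exists>x. \<forall>a. lam x y a b = 0 \<or> lam x y a b' = 0"
  using imitation assms unfolding imitation_game_def by fastforce

definition bob :: "'y \<times> 'b \<Rightarrow> 'h \<Rightarrow> 'h" where
  "bob = (\<lambda>(y, b). Q y b)"

lemma projector_bob: "projector (bob i)"
  by (cases i) (simp add: bob_def Q)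

lemma losing': "lam x y a b = 0 \<Longrightarrow> Q y b (P x a \<xi>) = \<zero>"
  using losing commute [OF xi(1)] by simp

text \<open>Let \<open>u\<close> be the component of \<open>P x a \<xi>\<close> that is orthogonal to the cyclic subspace of Bob's operators.
  Bob's outcomes that lose against \<open>a\<close> annihilate \<open>u\<close>, so that by the imitation property \<open>u\<close> is orthogonal
  to \<open>P x a' \<xi>\<close> for every \<open>a' \<noteq> a\<close>. Being orthogonal to their sum \<open>\<xi>\<close> too, it is orthogonal to
  \<open>P x a \<xi>\<close>, hence to itself.\<close>
lemma alice_xi_in_cyclic: "P x a \<xi> \<in> cyclic_subspace bob \<xi>"
proof -
  let ?K = "cyclic_subspace bob \<xi>"
  note K = closed_subspace_cyclic [of bob \<xi>, OF projector_bob xi(1)]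
  note KD = closed_subspaceD [OF K]
  have Kc: "?K \<subseteq> carrier H" using KD(1) by blast
  define k where "k = proj ?K (P x a \<xi>)"
  define u where "u = P x a \<xi> \<ominus> k"
  have k: "k \<in> ?K" unfolding k_def by (intro proj_in K) (simp add: xi)
  have u: "u \<in> orth ?K" unfolding u_def k_def by (intro diff_proj_in_orth K) (simp add: xi)
  have [simp]: "k \<in> carrier H" "u \<in> carrier H" using KD(1) [OF k] u by (auto simp: orth_def)
  have QK: "Q y b v \<in> ?K" if "v \<in> ?K" for y b v
    using cyclic_invariant [of bob \<xi>, OF projector_bob xi(1) that, of "(y, b)"] by (simp add: bob_def)
  have kill: "Q y b u = \<zero>" if "lam x y a b = 0" for y b
  proof -
    have "Q y b u = Q y b (P x a \<xi>) \<ominus> Q y b k"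
      unfolding u_def by (rule projector_diff [OF Q]) (simp_all add: xi)
    also have "\<dots> = \<zero> \<ominus> Q y b k" using that by (simp add: losing')
    finally have "Q y b u \<in> ?K" using KD(5) [OF KD(2) QK [OF k]] by simp
    moreover have "Q y b u \<in> orth ?K"
      by (rule projector_orth [OF Q Kc _ u]) (use QK double_orth_incl [OF Kc] in blast)
    ultimately show ?thesis by (rule double_orth_trivial)
  qed
  have other: "ip u (P x a' \<xi>) = 0" if a': "a' \<noteq> a" for a'
  proof -
    obtain y where "\<And>b. lam x y a b = 0 \<or> lam x y a' b = 0" using separate_a [of a a' x] a' by auto
    then have "Q y b u = \<zero> \<or> Q y b (P x a' \<xi>) = \<zero>" for b using kill losing' by blast
    then show ?thesis by (intro pvm_orthogonal [of "Q y"] Q Q_sum) (simp_all add: xi)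
  qed
  have "ip u \<xi> = (\<Sum>a'\<in>UNIV. ip u (P x a' \<xi>))"
    using ip_sum_right [of UNIV "\<lambda>a'. P x a' \<xi>" u] by (simp add: xi P_sum)
  also have "\<dots> = ip u (P x a \<xi>)"
    using other by (subst sum.remove [of _ a]) (auto intro: sum.neutral)
  finally have "ip u (P x a \<xi>) = ip u \<xi>" by simp
  also have "\<dots> = 0"
    using u word_in_cyclic [of bob \<xi>, OF projector_bob xi(1), of "[]"] orth_commute [of u \<xi>] xi(1) by (auto simp: orth_def)
  finally have "ip u (P x a \<xi>) = 0" .
  moreover have "ip u k = 0" using u k orth_commute [of u k] by (auto simp: orth_def)
  ultimately have "ip u u = 0" unfolding u_def [symmetric]
    using ip_diff_right [of u "P x a \<xi>" k] by (simp add: xi flip: u_def)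
  then have "u = \<zero>" using definite by simp
  then have "P x a \<xi> = k" using diff_eq_zeroD [of "P x a \<xi>" k] by (simp add: u_def xi)
  then show ?thesis using k by simp
qed

lemma alice_invariant:
  assumes "u \<in> cyclic_subspace bob \<xi>"
  shows "P x a u \<in> cyclic_subspace bob \<xi>"
proof -
  note wc = word_closed [of bob \<xi>, OF projector_bob xi(1)]
  have "P x a (foldr bob ws \<xi>) \<in> cyclic_subspace bob \<xi>" for ws
  proof (induction ws)
    case Nil
    show ?case using alice_xi_in_cyclic by simp
  next
    case (Cons i ws)
    have "P x a (bob i (foldr bob ws \<xi>)) = bob i (P x a (foldr bob ws \<xi>))"
      using commute [OF wc] by (cases i) (simp add: bob_def)
    then show ?case using cyclic_invariant [of bob \<xi>, OF projector_bob xi(1) Cons.IH] by simp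
  qed
  then have "P x a ` word_vectors bob \<xi> \<subseteq> orth (orth (word_vectors bob \<xi>))"
    by (auto simp: word_vectors_def cyclic_subspace_def)
  then show ?thesis using assms unfolding cyclic_subspace_def
    by (intro projector_double_orth [OF P word_vectors_subset [of bob \<xi>, OF projector_bob xi(1)]])
qed

lemma perfect_strategy_cyclic: "perfect_strategy (H\<lparr>carrier := cyclic_subspace bob \<xi>\<rparr>) P Q \<xi> lam"
proof -
  note K = closed_subspace_cyclic [of bob \<xi>, OF projector_bob xi(1)]
  have "Q y b u \<in> cyclic_subspace bob \<xi>" if "u \<in> cyclic_subspace bob \<xi>" for y b u
    using cyclic_invariant [of bob \<xi>, OF projector_bob xi(1) that, of "(y, b)"] by (simp add: bob_def)
  then have "commuting_pvms (H\<lparr>carrier := cyclic_subspace bob \<xi>\<rparr>) P Q \<xi>"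
    using word_in_cyclic [of bob \<xi>, OF projector_bob xi(1), of "[]"] alice_invariant
    by (intro commuting_pvms_subspace [OF commuting_pvms_axioms K]) auto
  then show ?thesis
    by (intro perfect_strategy.intro complete_inner_space_subspace [OF K] perfect_strategy_axioms.intro imitation)
      (simp_all add: losing)
qed

text \<open>Bob's operator \<open>Q y b\<close> is mirrored by the projection onto the vectors that are annihilated by all
  answers of Alice that lose against \<open>b\<close>.\<close>
definition winning_space :: "'y \<Rightarrow> 'b \<Rightarrow> 'h set" where
  "winning_space y b = orth {P x a u |x a u. u \<in> carrier H \<and> lam x y a b = 0}"

definition mirror_image :: "'y \<times> 'b \<Rightarrow> 'h \<Rightarrow> 'h" where
  "mirror_image = (\<lambda>(y, b). proj (winning_space y b))"

lemma closed_subspace_winning: "closed_subspace (winning_space y b)"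
  unfolding winning_space_def by (rule closed_subspace_orth) auto

lemma winning_space_iff:
  "u \<in> winning_space y b \<longleftrightarrow> u \<in> carrier H \<and> (\<forall>x a. lam x y a b = 0 \<longrightarrow> P x a u = \<zero>)"
proof -
  have "P x a u = \<zero>" if "u \<in> carrier H" "\<forall>w\<in>carrier H. ip (P x a w) u = 0" for x a
    using that by (intro ip_eqI) (simp_all add: projectorD(5) [OF P])
  moreover have "ip (P x a w) u = 0" if "u \<in> carrier H" "w \<in> carrier H" "P x a u = \<zero>" for x a w
    using that by (simp add: projectorD(5) [OF P])
  ultimately show ?thesis unfolding winning_space_def orth_def by blast
qed

text \<open>The vector \<open>Q y b \<xi>\<close> lies in the winning space of \<open>b\<close>. For \<open>b' \<noteq> b\<close> there is, by the imitation property, a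
  question to Alice none of whose answers wins against both \<open>b\<close> and \<open>b'\<close>; expanding along her answers shows
  that \<open>Q y b' \<xi>\<close> is orthogonal to that space. As \<open>\<xi>\<close> is the sum of all these vectors, its projection is
  \<open>Q y b \<xi>\<close>.\<close>
lemma mirror_xi: "proj (winning_space y b) \<xi> = Q y b \<xi>"
proof (rule proj_eqI [OF closed_subspace_winning])
  show "\<xi> \<in> carrier H" by (rule xi)
  show "Q y b \<xi> \<in> winning_space y b" by (simp add: winning_space_iff losing xi)
  have "ip w (\<xi> \<ominus> Q y b \<xi>) = 0" if w: "w \<in> winning_space y b" for w
  proof -
    have wc: "w \<in> carrier H" using w by (simp add: winning_space_iff)
    have other: "ip w (Q y b' \<xi>) = 0" if "b' \<noteq> b" for b'
    proof -
      obtain x where "\<And>a. lam x y a b = 0 \<or> lam x y a b' = 0" using separate_b [of b b' y] \<open>b' \<noteq> b\<close> by auto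
      then have "P x a w = \<zero> \<or> P x a (Q y b' \<xi>) = \<zero>" for a using w losing winning_space_iff by blast
      then show ?thesis using wc by (intro pvm_orthogonal [of "P x"] P P_sum) (simp_all add: xi)
    qed
    have "ip w \<xi> = (\<Sum>b'\<in>UNIV. ip w (Q y b' \<xi>))"
      using ip_sum_right [of UNIV "\<lambda>b'. Q y b' \<xi>" w] wc by (simp add: xi Q_sum)
    also have "\<dots> = ip w (Q y b \<xi>)"
      using other by (subst sum.remove [of _ b]) (auto intro: sum.neutral)
    finally show ?thesis using wc by (simp add: xi ip_diff_right)
  qed
  then show "\<xi> \<ominus> Q y b \<xi> \<in> orth (winning_space y b)" by (simp add: orth_def xi)
qed

lemma mirrored_family_bob:
  assumes total: "\<And>u. u \<in> carrier H \<Longrightarrow> (\<And>ws. ip (foldr bob ws \<xi>) u = 0) \<Longrightarrow> u = \<zero>"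
  shows "mirrored_family H bob mirror_image \<xi>"
proof (unfold_locales)
  fix i j :: "'y \<times> 'b" and u
  obtain y b z c where ij: "i = (y, b)" "j = (z, c)" by (cases i, cases j)
  show "projector (bob i)" by (rule projector_bob)
  show "projector (mirror_image i)" by (simp add: ij mirror_image_def projector_proj closed_subspace_winning)
  show "mirror_image i \<xi> = bob i \<xi>" by (simp add: ij mirror_image_def bob_def mirror_xi)
  assume u: "u \<in> carrier H"
  have "Q z c v \<in> winning_space y b" if "v \<in> winning_space y b" for v
    using that by (simp add: winning_space_iff commute projector_zero [OF Q])
  then show "mirror_image i (bob j u) = bob j (mirror_image i u)"
    using u by (simp add: ij mirror_image_def bob_def proj_commute [OF closed_subspace_winning Q])
qed (use xi total in auto)

text \<open>Alice's operators and the mirror images of Bob's satisfy the relations of the game: an identity in the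
  commutant may be tested at the separating vector \<open>\<xi>\<close>, where mirror images turn into Bob's own operators.
  The universal property gives a homomorphism into the commutant, along which the tracial vector state is
  pulled back.\<close>
theorem tracial_state_of_cyclic_strategy:
  fixes \<AA> :: "'c cstar_structure"
  assumes total: "\<And>u. u \<in> carrier H \<Longrightarrow> (\<And>ws. ip (foldr bob ws \<xi>) u = 0) \<Longrightarrow> u = \<zero>"
    and card: "(UNIV :: real set) \<lesssim> (UNIV :: 'c set)"
    and game: "is_game_cstar_algebra lam \<AA> e f"
  shows "\<exists>\<tau>. tracial_state \<AA> \<tau> \<and> (\<forall>x y a b. \<tau> (e x a \<otimes>\<^bsub>\<AA>\<^esub> f y b) = ip \<xi> (P x a (Q y b \<xi>)))"
proof -
  interpret M: mirrored_family H bob mirror_image \<xi> by (rule mirrored_family_bob [OF total])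
  obtain J :: "('h \<Rightarrow> 'h) \<Rightarrow> 'c" where "inj_on J M.commutant"
    using lepoll_if_complex_functions [OF card M.coefficients_inj] by blast
  then interpret C: coded_commutant H bob J by unfold_locales
  have Pbob: "P x a (bob i u) = bob i (P x a u)" if "u \<in> carrier H" for x a i u
    using commute [OF that] by (cases i) (simp add: bob_def)
  define E where "E x a = C.restrict_op (P x a)" for x a
  define F where "F y b = C.restrict_op (mirror_image (y, b))" for y b
  have E: "E x a \<in> M.commutant" and F: "F y b \<in> M.commutant" for x a y b
    unfolding E_def F_def by (intro C.restrict_op_commutant P M.S Pbob M.SR; assumption)+
  have at_xi: "E x a \<xi> = P x a \<xi>" "F y b \<xi> = Q y b \<xi>" for x a y b
    using xi M.mirror [of "(y, b)"] by (simp_all add: E_def F_def C.restrict_op_def bob_def)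
  have rel: "game_relations lam C.alg (\<lambda>x a. J (E x a)) (\<lambda>y b. J (F y b))"
    unfolding game_relations_def
  proof (intro conjI allI impI)
    show "cstar_projection C.alg (J (E x a))" for x a
      unfolding E_def by (rule C.cstar_projection_J [OF P Pbob])
    show "cstar_projection C.alg (J (F y b))" for y b
      unfolding F_def by (rule C.cstar_projection_J [OF M.S M.SR])
    show "(\<Oplus>\<^bsub>C.alg\<^esub>a\<in>UNIV. J (E x a)) = \<one>\<^bsub>C.alg\<^esub>" for x
    proof -
      have "(\<lambda>u. \<Oplus>a\<in>UNIV. E x a u) = M.op_one"
        using C.finsum_alg [of UNIV "E x"] E
        by (intro M.separating M.op_one) (simp_all add: at_xi P_sum xi M.op_one_def)
      then show ?thesis using C.finsum_alg [of UNIV "E x"] E by simp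
    qed
    show "(\<Oplus>\<^bsub>C.alg\<^esub>b\<in>UNIV. J (F y b)) = \<one>\<^bsub>C.alg\<^esub>" for y
    proof -
      have "(\<lambda>u. \<Oplus>b\<in>UNIV. F y b u) = M.op_one"
        using C.finsum_alg [of UNIV "F y"] F
        by (intro M.separating M.op_one) (simp_all add: at_xi Q_sum xi M.op_one_def)
      then show ?thesis using C.finsum_alg [of UNIV "F y"] F by simp
    qed
    fix x y a b assume "lam x y a b = 0"
    then have "M.op_mult (E x a) (F y b) = M.op_zero"
      using losing by (intro M.separating M.op_mult M.op_zero E F)
        (simp add: M.op_mult_def M.op_zero_def at_xi, simp add: E_def C.restrict_op_def xi)
    then show "J (E x a) \<otimes>\<^bsub>C.alg\<^esub> J (F y b) = \<zero>\<^bsub>C.alg\<^esub>" using E F by simp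
  qed
  interpret A: unital_cstar_algebra \<AA> using game by (simp add: is_game_cstar_algebra_def)
  obtain \<phi> where \<phi>: "\<phi> \<in> unital_star_hom \<AA> C.alg"
    and \<phi>e: "\<And>x a. \<phi> (e x a) = J (E x a)" and \<phi>f: "\<And>y b. \<phi> (f y b) = J (F y b)"
    using game C.unital_cstar_algebra_alg rel unfolding is_game_cstar_algebra_def by metis
  have ef: "e x a \<in> carrier \<AA>" "f y b \<in> carrier \<AA>" for x a y b
    using game by (auto simp: is_game_cstar_algebra_def game_relations_def cstar_projection_def)
  have hom: "\<phi> (v \<otimes>\<^bsub>\<AA>\<^esub> w) = \<phi> v \<otimes>\<^bsub>C.alg\<^esub> \<phi> w" "\<phi> (v \<oplus>\<^bsub>\<AA>\<^esub> w) = \<phi> v \<oplus>\<^bsub>C.alg\<^esub> \<phi> w"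
      "\<phi> (c \<odot>\<^bsub>\<AA>\<^esub> v) = c \<odot>\<^bsub>C.alg\<^esub> \<phi> v" "\<phi> (star \<AA> v) = star C.alg (\<phi> v)" "\<phi> \<one>\<^bsub>\<AA>\<^esub> = \<one>\<^bsub>C.alg\<^esub>"
    if "v \<in> carrier \<AA>" "w \<in> carrier \<AA>" for v w c
    using \<phi> that by (auto simp: unital_star_hom_def ring_hom_def)
  define \<tau> where "\<tau> v = ip \<xi> (C.decode (\<phi> v) \<xi>)" for v
  have cl [simp]: "C.decode z u \<in> carrier H" for z u by (rule M.commutant_closed) simp
  note [simp] = xi(1)
  have "tracial_state \<AA> \<tau>"
    unfolding tracial_state_def
  proof (intro conjI ballI allI)
    fix v w assume v: "v \<in> carrier \<AA>" and w: "w \<in> carrier \<AA>"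
    show "\<tau> (v \<oplus>\<^bsub>\<AA>\<^esub> w) = \<tau> v + \<tau> w"
      using v w by (simp add: \<tau>_def hom) (simp add: M.op_add_def ip_simps)
    show "\<tau> (v \<otimes>\<^bsub>\<AA>\<^esub> w) = \<tau> (w \<otimes>\<^bsub>\<AA>\<^esub> v)"
      using v w M.vector_state_tracial [of "C.decode (\<phi> v)" "C.decode (\<phi> w)"]
      by (simp add: \<tau>_def hom) (simp add: M.op_mult_def)
  next
    fix v c assume v: "v \<in> carrier \<AA>"
    show "\<tau> (c \<odot>\<^bsub>\<AA>\<^esub> v) = c * \<tau> v"
      using v by (simp add: \<tau>_def hom) (simp add: M.op_scale_def ip_simps)
    let ?T = "C.decode (\<phi> v)"
    have "\<tau> (star \<AA> v \<otimes>\<^bsub>\<AA>\<^esub> v) = ip \<xi> (M.adj ?T (?T \<xi>))"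
      using v A.star_closed by (simp add: \<tau>_def hom) (simp add: M.op_mult_def)
    also have "\<dots> = complex_of_real ((nm (?T \<xi>))\<^sup>2)"
      using M.commutant_linear(3) [of ?T \<xi> "?T \<xi>"] by (simp add: ip_self)
    finally show "\<tau> (star \<AA> v \<otimes>\<^bsub>\<AA>\<^esub> v) \<in> \<real>\<^sub>\<ge>\<^sub>0" by (simp add: nonneg_Reals_of_real_iff del: of_real_power)
  next
    show "\<tau> \<one>\<^bsub>\<AA>\<^esub> = 1"
      using hom(5) [OF A.zero_closed A.zero_closed] by (simp add: \<tau>_def) (simp add: M.op_one_def xi)
  qed
  moreover have "\<tau> (e x a \<otimes>\<^bsub>\<AA>\<^esub> f y b) = ip \<xi> (P x a (Q y b \<xi>))" for x y a b
    using E F ef by (simp add: \<tau>_def hom \<phi>e \<phi>f) (simp add: M.op_mult_def at_xi, simp add: E_def C.restrict_op_def)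
  ultimately show ?thesis by blast
qed

end

text \<open>The given Hilbert space is completed afresh. Its own completeness is a statement about \<open>Metric_space\<close>,
  whose definitions unfold only for a distance that is symmetric and non-negative on the whole type, and
  nothing is known about the operations outside the carrier.\<close>
theorem tracial_state_of_qc_correlation:
  fixes \<AA> :: "'c cstar_structure"
  assumes p: "p \<in> qc_game_correlations TYPE('h) lam"
    and imitation: "imitation_game lam"
    and card: "(UNIV :: real set) \<lesssim> (UNIV :: 'c set)"
    and game: "is_game_cstar_algebra lam \<AA> e f"
  shows "\<exists>\<tau>. tracial_state \<AA> \<tau> \<and> (\<forall>x y a b. complex_of_real (p a b x y) = \<tau> (e x a \<otimes>\<^bsub>\<AA>\<^esub> f y b))"
proof -
  have qc: "p \<in> qc_correlations TYPE('h)" and zero: "\<And>x y a b. lam x y a b = 0 \<Longrightarrow> p a b x y = 0"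
    using p by (auto simp: qc_game_correlations_def)
  obtain H :: "'h inner_product_space" and \<xi> P Q where
    "hilbert_space H \<and> \<xi> \<in> carrier H \<and> hnorm H \<xi> = 1 \<and> (\<forall>x. PVM H (P x)) \<and> (\<forall>y. PVM H (Q y)) \<and>
     (\<forall>x y a b. \<forall>u\<in>carrier H. P x a (Q y b u) = Q y b (P x a u)) \<and>
     (\<forall>x y a b. complex_of_real (p a b x y) = inner_prod H \<xi> (P x a (Q y b \<xi>)))"
    using qc unfolding qc_correlations_def mem_Collect_eq by blast
  then have H: "hilbert_space H" and xi: "\<xi> \<in> carrier H" "hnorm H \<xi> = 1"
    and PVM: "\<And>x. PVM H (P x)" "\<And>y. PVM H (Q y)"
    and comm: "\<And>x y a b u. u \<in> carrier H \<Longrightarrow> P x a (Q y b u) = Q y b (P x a u)"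
    and corr: "\<And>x y a b. complex_of_real (p a b x y) = inner_prod H \<xi> (P x a (Q y b \<xi>))"
    by blast+
  interpret hilbert_space H by fact
  interpret V: commuting_pvms H P Q \<xi>
  proof
    show "projector (P x a)" "projector (Q y b)" for x a y b
      using PVM projection_operator_projector unfolding PVM_def by blast+
    show "(\<Oplus>\<^bsub>H\<^esub>a\<in>UNIV. P x a u) = u" "(\<Oplus>\<^bsub>H\<^esub>b\<in>UNIV. Q y b u) = u" if "u \<in> carrier H" for x y u
      using PVM that unfolding PVM_def by blast+
  qed (use xi comm ip_self in auto)
  let ?P = "\<lambda>x a. extend (P x a)" and ?Q = "\<lambda>y b. extend (Q y b)" and ?xi = "embed \<xi>"
  interpret C: complete_inner_space completion by (rule complete_inner_space_completion)
  interpret W: commuting_pvms completion ?P ?Q ?xi by (rule V.commuting_pvms_completion)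
  have "?P x a (?Q y b ?xi) = \<zero>\<^bsub>completion\<^esub>" if lam: "lam x y a b = 0" for x y a b
  proof -
    let ?u = "?P x a (?Q y b ?xi)"
    note [simp] = W.xi(1) W.PQ_closed
    have "C.ip ?u ?u = C.ip (?Q y b ?xi) ?u"
      by (simp add: C.projectorD(5) [OF W.P] C.projectorD(4) [OF W.P])
    also have "\<dots> = C.ip ?xi (?Q y b ?u)" by (simp add: C.projectorD(5) [OF W.Q])
    also have "?Q y b ?u = ?u" by (simp add: C.projectorD(4) [OF W.Q] flip: W.commute)
    also have "C.ip ?xi ?u = 0"
      using corr [of a b x y] zero [OF lam] by (simp add: V.correlation_completion)
    finally show ?thesis by (intro C.definite) simp_all
  qed
  then interpret S: perfect_strategy completion ?P ?Q ?xi lam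
    by unfold_locales (auto intro: imitation)
  let ?K = "C.cyclic_subspace S.bob ?xi"
  interpret K: perfect_strategy "completion\<lparr>carrier := ?K\<rparr>" ?P ?Q ?xi lam
    by (rule S.perfect_strategy_cyclic)
  have "\<exists>\<tau>. tracial_state \<AA> \<tau> \<and> (\<forall>x y a b. \<tau> (e x a \<otimes>\<^bsub>\<AA>\<^esub> f y b) =
      inner_prod (completion\<lparr>carrier := ?K\<rparr>) ?xi (?P x a (?Q y b ?xi)))"
    by (rule K.tracial_state_of_cyclic_strategy [OF _ card game])
      (use C.cyclic_total [of S.bob ?xi, OF S.projector_bob W.xi(1)] in simp)
  then show ?thesis by (simp add: V.correlation_completion corr) metis
qed

section \<open>The Hilbert space of a tracial state\<close>

text \<open>A C*-algebra is a ring and a module over the ring of complex numbers at the same time, and there the plain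
  names of the ring laws denote those of the scalars. The laws of the algebra are restated.\<close>
lemma ring_laws:
  fixes A (structure)
  assumes "ring A"
  shows "\<lbrakk>u \<in> carrier A; v \<in> carrier A; w \<in> carrier A\<rbrakk> \<Longrightarrow> (u \<otimes> v) \<otimes> w = u \<otimes> (v \<otimes> w)"
    "\<lbrakk>u \<in> carrier A; v \<in> carrier A; w \<in> carrier A\<rbrakk> \<Longrightarrow> (u \<oplus> v) \<otimes> w = u \<otimes> w \<oplus> v \<otimes> w"
    "\<lbrakk>u \<in> carrier A; v \<in> carrier A; w \<in> carrier A\<rbrakk> \<Longrightarrow> w \<otimes> (u \<oplus> v) = w \<otimes> u \<oplus> w \<otimes> v"
    "u \<in> carrier A \<Longrightarrow> u \<otimes> \<one> = u" "u \<in> carrier A \<Longrightarrow> \<one> \<otimes> u = u" "\<one> \<in> carrier A" "\<zero> \<in> carrier A"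
    "\<zero> \<oplus> \<zero> = \<zero>" "u \<in> carrier A \<Longrightarrow> v \<in> carrier A \<Longrightarrow> u \<otimes> v \<in> carrier A"
    "u \<in> carrier A \<Longrightarrow> v \<in> carrier A \<Longrightarrow> u \<oplus> v \<in> carrier A"
  by (simp_all add: ring.ring_simprules [OF assms] monoid.r_one [OF ring.is_monoid [OF assms]])

lemma ring_finsum_distr:
  fixes A (structure)
  assumes "ring A" "finite I" "u \<in> carrier A" "g \<in> I \<rightarrow> carrier A"
  shows "(\<Oplus>i\<in>I. g i \<otimes> u) = (\<Oplus>i\<in>I. g i) \<otimes> u" "(\<Oplus>i\<in>I. u \<otimes> g i) = u \<otimes> (\<Oplus>i\<in>I. g i)"
proof -
  interpret ring A by fact
  show "(\<Oplus>i\<in>I. g i \<otimes> u) = (\<Oplus>i\<in>I. g i) \<otimes> u" "(\<Oplus>i\<in>I. u \<otimes> g i) = u \<otimes> (\<Oplus>i\<in>I. g i)"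
    using assms(2-) by (simp_all add: finsum_ldistr finsum_rdistr)
qed

lemma ring_abelian_group_same_add:
  fixes A (structure) and V :: "('c, 'n) ring_scheme"
  assumes "ring A" and "carrier V = carrier A" "\<zero>\<^bsub>V\<^esub> = \<zero>" "\<And>u v. u \<oplus>\<^bsub>V\<^esub> v = u \<oplus> v"
  shows "abelian_group V"
proof -
  interpret ring A by fact
  show ?thesis
  proof (rule abelian_groupI)
    fix v assume "v \<in> carrier V"
    then show "\<exists>w\<in>carrier V. w \<oplus>\<^bsub>V\<^esub> v = \<zero>\<^bsub>V\<^esub>"
      using assms by (intro bexI [of _ "\<ominus> v"]) (auto simp: l_neg)
  qed (use assms in \<open>auto simp: a_ac\<close>)
qed

locale tracial_cstar_algebra = unital_cstar_algebra \<AA>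
  for \<AA> :: "('c, 'm) cstar_structure_scheme" (structure) +
  fixes \<tau> :: "'c \<Rightarrow> complex"
  assumes tracial: "tracial_state \<AA> \<tau>"
begin

lemma ring: "ring \<AA>"
  using unital_cstar_algebra_axioms by (simp add: unital_cstar_algebra_def)

lemmas laws [simp] = ring_laws [OF ring]

lemma trace_add: "v \<in> carrier \<AA> \<Longrightarrow> w \<in> carrier \<AA> \<Longrightarrow> \<tau> (v \<oplus> w) = \<tau> v + \<tau> w"
  and trace_scale: "v \<in> carrier \<AA> \<Longrightarrow> \<tau> (c \<odot> v) = c * \<tau> v"
  using tracial by (auto simp: tracial_state_def)

lemma trace_commute: "v \<in> carrier \<AA> \<Longrightarrow> w \<in> carrier \<AA> \<Longrightarrow> \<tau> (v \<otimes> w) = \<tau> (w \<otimes> v)"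
  using tracial by (auto simp: tracial_state_def)

lemma trace_one: "\<tau> \<one> = 1"
  using tracial by (auto simp: tracial_state_def)

lemma star_one: "star \<AA> \<one> = \<one>"
proof -
  have c: "star \<AA> \<one> \<in> carrier \<AA>" by (rule star_closed) simp
  have "star \<AA> (star \<AA> \<one> \<otimes> \<one>) = star \<AA> \<one> \<otimes> star \<AA> (star \<AA> \<one>)" using c by (intro star_mult) auto
  then show ?thesis using c by (simp add: star_star)
qed

text \<open>The space of the Gelfand-Naimark-Segal construction, before null vectors are divided out and before
  completion.\<close>
definition gns :: "'c inner_product_space" where
  "gns = \<lparr>carrier = carrier \<AA>, mult = undefined, one = undefined, zero = \<zero>, add = add \<AA>,
     smult = smult \<AA>, inner_prod = (\<lambda>v w. \<tau> (star \<AA> v \<otimes> w))\<rparr>"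

lemma gns_simps [simp]:
  "carrier gns = carrier \<AA>" "\<zero>\<^bsub>gns\<^esub> = \<zero>" "v \<oplus>\<^bsub>gns\<^esub> w = v \<oplus> w" "c \<odot>\<^bsub>gns\<^esub> v = c \<odot> v"
  "inner_prod gns v w = \<tau> (star \<AA> v \<otimes> w)"
  by (simp_all add: gns_def)

lemma complex_vector_space_gns: "complex_vector_space gns"
  unfolding complex_vector_space_def
proof (rule moduleI [OF cring_complex_ring])
  show "abelian_group gns"
    by (rule ring_abelian_group_same_add [OF ring]) simp_all
  show "c \<odot>\<^bsub>gns\<^esub> v \<in> carrier gns" if "v \<in> carrier gns" for c v
    using that smult_closed by simp
qed (use smult_l_distr smult_r_distr smult_assoc1 smult_one in auto)

text \<open>A sesquilinear form whose diagonal is real is Hermitian, by polarization.\<close>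
lemma semi_inner_space_gns: "semi_inner_space gns"
proof -
  interpret V: complex_vector_space gns by (rule complex_vector_space_gns)
  note [simp] = star_closed smult_closed
  let ?s = "\<lambda>v w. \<tau> (star \<AA> v \<otimes> w)"
  have sc [simp]: "c \<odot> v \<in> carrier \<AA>" if "v \<in> carrier \<AA>" for c v using that smult_closed by simp
  note form_simps = trace_add trace_scale star_add star_smult smult_mult_left smult_mult_right
  have real: "Im (?s v v) = 0" "0 \<le> Re (?s v v)" if "v \<in> carrier \<AA>" for v
    using tracial that by (auto simp: tracial_state_def complex_nonneg_Reals_iff)
  have herm: "?s w v = cnj (?s v w)" if vw: "v \<in> carrier \<AA>" "w \<in> carrier \<AA>" for v w
  proof -
    have "Im (?s (v \<oplus> w) (v \<oplus> w)) = 0" "Im (?s (v \<oplus> \<i> \<odot> w) (v \<oplus> \<i> \<odot> w)) = 0"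
      using vw by (intro real; simp)+
    then have "Im (?s v w) + Im (?s w v) = 0" "Re (?s v w) - Re (?s w v) = 0"
      using vw real(1) [OF vw(1)] real(1) [OF vw(2)] by (simp_all add: form_simps)
    then show ?thesis by (simp add: complex_eq_iff)
  qed
  show ?thesis by unfold_locales (simp_all add: form_simps real, rule herm)
qed

lemma finsum_gns:
  assumes "finite I" "\<And>i. i \<in> I \<Longrightarrow> g i \<in> carrier \<AA>"
  shows "(\<Oplus>\<^bsub>gns\<^esub>i\<in>I. g i) = (\<Oplus>i\<in>I. g i)"
proof -
  interpret V: complex_vector_space gns by (rule complex_vector_space_gns)
  show ?thesis using assms
  proof (induction I rule: finite_induct)
    case (insert i I)
    then have "g \<in> I \<rightarrow> carrier gns" "g \<in> I \<rightarrow> carrier \<AA>" by auto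
    with insert show ?case by (simp add: V.M.finsum_insert finsum_insert)
  qed simp
qed

lemma projector_left:
  assumes e: "cstar_projection \<AA> e"
  shows "semi_inner_space.projector gns (\<lambda>v. e \<otimes> v)"
proof -
  interpret V: semi_inner_space gns by (rule semi_inner_space_gns)
  have [simp]: "e \<in> carrier \<AA>" "e \<otimes> e = e" "star \<AA> e = e" using e by (auto simp: cstar_projection_def)
  show ?thesis unfolding V.projector_def
    by (auto simp: smult_mult_right star_mult star_closed simp flip: laws(1) [of e e])
qed

text \<open>It is the trace property that makes right multiplication by a projection self-adjoint.\<close>
lemma projector_right:
  assumes e: "cstar_projection \<AA> e"
  shows "semi_inner_space.projector gns (\<lambda>v. v \<otimes> e)"
proof -
  interpret V: semi_inner_space gns by (rule semi_inner_space_gns)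
  have [simp]: "e \<in> carrier \<AA>" "e \<otimes> e = e" "star \<AA> e = e" using e by (auto simp: cstar_projection_def)
  have "\<tau> (star \<AA> (u \<otimes> e) \<otimes> v) = \<tau> (star \<AA> u \<otimes> (v \<otimes> e))" if "u \<in> carrier \<AA>" "v \<in> carrier \<AA>" for u v
    using that trace_commute [of e "star \<AA> u \<otimes> v"] by (simp add: star_mult star_closed)
  then show ?thesis unfolding V.projector_def
    by (auto simp: smult_mult_left)
qed

end

text \<open>Alice acts by left multiplication, Bob by right multiplication, and these commute by associativity. The
  state is the class of \<open>\<one>\<close>.\<close>
theorem qc_correlation_of_tracial_state:
  fixes lam :: "('x::finite, 'y::finite, 'a::finite, 'b::finite) rule"
  assumes \<AA>: "unital_cstar_algebra \<AA>" and rel: "game_relations lam \<AA> e f" and \<tau>: "tracial_state \<AA> \<tau>"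
    and card: "(UNIV :: real set) \<lesssim> (UNIV :: 'h set)"
    and corr: "\<And>x y a b. complex_of_real (p a b x y) = \<tau> (e x a \<otimes>\<^bsub>\<AA>\<^esub> f y b)"
  shows "p \<in> qc_game_correlations TYPE('h) lam"
proof -
  interpret A: unital_cstar_algebra \<AA> by fact
  interpret A: tracial_cstar_algebra \<AA> \<tau> by unfold_locales fact
  interpret V: semi_inner_space A.gns by (rule A.semi_inner_space_gns)
  have proj: "cstar_projection \<AA> (e x a)" "cstar_projection \<AA> (f y b)" for x a y b
    using rel by (auto simp: game_relations_def)
  have ef [simp]: "e x a \<in> carrier \<AA>" "f y b \<in> carrier \<AA>" for x a y b
    using proj by (auto simp: cstar_projection_def)
  have sums: "(\<Oplus>\<^bsub>\<AA>\<^esub>a\<in>UNIV. e x a) = \<one>\<^bsub>\<AA>\<^esub>" "(\<Oplus>\<^bsub>\<AA>\<^esub>b\<in>UNIV. f y b) = \<one>\<^bsub>\<AA>\<^esub>" for x y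
    using rel by (auto simp: game_relations_def)
  let ?P = "\<lambda>x a v. e x a \<otimes>\<^bsub>\<AA>\<^esub> v" and ?Q = "\<lambda>y b v. v \<otimes>\<^bsub>\<AA>\<^esub> f y b"
  interpret W: commuting_pvms A.gns ?P ?Q "\<one>\<^bsub>\<AA>\<^esub>"
  proof
    fix u assume "u \<in> carrier A.gns"
    then have u: "u \<in> carrier \<AA>" by simp
    show "(\<Oplus>\<^bsub>A.gns\<^esub>a\<in>UNIV. e x a \<otimes>\<^bsub>\<AA>\<^esub> u) = u" for x
      using u ring_finsum_distr(1) [OF A.ring, of UNIV u "e x"] sums by (simp add: A.finsum_gns Pi_def)
    show "(\<Oplus>\<^bsub>A.gns\<^esub>b\<in>UNIV. u \<otimes>\<^bsub>\<AA>\<^esub> f y b) = u" for y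
      using u ring_finsum_distr(2) [OF A.ring, of UNIV u "f y"] sums by (simp add: A.finsum_gns Pi_def)
    show "e x a \<otimes>\<^bsub>\<AA>\<^esub> (u \<otimes>\<^bsub>\<AA>\<^esub> f y b) = e x a \<otimes>\<^bsub>\<AA>\<^esub> u \<otimes>\<^bsub>\<AA>\<^esub> f y b" for x y a b
      using u by simp
  qed (simp_all add: A.projector_left A.projector_right proj A.star_one A.trace_one)
  let ?P' = "\<lambda>x a. V.extend (?P x a)" and ?Q' = "\<lambda>y b. V.extend (?Q y b)" and ?xi = "V.embed \<one>\<^bsub>\<AA>\<^esub>"
  interpret C: complete_inner_space V.completion by (rule V.complete_inner_space_completion)
  interpret D: commuting_pvms V.completion ?P' ?Q' ?xi by (rule W.commuting_pvms_completion)
  \<comment> \<open>The completion may exceed the type \<open>'h\<close>. The cyclic subspace fits, for its vectors are determined by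
    their inner products with the countably many word vectors.\<close>
  define T where "T = case_sum (\<lambda>(x, a). ?P' x a) (\<lambda>(y, b). ?Q' y b)"
  have T: "C.projector (T i)" for i
    by (cases i) (auto simp: T_def D.P D.Q)
  note cyc = T D.xi(1)
  let ?K = "C.cyclic_subspace T ?xi"
  have K: "C.closed_subspace ?K" by (rule C.closed_subspace_cyclic [of T ?xi, OF cyc])
  have pvms: "commuting_pvms (V.completion\<lparr>carrier := ?K\<rparr>) ?P' ?Q' ?xi"
  proof (rule C.commuting_pvms_subspace [OF D.commuting_pvms_axioms K])
    show "?xi \<in> ?K" using C.word_in_cyclic [of T ?xi, OF cyc, of "[]"] by simp
    show "?P' x a u \<in> ?K" if "u \<in> ?K" for x a u
      using C.cyclic_invariant [of T ?xi, OF cyc that, of "Inl (x, a)"] by (simp add: T_def)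
    show "?Q' y b u \<in> ?K" if "u \<in> ?K" for y b u
      using C.cyclic_invariant [of T ?xi, OF cyc that, of "Inr (y, b)"] by (simp add: T_def)
  qed
  have "inj_on (\<lambda>u ws. C.ip (foldr T ws ?xi) u) ?K"
  proof (rule inj_onI)
    fix u v assume u: "u \<in> ?K" and v: "v \<in> ?K"
      and eq: "(\<lambda>ws. C.ip (foldr T ws ?xi) u) = (\<lambda>ws. C.ip (foldr T ws ?xi) v)"
    note KD = C.closed_subspaceD [OF K]
    have "u \<ominus>\<^bsub>V.completion\<^esub> v = \<zero>\<^bsub>V.completion\<^esub>"
      using fun_cong [OF eq] u v C.word_closed [of T ?xi, OF cyc]
      by (intro C.cyclic_total [of T ?xi, OF cyc] KD(5)) (simp_all add: C.ip_diff_right KD(1))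
    then show "u = v" using KD(1) u v C.diff_eq_zeroD by blast
  qed
  then obtain J :: "('c \<Rightarrow> complex) \<Rightarrow> 'h" where J: "inj_on J ?K"
    using lepoll_if_complex_functions [OF card] by blast
  have "p \<in> qc_correlations TYPE('h)"
  proof (rule qc_correlationsI [OF C.complete_inner_space_subspace [OF K] pvms])
    show "inj_on J (carrier (V.completion\<lparr>carrier := ?K\<rparr>))" using J by simp
    show "complex_of_real (p a b x y) =
        inner_prod (V.completion\<lparr>carrier := ?K\<rparr>) ?xi (?P' x a (?Q' y b ?xi))" for x y a b
      using W.correlation_completion [of x a y b] by (simp add: corr A.star_one)
  qed
  moreover have "p a b x y = 0" if "lam x y a b = 0" for x y a b
  proof -
    have "e x a \<otimes>\<^bsub>\<AA>\<^esub> f y b = \<zero>\<^bsub>\<AA>\<^esub>" using rel that by (simp add: game_relations_def)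
    moreover have "\<tau> \<zero>\<^bsub>\<AA>\<^esub> = 0" using A.trace_add [of "\<zero>\<^bsub>\<AA>\<^esub>" "\<zero>\<^bsub>\<AA>\<^esub>"] by simp
    ultimately show ?thesis using corr [of a b x y] by simp
  qed
  ultimately show ?thesis by (simp add: qc_game_correlations_def)
qed

theorem theorem5p1:
  fixes lam :: "('x::finite, 'y::finite, 'a::finite, 'b::finite) rule"
    and p :: "('x, 'y, 'a, 'b) correlation"
    and \<AA> :: "'c cstar_structure"
    and e :: "'x \<Rightarrow> 'a \<Rightarrow> 'c"
    and f :: "'y \<Rightarrow> 'b \<Rightarrow> 'c"
  assumes "(UNIV :: real set) \<lesssim> (UNIV :: 'c set)"
    and "(UNIV :: real set) \<lesssim> (UNIV :: 'h set)"
    and "imitation_game lam"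
    and "nonsignalling_correlation p"
    and "is_game_cstar_algebra lam \<AA> e f"
  shows "p \<in> qc_game_correlations TYPE('h) lam \<longleftrightarrow>
    carrier \<AA> \<noteq> {\<zero>\<^bsub>\<AA>\<^esub>} \<and>
    (\<exists>\<tau>. tracial_state \<AA> \<tau> \<and>
      (\<forall>x y a b. complex_of_real (p a b x y) = \<tau> (e x a \<otimes>\<^bsub>\<AA>\<^esub> f y b)))"
proof
  assume "p \<in> qc_game_correlations TYPE('h) lam"
  then obtain \<tau> where \<tau>: "tracial_state \<AA> \<tau>"
    "\<forall>x y a b. complex_of_real (p a b x y) = \<tau> (e x a \<otimes>\<^bsub>\<AA>\<^esub> f y b)"
    using tracial_state_of_qc_correlation assms by blast
  interpret A: unital_cstar_algebra \<AA> using assms(5) by (simp add: is_game_cstar_algebra_def)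
  interpret A: tracial_cstar_algebra \<AA> \<tau> by unfold_locales (rule \<tau>)
  have "\<tau> \<zero>\<^bsub>\<AA>\<^esub> = 0" using A.trace_add [of "\<zero>\<^bsub>\<AA>\<^esub>" "\<zero>\<^bsub>\<AA>\<^esub>"] by simp
  then have "\<one>\<^bsub>\<AA>\<^esub> \<noteq> \<zero>\<^bsub>\<AA>\<^esub>" using A.trace_one by auto
  then have "carrier \<AA> \<noteq> {\<zero>\<^bsub>\<AA>\<^esub>}" using A.laws(6) by auto
  with \<tau> show "carrier \<AA> \<noteq> {\<zero>\<^bsub>\<AA>\<^esub>} \<and> (\<exists>\<tau>. tracial_state \<AA> \<tau> \<and>
      (\<forall>x y a b. complex_of_real (p a b x y) = \<tau> (e x a \<otimes>\<^bsub>\<AA>\<^esub> f y b)))" by blast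
next
  assume "carrier \<AA> \<noteq> {\<zero>\<^bsub>\<AA>\<^esub>} \<and> (\<exists>\<tau>. tracial_state \<AA> \<tau> \<and>
      (\<forall>x y a b. complex_of_real (p a b x y) = \<tau> (e x a \<otimes>\<^bsub>\<AA>\<^esub> f y b)))"
  then obtain \<tau> where "tracial_state \<AA> \<tau>"
    "\<And>x y a b. complex_of_real (p a b x y) = \<tau> (e x a \<otimes>\<^bsub>\<AA>\<^esub> f y b)" by blast
  moreover have "unital_cstar_algebra \<AA>" "game_relations lam \<AA> e f"
    using assms(5) by (simp_all add: is_game_cstar_algebra_def)
  ultimately show "p \<in> qc_game_correlations TYPE('h) lam"
    using qc_correlation_of_tracial_state assms(2) by blast
qed

end
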